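(* Let $1\le p<\infty$, let $(\Omega,\Sigma,\mu)$ be a measure space for which there is a sequence $(\Omega_n)_{n\in\mathbb N}$ of pairwise disjoint sets in $\Sigma$ with $0<\mu(\Omega_n)<\infty$ for all $n$, and let $X$ be a Banach space with the bounded approximation property. Then the Banach algebra $\mathcal A(L_p(\mu,X))$ is weakly amenable.
   Context: $L_p(\mu,X)$ is the Banach space of (classes of) Bochner $p$-integrable $X$-valued functions on $\Omega$. For a Banach space $E$, $\mathcal A(E)$ is the Banach algebra (operator norm) of approximable operators on $E$, i.e. the operator-norm closure of the finite rank bounded operators. A Banach algebra $\mathfrak A$ is weakly amenable if every bounded derivation $D\colon\mathfrak A\to\mathfrak A^*$ is inner, where $\mathfrak A^*$ has the dual $\mathfrak A$-bimodule structure. *)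

theory Defs
  imports "HOL-Analysis.Analysis"
begin

section \<open>Scalars\<close>

text \<open>The theorem is about Banach spaces over the real or over the complex numbers. The
  following class has exactly these two fields (with their usual absolute value) as models.\<close>

class real_or_complex = real_normed_field +
  assumes real_or_complex:
    "(\<forall>z. \<exists>a. z = a *\<^sub>R 1) \<or>
     (\<exists>i. i * i = - 1 \<and> (\<forall>a b. norm (a *\<^sub>R 1 + b *\<^sub>R i) = sqrt (a\<^sup>2 + b\<^sup>2)) \<and>
          (\<forall>z. \<exists>a b. z = a *\<^sub>R 1 + b *\<^sub>R i))"

instance real :: real_or_complex
  by standard simp

instance complex :: real_or_complex
proof
  have "\<i> * \<i> = - 1" "norm (a *\<^sub>R 1 + b *\<^sub>R \<i>) = sqrt (a\<^sup>2 + b\<^sup>2)"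
    "z = Re z *\<^sub>R 1 + Im z *\<^sub>R \<i>" for a b z
    by (simp_all add: cmod_def complex_eq_iff)
  then show "(\<forall>z::complex. \<exists>a. z = a *\<^sub>R 1) \<or>
     (\<exists>i::complex. i * i = - 1 \<and> (\<forall>a b. norm (a *\<^sub>R 1 + b *\<^sub>R i) = sqrt (a\<^sup>2 + b\<^sup>2)) \<and>
          (\<forall>z. \<exists>a b. z = a *\<^sub>R 1 + b *\<^sub>R i))"
    by blast
qed

text \<open>A Banach space over the field \<open>'k\<close> whose underlying real Banach space is the type \<open>'x\<close>.
  For \<open>'k = real\<close> the scalar multiplication is necessarily \<^const>\<open>scaleR\<close>.\<close>

locale banach_space_over = vector_space smul
  for smul :: "'k::real_or_complex \<Rightarrow> 'x::banach \<Rightarrow> 'x" +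
  assumes norm_scale: "norm (smul c x) = norm c * norm x"
    and scale_of_real: "smul (of_real r) x = r *\<^sub>R x"


section \<open>Normed spaces and normed algebras with explicit carriers\<close>

text \<open>\<open>L\<^sub>p(\<mu>, X)\<close> depends on the measure and on \<open>p\<close>, hence is not a type; it and the spaces built
  from it are records with explicit carriers.\<close>

record ('k, 'e) normed_space =
  ns_carrier :: "'e set"
  ns_zero :: 'e
  ns_add :: "'e \<Rightarrow> 'e \<Rightarrow> 'e"
  ns_scale :: "'k \<Rightarrow> 'e \<Rightarrow> 'e"
  ns_norm :: "'e \<Rightarrow> real"

record ('k, 'e) normed_algebra = "('k, 'e) normed_space" +
  na_mult :: "'e \<Rightarrow> 'e \<Rightarrow> 'e"

definition ns_diff :: "('k::real_normed_field, 'e, 'z) normed_space_scheme \<Rightarrow> 'e \<Rightarrow> 'e \<Rightarrow> 'e" where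
  "ns_diff E x y = ns_add E x (ns_scale E (- 1) y)"

definition type_space :: "('k \<Rightarrow> 'x \<Rightarrow> 'x) \<Rightarrow> ('k, 'x::real_normed_vector) normed_space" where
  "type_space smul =
     \<lparr>ns_carrier = UNIV, ns_zero = 0, ns_add = (+), ns_scale = smul, ns_norm = norm\<rparr>"

definition ns_subspace :: "('k, 'e, 'z) normed_space_scheme \<Rightarrow> 'e set \<Rightarrow> bool" where
  "ns_subspace E W \<longleftrightarrow> W \<subseteq> ns_carrier E \<and> ns_zero E \<in> W \<and>
     (\<forall>x\<in>W. \<forall>y\<in>W. ns_add E x y \<in> W) \<and> (\<forall>c. \<forall>x\<in>W. ns_scale E c x \<in> W)"

definition ns_linear :: "('k, 'e, 'z) normed_space_scheme \<Rightarrow> ('k, 'f, 'y) normed_space_scheme \<Rightarrow>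
    ('e \<Rightarrow> 'f) \<Rightarrow> bool" where
  "ns_linear E F T \<longleftrightarrow> T \<in> ns_carrier E \<rightarrow> ns_carrier F \<and>
     (\<forall>x\<in>ns_carrier E. \<forall>y\<in>ns_carrier E. T (ns_add E x y) = ns_add F (T x) (T y)) \<and>
     (\<forall>c. \<forall>x\<in>ns_carrier E. T (ns_scale E c x) = ns_scale F c (T x))"

definition op_norm :: "('k, 'e, 'z) normed_space_scheme \<Rightarrow> ('k, 'f, 'y) normed_space_scheme \<Rightarrow>
    ('e \<Rightarrow> 'f) \<Rightarrow> real" where
  "op_norm E F T = Inf {C. 0 \<le> C \<and> (\<forall>x\<in>ns_carrier E. ns_norm F (T x) \<le> C * ns_norm E x)}"

text \<open>The space of bounded operators. Operators are kept undefined off the carrier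
  (\<^const>\<open>extensional\<close>), so that equality of operators is equality on the carrier.\<close>

definition bounded_op_space :: "('k, 'e, 'z) normed_space_scheme \<Rightarrow>
    ('k, 'f, 'y) normed_space_scheme \<Rightarrow> ('k, 'e \<Rightarrow> 'f) normed_space" where
  "bounded_op_space E F =
     \<lparr>ns_carrier = {T \<in> extensional (ns_carrier E). ns_linear E F T \<and>
        (\<exists>C. \<forall>x\<in>ns_carrier E. ns_norm F (T x) \<le> C * ns_norm E x)},
      ns_zero = (\<lambda>x\<in>ns_carrier E. ns_zero F),
      ns_add = (\<lambda>S T. \<lambda>x\<in>ns_carrier E. ns_add F (S x) (T x)),
      ns_scale = (\<lambda>c T. \<lambda>x\<in>ns_carrier E. ns_scale F c (T x)),
      ns_norm = op_norm E F\<rparr>"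

definition dual_space :: "('k::real_normed_field, 'e, 'z) normed_space_scheme \<Rightarrow>
    ('k, 'e \<Rightarrow> 'k) normed_space" where
  "dual_space E = bounded_op_space E (type_space (*))"

definition finite_rank_ops :: "('k, 'e, 'z) normed_space_scheme \<Rightarrow>
    ('k, 'f, 'y) normed_space_scheme \<Rightarrow> ('e \<Rightarrow> 'f) set" where
  "finite_rank_ops E F = {T \<in> ns_carrier (bounded_op_space E F).
     \<exists>B. finite B \<and> B \<subseteq> ns_carrier F \<and> T ` ns_carrier E \<subseteq> ns_subspace F hull B}"

definition approximable_ops :: "('k::real_normed_field, 'e, 'z) normed_space_scheme \<Rightarrow>
    ('e \<Rightarrow> 'e) set" where
  "approximable_ops E = {T \<in> ns_carrier (bounded_op_space E E).
     \<forall>\<epsilon>>0. \<exists>F\<in>finite_rank_ops E E. op_norm E E (ns_diff (bounded_op_space E E) T F) < \<epsilon>}"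

definition approximable_algebra :: "('k::real_normed_field, 'e, 'z) normed_space_scheme \<Rightarrow>
    ('k, 'e \<Rightarrow> 'e) normed_algebra" where
  "approximable_algebra E =
     \<lparr>ns_carrier = approximable_ops E,
      ns_zero = ns_zero (bounded_op_space E E),
      ns_add = ns_add (bounded_op_space E E),
      ns_scale = ns_scale (bounded_op_space E E),
      ns_norm = op_norm E E,
      na_mult = compose (ns_carrier E)\<rparr>"


section \<open>Weak amenability\<close>

text \<open>The dual bimodule structure: \<open>(a \<cdot> \<phi>)(b) = \<phi>(b a)\<close> and \<open>(\<phi> \<cdot> a)(b) = \<phi>(a b)\<close>.\<close>

definition dual_left_act :: "('k, 'a, 'z) normed_algebra_scheme \<Rightarrow> 'a \<Rightarrow> ('a \<Rightarrow> 'k) \<Rightarrow> ('a \<Rightarrow> 'k)" where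
  "dual_left_act A a \<phi> = (\<lambda>b\<in>ns_carrier A. \<phi> (na_mult A b a))"

definition dual_right_act :: "('k, 'a, 'z) normed_algebra_scheme \<Rightarrow> ('a \<Rightarrow> 'k) \<Rightarrow> 'a \<Rightarrow> ('a \<Rightarrow> 'k)" where
  "dual_right_act A \<phi> a = (\<lambda>b\<in>ns_carrier A. \<phi> (na_mult A a b))"

definition bounded_dual_derivation :: "('k::real_normed_field, 'a, 'z) normed_algebra_scheme \<Rightarrow>
    ('a \<Rightarrow> 'a \<Rightarrow> 'k) \<Rightarrow> bool" where
  "bounded_dual_derivation A D \<longleftrightarrow>
     D \<in> ns_carrier (bounded_op_space A (dual_space A)) \<and>
     (\<forall>a\<in>ns_carrier A. \<forall>b\<in>ns_carrier A.
        D (na_mult A a b) =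
          ns_add (dual_space A) (dual_left_act A a (D b)) (dual_right_act A (D a) b))"

definition inner_dual_derivation :: "('k::real_normed_field, 'a, 'z) normed_algebra_scheme \<Rightarrow>
    ('a \<Rightarrow> 'a \<Rightarrow> 'k) \<Rightarrow> bool" where
  "inner_dual_derivation A D \<longleftrightarrow>
     (\<exists>\<phi>\<in>ns_carrier (dual_space A). \<forall>a\<in>ns_carrier A.
        D a = ns_diff (dual_space A) (dual_left_act A a \<phi>) (dual_right_act A \<phi> a))"

definition weakly_amenable :: "('k::real_normed_field, 'a, 'z) normed_algebra_scheme \<Rightarrow> bool" where
  "weakly_amenable A \<longleftrightarrow> (\<forall>D. bounded_dual_derivation A D \<longrightarrow> inner_dual_derivation A D)"


section \<open>The bounded approximation property\<close>

definition bounded_approximation_property ::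
    "('k::real_or_complex \<Rightarrow> 'x::banach \<Rightarrow> 'x) \<Rightarrow> bool" where
  "bounded_approximation_property smul \<longleftrightarrow>
     (\<exists>\<Lambda>. \<forall>K \<epsilon>. compact K \<and> 0 < \<epsilon> \<longrightarrow>
        (\<exists>T\<in>finite_rank_ops (type_space smul) (type_space smul).
           op_norm (type_space smul) (type_space smul) T \<le> \<Lambda> \<and> (\<forall>x\<in>K. norm (T x - x) \<le> \<epsilon>)))"


section \<open>The space of Bochner p-integrable functions\<close>

text \<open>Strong measurability: pointwise limit of simple functions. The library's
  \<^const>\<open>borel_measurable\<close> does not suffice since \<open>'x\<close> need not be separable. Functions which are
  only almost everywhere limits of simple functions give the same classes below.\<close>

definition strongly_measurable :: "'w measure \<Rightarrow> ('w \<Rightarrow> 'x::real_normed_vector) \<Rightarrow> bool" where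
  "strongly_measurable M f \<longleftrightarrow>
     (\<exists>s. (\<forall>n. simple_function M (s n)) \<and> (\<forall>x\<in>space M. (\<lambda>n::nat. s n x) \<longlonglongrightarrow> f x))"

definition Lp_functions :: "real \<Rightarrow> 'w measure \<Rightarrow> ('w \<Rightarrow> 'x::real_normed_vector) set" where
  "Lp_functions p M = {f. strongly_measurable M f \<and> integrable M (\<lambda>x. norm (f x) powr p)}"

definition Lp_rel :: "real \<Rightarrow> 'w measure \<Rightarrow> (('w \<Rightarrow> 'x::real_normed_vector) \<times> ('w \<Rightarrow> 'x)) set" where
  "Lp_rel p M = {(f, g). f \<in> Lp_functions p M \<and> g \<in> Lp_functions p M \<and> (AE x in M. f x = g x)}"

definition Lp_norm :: "real \<Rightarrow> 'w measure \<Rightarrow> ('w \<Rightarrow> 'x::real_normed_vector) \<Rightarrow> real" where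
  "Lp_norm p M f = (\<integral>x. norm (f x) powr p \<partial>M) powr (1 / p)"

definition Lp_space :: "real \<Rightarrow> 'w measure \<Rightarrow> ('k \<Rightarrow> 'x::banach \<Rightarrow> 'x) \<Rightarrow>
    ('k, ('w \<Rightarrow> 'x) set) normed_space" where
  "Lp_space p M smul =
     \<lparr>ns_carrier = Lp_functions p M // Lp_rel p M,
      ns_zero = Lp_rel p M `` {\<lambda>x. 0},
      ns_add = (\<lambda>U V. \<Union>f\<in>U. \<Union>g\<in>V. Lp_rel p M `` {\<lambda>x. f x + g x}),
      ns_scale = (\<lambda>c U. \<Union>f\<in>U. Lp_rel p M `` {\<lambda>x. smul c (f x)}),
      ns_norm = (\<lambda>U. the_elem (Lp_norm p M ` U))\<rparr>"

text \<open>The operations on classes are the ones induced by the operations on functions.\<close>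

lemma strongly_measurable_imp_borel:
  assumes "strongly_measurable M f" shows "f \<in> borel_measurable M"
proof -
  obtain s where s: "\<And>n. simple_function M (s n)" "\<And>x. x \<in> space M \<Longrightarrow> (\<lambda>n::nat. s n x) \<longlonglongrightarrow> f x"
    using assms unfolding strongly_measurable_def by blast
  show ?thesis
    using borel_measurable_simple_function[OF s(1)] s(2) by (rule borel_measurable_LIMSEQ_metric)
qed

lemma strongly_measurable_add:
  assumes "strongly_measurable M f" "strongly_measurable M g"
  shows "strongly_measurable M (\<lambda>x. f x + g x)"
proof -
  obtain s where s: "\<And>n. simple_function M (s n)" "\<And>x. x \<in> space M \<Longrightarrow> (\<lambda>n::nat. s n x) \<longlonglongrightarrow> f x"
    using assms(1) unfolding strongly_measurable_def by blast
  obtain t where t: "\<And>n. simple_function M (t n)" "\<And>x. x \<in> space M \<Longrightarrow> (\<lambda>n::nat. t n x) \<longlonglongrightarrow> g x"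
    using assms(2) unfolding strongly_measurable_def by blast
  show ?thesis unfolding strongly_measurable_def
  proof (intro exI conjI allI ballI)
    show "simple_function M (\<lambda>x. s n x + t n x)" for n
      using s(1) t(1) by (rule simple_function_compose2)
    show "(\<lambda>n. s n x + t n x) \<longlonglongrightarrow> f x + g x" if "x \<in> space M" for x
      using s(2) t(2) that by (intro tendsto_add)
  qed
qed

lemma Lp_functions_add:
  assumes f: "f \<in> Lp_functions p M" and g: "g \<in> Lp_functions p M" and p: "1 \<le> p"
  shows "(\<lambda>x. f x + g x) \<in> Lp_functions p M"
proof -
  have sm: "strongly_measurable M (\<lambda>x. f x + g x)"
    using f g by (auto simp: Lp_functions_def intro: strongly_measurable_add)
  have [measurable]: "(\<lambda>x. f x + g x) \<in> borel_measurable M"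
    by (rule strongly_measurable_imp_borel[OF sm])
  have bound: "norm (f x + g x) powr p \<le> 2 powr p * (norm (f x) powr p + norm (g x) powr p)" for x
  proof -
    let ?m = "max (norm (f x)) (norm (g x))"
    have "norm (f x + g x) \<le> norm (f x) + norm (g x)"
      by (rule norm_triangle_ineq)
    also have "\<dots> \<le> 2 * ?m"
      by linarith
    finally have "norm (f x + g x) powr p \<le> (2 * ?m) powr p"
      using p by (intro powr_mono2) simp_all
    also have "\<dots> = 2 powr p * ?m powr p"
      by (rule powr_mult)
    also have "\<dots> \<le> 2 powr p * (norm (f x) powr p + norm (g x) powr p)"
      by (rule mult_left_mono) (simp_all add: max_def)
    finally show ?thesis .
  qed
  have "integrable M (\<lambda>x. norm (f x + g x) powr p)"
  proof (rule Bochner_Integration.integrable_bound)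
    show "integrable M (\<lambda>x. 2 powr p * (norm (f x) powr p + norm (g x) powr p))"
      using f g by (auto simp: Lp_functions_def)
    show "(\<lambda>x. norm (f x + g x) powr p) \<in> borel_measurable M"
      by measurable
    show "AE x in M. norm (norm (f x + g x) powr p)
        \<le> norm (2 powr p * (norm (f x) powr p + norm (g x) powr p))"
      using order_trans[OF bound abs_ge_self] by (intro AE_I2) simp
  qed
  with sm show ?thesis by (simp add: Lp_functions_def)
qed

lemma (in banach_space_over) Lp_functions_scale:
  assumes f: "f \<in> Lp_functions p M"
  shows "(\<lambda>x. smul c (f x)) \<in> Lp_functions p M"
proof -
  obtain s where s: "\<And>n. simple_function M (s n)" "\<And>x. x \<in> space M \<Longrightarrow> (\<lambda>n::nat. s n x) \<longlonglongrightarrow> f x"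
    using f unfolding Lp_functions_def strongly_measurable_def by blast
  have lin: "bounded_linear (smul c)"
  proof (rule bounded_linear_intro[where K = "norm c"])
    show "smul c (r *\<^sub>R x) = r *\<^sub>R smul c x" for r x
      by (metis mult.commute scale_of_real scale_scale)
  qed (simp_all add: scale_right_distrib norm_scale mult.commute)
  have "strongly_measurable M (\<lambda>x. smul c (f x))"
    unfolding strongly_measurable_def
  proof (intro exI conjI allI ballI)
    show "simple_function M (\<lambda>x. smul c (s n x))" for n
      by (rule simple_function_compose1[OF s(1)])
    show "(\<lambda>n. smul c (s n x)) \<longlonglongrightarrow> smul c (f x)" if "x \<in> space M" for x
      using lin s(2)[OF that] by (rule bounded_linear.tendsto)
  qed
  moreover have "integrable M (\<lambda>x. norm (smul c (f x)) powr p)"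
    using f by (simp add: Lp_functions_def norm_scale powr_mult)
  ultimately show ?thesis by (simp add: Lp_functions_def)
qed

lemma equiv_Lp_rel:
  "equiv (Lp_functions p M :: ('w \<Rightarrow> 'x::real_normed_vector) set) (Lp_rel p M)"
  (is "equiv ?F ?R")
proof (rule equivI)
  show "?R \<subseteq> ?F \<times> ?F"
    by (auto simp: Lp_rel_def)
  show "refl_on ?F ?R"
    by (simp add: Lp_rel_def refl_on_def)
  show "sym ?R"
  proof (rule symI)
    fix f g assume "(f, g) \<in> ?R"
    then have *: "f \<in> ?F" "g \<in> ?F" and fg: "AE x in M. f x = g x"
      by (simp_all add: Lp_rel_def)
    from fg have "AE x in M. g x = f x" by eventually_elim simp
    with * show "(g, f) \<in> ?R" by (simp add: Lp_rel_def)
  qed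
  show "trans ?R"
  proof (rule transI)
    fix f g h assume "(f, g) \<in> ?R" "(g, h) \<in> ?R"
    then have *: "f \<in> ?F" "h \<in> ?F"
      and fg: "AE x in M. f x = g x" and gh: "AE x in M. g x = h x"
      by (simp_all add: Lp_rel_def)
    from fg gh have "AE x in M. f x = h x" by eventually_elim simp
    with * show "(f, h) \<in> ?R" by (simp add: Lp_rel_def)
  qed
qed

lemma Lp_space_add_class:
  fixes f g :: "'w \<Rightarrow> 'x::banach"
  assumes "1 \<le> p" "f \<in> Lp_functions p M" "g \<in> Lp_functions p M"
  shows "ns_add (Lp_space p M smul) (Lp_rel p M `` {f}) (Lp_rel p M `` {g}) =
    Lp_rel p M `` {\<lambda>x. f x + g x}"
proof -
  have "congruent2 (Lp_rel p M) (Lp_rel p M) (\<lambda>(f :: 'w \<Rightarrow> 'x) g. Lp_rel p M `` {\<lambda>x. f x + g x})"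
  proof (rule congruent2I')
    fix f f' g g' :: "'w \<Rightarrow> 'x"
    assume "(f, f') \<in> Lp_rel p M" "(g, g') \<in> Lp_rel p M"
    then have *: "f \<in> Lp_functions p M" "f' \<in> Lp_functions p M" "g \<in> Lp_functions p M"
        "g' \<in> Lp_functions p M" and ff: "AE x in M. f x = f' x" and gg: "AE x in M. g x = g' x"
      by (simp_all add: Lp_rel_def)
    from ff gg have "AE x in M. f x + g x = f' x + g' x" by eventually_elim simp
    with * assms(1) have "((\<lambda>x. f x + g x), (\<lambda>x. f' x + g' x)) \<in> Lp_rel p M"
      by (simp add: Lp_rel_def Lp_functions_add)
    then show "Lp_rel p M `` {\<lambda>x. f x + g x} = Lp_rel p M `` {\<lambda>x. f' x + g' x}"
      by (rule equiv_class_eq[OF equiv_Lp_rel])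
  qed
  from UN_equiv_class2[OF equiv_Lp_rel equiv_Lp_rel this assms(2,3)]
  show ?thesis by (simp add: Lp_space_def)
qed

lemma (in banach_space_over) Lp_space_scale_class:
  fixes f :: "'w \<Rightarrow> 'x"
  assumes "f \<in> Lp_functions p M"
  shows "ns_scale (Lp_space p M smul) c (Lp_rel p M `` {f}) = Lp_rel p M `` {\<lambda>x. smul c (f x)}"
proof -
  have "(\<lambda>f :: 'w \<Rightarrow> 'x. Lp_rel p M `` {\<lambda>x. smul c (f x)}) respects Lp_rel p M"
  proof (rule congruentI)
    fix f f' :: "'w \<Rightarrow> 'x"
    assume "(f, f') \<in> Lp_rel p M"
    then have *: "f \<in> Lp_functions p M" "f' \<in> Lp_functions p M" and ff: "AE x in M. f x = f' x"
      by (simp_all add: Lp_rel_def)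
    from ff have "AE x in M. smul c (f x) = smul c (f' x)" by eventually_elim simp
    with * have "((\<lambda>x. smul c (f x)), (\<lambda>x. smul c (f' x))) \<in> Lp_rel p M"
      by (simp add: Lp_rel_def Lp_functions_scale)
    then show "Lp_rel p M `` {\<lambda>x. smul c (f x)} = Lp_rel p M `` {\<lambda>x. smul c (f' x)}"
      by (rule equiv_class_eq[OF equiv_Lp_rel])
  qed
  from UN_equiv_class[OF equiv_Lp_rel this assms]
  show ?thesis by (simp add: Lp_space_def)
qed

lemma Lp_space_norm_class:
  assumes "f \<in> Lp_functions p M"
  shows "ns_norm (Lp_space p M smul) (Lp_rel p M `` {f}) = Lp_norm p M f"
proof -
  have eq: "Lp_norm p M g = Lp_norm p M f" if "(f, g) \<in> Lp_rel p M" for g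
  proof -
    have meas: "(\<lambda>x. norm (f x) powr p) \<in> borel_measurable M"
        "(\<lambda>x. norm (g x) powr p) \<in> borel_measurable M"
      and fg: "AE x in M. f x = g x"
      using that by (simp_all add: Lp_rel_def Lp_functions_def borel_measurable_integrable)
    from fg have "AE x in M. norm (f x) powr p = norm (g x) powr p"
      by eventually_elim simp
    with meas have "(\<integral>x. norm (f x) powr p \<partial>M) = (\<integral>x. norm (g x) powr p \<partial>M)"
      by (rule integral_cong_AE)
    then show ?thesis by (simp add: Lp_norm_def)
  qed
  have "f \<in> Lp_rel p M `` {f}"
    by (rule equiv_class_self[OF equiv_Lp_rel assms])
  then have "Lp_norm p M ` (Lp_rel p M `` {f}) = {Lp_norm p M f}"
    using eq by blast
  then show ?thesis by (simp add: Lp_space_def)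
qed

end

theory Submission
  imports Defs
begin

text \<open>
Let \<open>A\<close> be a normed algebra and \<open>D\<close> a bounded derivation from \<open>A\<close> into its dual. A functional \<open>\<phi>\<close>
implements \<open>D\<close> iff \<open>D(a)(b) = \<phi>(b a) - \<phi>(a b)\<close>. If \<open>u v\<close> is a left unit for \<open>a\<close> and \<open>b\<close>, then the
functional \<open>\<phi>(c) = D(v c)(u)\<close> almost does this: the derivation identity gives

\<open>D(v b a)(u) - D(v a b)(u) = D(a)(b) - D(v a u)(v b u)\<close>.

The last term can be averaged away when there are many pairs \<open>(u\<^sub>k, v\<^sub>k)\<close> whose compressions \<open>v\<^sub>k a u\<^sub>k\<close>
do not interact, in the sense that all signed sums \<open>\<Sum>\<^sub>k \<plusminus> v\<^sub>k a u\<^sub>k\<close> have norm at most \<open>K \<parallel>a\<parallel>\<close>: averaging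
\<open>D(\<Sum>\<^sub>k \<epsilon>\<^sub>k v\<^sub>k a u\<^sub>k)(\<Sum>\<^sub>k \<epsilon>\<^sub>k v\<^sub>k b u\<^sub>k)\<close> over all signs leaves exactly \<open>\<Sum>\<^sub>k D(v\<^sub>k a u\<^sub>k)(v\<^sub>k b u\<^sub>k)\<close>, which
is therefore bounded independently of the number \<open>n\<close> of pairs. So the mean over \<open>k < n\<close> of the
functionals \<open>c \<mapsto> D(v\<^sub>k c)(u\<^sub>k)\<close> implements \<open>D\<close> at \<open>a\<close> and \<open>b\<close> up to \<open>O(1/n)\<close>. These means are uniformly
bounded, and by Tychonoff's theorem they have a cluster point, which implements \<open>D\<close>. This is
\<open>weakly_amenable_if_amplified_factorizations\<close>.

For approximable operators on a space \<open>E\<close> it suffices that \<open>u\<^sub>k v\<^sub>k\<close> is nearly the identity at finitely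
many given points of \<open>E\<close>, because a finite rank operator only sees a finite-dimensional subspace, on
which the coefficients with respect to a spanning family can be chosen bounded by the norm
(\<open>bounded_coefficients\<close>).

For \<open>E = L\<^sub>p(\<mu>, X)\<close> finitely many elements are nearly step functions over one family of disjoint cells
\<open>A\<^sub>0, \<dots>, A\<^bsub>m-1\<^esub>\<close> of finite measure. The operator \<open>v\<^sub>k\<close> averages a function over each \<open>A\<^sub>j\<close>, applies to the
average a finite rank operator \<open>T\<close> on \<open>X\<close> that almost fixes the finitely many relevant values (this is
where the bounded approximation property is used), and spreads the result, suitably normalised, over
\<open>\<Omega>\<^bsub>km+j\<^esub>\<close>; the operator \<open>u\<^sub>k\<close> goes back in the same way. Both have norm at most the approximation
constant, whatever \<open>m\<close> and \<open>k\<close> are. As different \<open>k\<close> use disjoint blocks of the sets \<open>\<Omega>\<^sub>i\<close>, the signed sums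
are bounded by \<open>\<ell>\<^sub>p\<close>-orthogonality of functions with disjoint supports (\<open>signed_block_sum_le\<close>).
\<close>

section \<open>Compact sets of scalar functions\<close>

lemma compact_cball_real_or_complex: "compact (cball (0::'k::real_or_complex) r)"
proof -
  have "\<exists>i::'k. \<forall>z. norm z \<le> r \<longrightarrow> (\<exists>a b. z = a *\<^sub>R 1 + b *\<^sub>R i \<and> \<bar>a\<bar> \<le> r \<and> \<bar>b\<bar> \<le> r)"
    using real_or_complex[where 'a = 'k]
  proof
    assume real: "\<forall>z::'k. \<exists>a. z = a *\<^sub>R 1"
    have "\<exists>a b. z = a *\<^sub>R 1 + b *\<^sub>R 1 \<and> \<bar>a\<bar> \<le> r \<and> \<bar>b\<bar> \<le> r" if z: "norm z \<le> r" for z :: 'k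
    proof -
      obtain a where a: "z = a *\<^sub>R 1" using real by blast
      have "0 \<le> r" using norm_ge_zero[of z] z by linarith
      then show ?thesis using a z by (intro exI[of _ a] exI[of _ 0]) simp
    qed
    then show ?thesis by blast
  next
    assume "\<exists>i::'k. i * i = - 1 \<and> (\<forall>a b. norm (a *\<^sub>R 1 + b *\<^sub>R i) = sqrt (a\<^sup>2 + b\<^sup>2)) \<and>
          (\<forall>z. \<exists>a b. z = a *\<^sub>R 1 + b *\<^sub>R i)"
    then obtain i :: 'k where i: "\<And>a b. norm (a *\<^sub>R 1 + b *\<^sub>R i) = sqrt (a\<^sup>2 + b\<^sup>2)"
      "\<And>z. \<exists>a b. z = a *\<^sub>R 1 + b *\<^sub>R i" by blast
    have "\<exists>a b. z = a *\<^sub>R 1 + b *\<^sub>R i \<and> \<bar>a\<bar> \<le> r \<and> \<bar>b\<bar> \<le> r" if z: "norm z \<le> r" for z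
    proof -
      obtain a b where ab: "z = a *\<^sub>R 1 + b *\<^sub>R i" using i(2) by blast
      have "sqrt (a\<^sup>2 + b\<^sup>2) \<le> r" using z i(1) ab by simp
      moreover have "\<bar>a\<bar> \<le> sqrt (a\<^sup>2 + b\<^sup>2)" "\<bar>b\<bar> \<le> sqrt (a\<^sup>2 + b\<^sup>2)"
        by (simp_all add: real_le_rsqrt)
      ultimately show ?thesis using ab by (intro exI[of _ a] exI[of _ b]) linarith
    qed
    then show ?thesis by blast
  qed
  then obtain i :: 'k where i:
    "\<And>z. norm z \<le> r \<Longrightarrow> \<exists>a b. z = a *\<^sub>R 1 + b *\<^sub>R i \<and> \<bar>a\<bar> \<le> r \<and> \<bar>b\<bar> \<le> r" by blast
  let ?f = "\<lambda>(a, b). a *\<^sub>R (1::'k) + b *\<^sub>R i"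
  have "compact (?f ` ({-r..r} \<times> {-r..r}))"
    by (intro compact_continuous_image compact_Times)
      (auto intro!: continuous_intros simp: case_prod_beta)
  moreover have "cball 0 r = cball 0 r \<inter> ?f ` ({-r..r} \<times> {-r..r})"
  proof -
    have "z \<in> ?f ` ({-r..r} \<times> {-r..r})" if "norm z \<le> r" for z :: 'k
    proof -
      from i[OF that] obtain a b :: real where "z = a *\<^sub>R 1 + b *\<^sub>R i" "\<bar>a\<bar> \<le> r" "\<bar>b\<bar> \<le> r" by auto
      then show ?thesis by (intro image_eqI[of _ _ "(a, b)"]) auto
    qed
    then show ?thesis by auto
  qed
  ultimately show ?thesis by (metis closed_Int_compact closed_cball)
qed

text \<open>Tychonoff's theorem. It is used for coefficient vectors and for functionals on an algebra,
the latter being regarded as arbitrary scalar functions.\<close>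

lemma compact_bounded_functions:
  "compact {f :: 'i \<Rightarrow> 'k::real_or_complex. \<forall>i. norm (f i) \<le> r i}"
proof -
  have "compactin (product_topology (\<lambda>i. euclidean) UNIV) (PiE UNIV (\<lambda>i. cball (0::'k) (r i)))"
    by (simp add: compactin_PiE compact_cball_real_or_complex)
  then have "compact (PiE UNIV (\<lambda>i. cball (0::'k) (r i)))"
    by (simp add: euclidean_product_topology)
  also have "PiE UNIV (\<lambda>i. cball (0::'k) (r i)) = {f. \<forall>i. norm (f i) \<le> r i}"
    by (auto simp: PiE_iff)
  finally show ?thesis .
qed

section \<open>Normed spaces\<close>

locale normed_space_on =
  fixes E :: "('k::real_normed_field, 'e, 'z) normed_space_scheme"
  assumes zero_closed: "ns_zero E \<in> ns_carrier E"
    and add_closed: "x \<in> ns_carrier E \<Longrightarrow> y \<in> ns_carrier E \<Longrightarrow> ns_add E x y \<in> ns_carrier E"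
    and scale_closed: "x \<in> ns_carrier E \<Longrightarrow> ns_scale E c x \<in> ns_carrier E"
    and add_assoc: "x \<in> ns_carrier E \<Longrightarrow> y \<in> ns_carrier E \<Longrightarrow> z \<in> ns_carrier E \<Longrightarrow>
      ns_add E (ns_add E x y) z = ns_add E x (ns_add E y z)"
    and add_commute: "x \<in> ns_carrier E \<Longrightarrow> y \<in> ns_carrier E \<Longrightarrow> ns_add E x y = ns_add E y x"
    and add_zero: "x \<in> ns_carrier E \<Longrightarrow> ns_add E x (ns_zero E) = x"
    and scale_add: "x \<in> ns_carrier E \<Longrightarrow> y \<in> ns_carrier E \<Longrightarrow>
      ns_scale E c (ns_add E x y) = ns_add E (ns_scale E c x) (ns_scale E c y)"
    and add_scale: "x \<in> ns_carrier E \<Longrightarrow>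
      ns_scale E (c + d) x = ns_add E (ns_scale E c x) (ns_scale E d x)"
    and scale_scale: "x \<in> ns_carrier E \<Longrightarrow> ns_scale E c (ns_scale E d x) = ns_scale E (c * d) x"
    and scale_one: "x \<in> ns_carrier E \<Longrightarrow> ns_scale E 1 x = x"
    and scale_zero: "x \<in> ns_carrier E \<Longrightarrow> ns_scale E 0 x = ns_zero E"
    and norm_triangle: "x \<in> ns_carrier E \<Longrightarrow> y \<in> ns_carrier E \<Longrightarrow>
      ns_norm E (ns_add E x y) \<le> ns_norm E x + ns_norm E y"
    and norm_scale: "x \<in> ns_carrier E \<Longrightarrow> ns_norm E (ns_scale E c x) = norm c * ns_norm E x"
    and norm_eq_zeroD: "x \<in> ns_carrier E \<Longrightarrow> ns_norm E x = 0 \<Longrightarrow> x = ns_zero E"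

text \<open>The carriers are not types, so their sums are defined by recursion over initial segments of the
naturals.\<close>

primrec ns_sum :: "('k, 'e, 'z) normed_space_scheme \<Rightarrow> (nat \<Rightarrow> 'e) \<Rightarrow> nat \<Rightarrow> 'e" where
  "ns_sum E f 0 = ns_zero E"
| "ns_sum E f (Suc n) = ns_add E (ns_sum E f n) (f n)"

lemma ns_sum_cong: "(\<And>k. k < n \<Longrightarrow> f k = g k) \<Longrightarrow> ns_sum E f n = ns_sum E g n"
  by (induction n) auto

context normed_space_on
begin

abbreviation plus (infixl "\<oplus>" 65) where "x \<oplus> y \<equiv> ns_add E x y"
abbreviation minus (infixl "\<ominus>" 65) where "x \<ominus> y \<equiv> ns_diff E x y"
abbreviation scale (infixr "\<odot>" 75) where "c \<odot> x \<equiv> ns_scale E c x"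
abbreviation carr ("V") where "V \<equiv> ns_carrier E"
abbreviation nrm where "nrm \<equiv> ns_norm E"

lemma diff_closed: "x \<in> V \<Longrightarrow> y \<in> V \<Longrightarrow> x \<ominus> y \<in> V"
  by (simp add: ns_diff_def add_closed scale_closed)

lemmas closed = zero_closed add_closed scale_closed diff_closed

lemma zero_add: "x \<in> V \<Longrightarrow> ns_zero E \<oplus> x = x"
  by (metis add_commute add_zero zero_closed)

lemma scale_zero_right: "c \<odot> ns_zero E = ns_zero E"
  by (metis mult_zero_right scale_scale scale_zero zero_closed)

lemma norm_zero: "nrm (ns_zero E) = 0"
  by (metis mult_zero_left norm_scale scale_zero zero_closed norm_zero)

lemma diff_self: "x \<in> V \<Longrightarrow> x \<ominus> x = ns_zero E"
  using add_scale[of x 1 "-1"] by (simp add: ns_diff_def scale_one scale_zero)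

lemma norm_nonneg: "x \<in> V \<Longrightarrow> 0 \<le> nrm x"
  using norm_triangle[of x "(-1) \<odot> x"] diff_self[of x]
  by (simp add: ns_diff_def scale_closed norm_scale norm_zero)

lemma add4: "x \<in> V \<Longrightarrow> y \<in> V \<Longrightarrow> z \<in> V \<Longrightarrow> w \<in> V \<Longrightarrow> (x \<oplus> y) \<oplus> (z \<oplus> w) = (x \<oplus> z) \<oplus> (y \<oplus> w)"
  by (metis add_assoc add_closed add_commute)

lemma add_diff_add: "x \<in> V \<Longrightarrow> y \<in> V \<Longrightarrow> z \<in> V \<Longrightarrow> w \<in> V \<Longrightarrow>
    (x \<oplus> y) \<ominus> (z \<oplus> w) = (x \<ominus> z) \<oplus> (y \<ominus> w)"
  by (simp add: ns_diff_def scale_add add4 scale_closed)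

lemma scale_diff: "x \<in> V \<Longrightarrow> y \<in> V \<Longrightarrow> c \<odot> (x \<ominus> y) = c \<odot> x \<ominus> c \<odot> y"
  by (simp add: ns_diff_def scale_add scale_closed scale_scale)

lemma add_diff_cancel: "x \<in> V \<Longrightarrow> y \<in> V \<Longrightarrow> y \<oplus> (x \<ominus> y) = x"
  by (metis ns_diff_def add_assoc add_commute add_zero diff_closed diff_self scale_closed)

lemma diff_add_cancel: "x \<in> V \<Longrightarrow> y \<in> V \<Longrightarrow> (x \<oplus> y) \<ominus> y = x"
  unfolding ns_diff_def by (metis ns_diff_def add_assoc add_zero diff_self scale_closed)

lemma diff_add_diff: "x \<in> V \<Longrightarrow> y \<in> V \<Longrightarrow> z \<in> V \<Longrightarrow> (x \<ominus> y) \<oplus> (y \<ominus> z) = x \<ominus> z"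
  unfolding ns_diff_def
  by (metis add_assoc add_diff_cancel add_closed add_commute ns_diff_def scale_closed)

lemma norm_triangle_diff: "x \<in> V \<Longrightarrow> y \<in> V \<Longrightarrow> nrm (x \<ominus> y) \<le> nrm x + nrm y"
  using norm_triangle[of x "(-1) \<odot> y"] by (simp add: ns_diff_def scale_closed norm_scale)

lemma norm_diff_commute: "x \<in> V \<Longrightarrow> y \<in> V \<Longrightarrow> nrm (x \<ominus> y) = nrm (y \<ominus> x)"
proof -
  assume xy: "x \<in> V" "y \<in> V"
  have "y \<ominus> x = (-1) \<odot> (x \<ominus> y)"
    using xy by (simp add: ns_diff_def scale_add scale_closed scale_scale scale_one add_commute)
  then show ?thesis using xy by (simp add: norm_scale diff_closed)
qed

lemma sum_closed: "(\<And>k. k < n \<Longrightarrow> f k \<in> V) \<Longrightarrow> ns_sum E f n \<in> V"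
  by (induction n) (auto intro: closed)

lemma sum_add: "(\<And>k. k < n \<Longrightarrow> f k \<in> V) \<Longrightarrow> (\<And>k. k < n \<Longrightarrow> g k \<in> V) \<Longrightarrow>
    ns_sum E (\<lambda>k. f k \<oplus> g k) n = ns_sum E f n \<oplus> ns_sum E g n"
  by (induction n) (simp_all add: add_zero zero_closed add4 sum_closed)

lemma sum_scale: "(\<And>k. k < n \<Longrightarrow> f k \<in> V) \<Longrightarrow>
    ns_sum E (\<lambda>k. c \<odot> f k) n = c \<odot> ns_sum E f n"
  by (induction n) (simp_all add: scale_zero_right scale_add sum_closed)

lemma norm_sum: "(\<And>k. k < n \<Longrightarrow> f k \<in> V) \<Longrightarrow> nrm (ns_sum E f n) \<le> (\<Sum>k<n. nrm (f k))"
proof (induction n)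
  case (Suc n)
  then have "nrm (ns_sum E f n \<oplus> f n) \<le> nrm (ns_sum E f n) + nrm (f n)"
    by (intro norm_triangle sum_closed) auto
  with Suc show ?case by force
qed (simp add: norm_zero)

lemma subspace_hull: "B \<subseteq> V \<Longrightarrow> ns_subspace E (ns_subspace E hull B)"
proof -
  assume B: "B \<subseteq> V"
  have V: "ns_subspace E V" by (auto simp: ns_subspace_def closed)
  have "ns_subspace E hull B \<subseteq> V" using B V by (rule hull_minimal)
  then show ?thesis unfolding ns_subspace_def hull_def by auto
qed

text \<open>A single vector as a linear combination; it shows that the linear combinations of a family form
a subspace containing the family.\<close>

lemma sum_delta:
  "(\<And>i. b i \<in> V) \<Longrightarrow> ns_sum E (\<lambda>i. (if i = j then 1 else 0) \<odot> b i) n = (if j < n then b j else ns_zero E)"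
proof (induction n)
  case (Suc n)
  then show ?case
    by (cases "n = j") (simp_all add: scale_one scale_zero add_zero zero_add zero_closed less_Suc_eq)
qed simp

lemma hull_linear_combination:
  assumes b: "\<And>i. b i \<in> V" and w: "w \<in> ns_subspace E hull (b ` {..<n})"
  shows "\<exists>c. w = ns_sum E (\<lambda>i. c i \<odot> b i) n"
proof -
  let ?W = "range (\<lambda>c. ns_sum E (\<lambda>i. c i \<odot> b i) n)"
  have sub: "ns_subspace E ?W"
    unfolding ns_subspace_def
  proof (intro conjI ballI allI)
    show "?W \<subseteq> V" using b by (auto intro!: sum_closed closed)
    have "ns_sum E (\<lambda>i. 0 \<odot> b i) n = ns_zero E"
      using sum_scale[of n b 0] b by (simp add: scale_zero sum_closed)
    then show "ns_zero E \<in> ?W" by (intro range_eqI) (rule sym)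
  next
    fix x y assume "x \<in> ?W" "y \<in> ?W"
    then obtain c d where "x = ns_sum E (\<lambda>i. c i \<odot> b i) n" "y = ns_sum E (\<lambda>i. d i \<odot> b i) n" by auto
    then have "x \<oplus> y = ns_sum E (\<lambda>i. (c i + d i) \<odot> b i) n"
      using b by (simp add: sum_add[symmetric] add_scale scale_closed)
    then show "x \<oplus> y \<in> ?W" by (intro range_eqI)
  next
    fix e x assume "x \<in> ?W"
    then obtain c where "x = ns_sum E (\<lambda>i. c i \<odot> b i) n" by auto
    then have "e \<odot> x = ns_sum E (\<lambda>i. (e * c i) \<odot> b i) n"
      using b by (simp add: sum_scale[symmetric] scale_scale scale_closed)
    then show "e \<odot> x \<in> ?W" by (intro range_eqI)
  qed
  have "b ` {..<n} \<subseteq> ?W"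
  proof
    fix x assume "x \<in> b ` {..<n}"
    then obtain j where "j < n" "x = b j" by auto
    then have "x = ns_sum E (\<lambda>i. (if i = j then 1 else 0) \<odot> b i) n" using b sum_delta by simp
    then show "x \<in> ?W" by (intro range_eqI)
  qed
  then have "ns_subspace E hull (b ` {..<n}) \<subseteq> ?W" using sub by (rule hull_minimal)
  with w show ?thesis by auto
qed

end

section \<open>Bounded operators\<close>

lemma ns_linear_closed: "ns_linear E F T \<Longrightarrow> x \<in> ns_carrier E \<Longrightarrow> T x \<in> ns_carrier F"
  by (auto simp: ns_linear_def)

lemma ns_linear_sum:
  assumes "normed_space_on E" "normed_space_on F" "ns_linear E F T" "\<And>k. k < n \<Longrightarrow> f k \<in> ns_carrier E"
  shows "T (ns_sum E f n) = ns_sum F (\<lambda>k. T (f k)) n"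
proof -
  interpret E: normed_space_on E by fact
  interpret F: normed_space_on F by fact
  have 0: "T (ns_zero E) = ns_zero F"
    by (metis E.scale_zero E.zero_closed F.scale_zero assms(3) ns_linear_closed ns_linear_def)
  show ?thesis using assms(4)
  proof (induction n)
    case (Suc n)
    then show ?case using assms(3) E.sum_closed[of n f] by (simp add: ns_linear_def)
  qed (simp add: 0)
qed

abbreviation bounded_ops where "bounded_ops E F \<equiv> ns_carrier (bounded_op_space E F)"

lemma bounded_ops_iff: "T \<in> bounded_ops E F \<longleftrightarrow> T \<in> extensional (ns_carrier E) \<and> ns_linear E F T \<and>
        (\<exists>C. \<forall>x\<in>ns_carrier E. ns_norm F (T x) \<le> C * ns_norm E x)"
  by (simp add: bounded_op_space_def)

lemma bounded_ops_linear: "T \<in> bounded_ops E F \<Longrightarrow> ns_linear E F T"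
  by (simp add: bounded_ops_iff)

lemma bounded_ops_closed: "T \<in> bounded_ops E F \<Longrightarrow> x \<in> ns_carrier E \<Longrightarrow> T x \<in> ns_carrier F"
  by (rule ns_linear_closed[OF bounded_ops_linear])

lemma bounded_op_space_simps:
  "ns_zero (bounded_op_space E F) = (\<lambda>x\<in>ns_carrier E. ns_zero F)"
  "ns_add (bounded_op_space E F) S T = (\<lambda>x\<in>ns_carrier E. ns_add F (S x) (T x))"
  "ns_scale (bounded_op_space E F) c T = (\<lambda>x\<in>ns_carrier E. ns_scale F c (T x))"
  "ns_norm (bounded_op_space E F) = op_norm E F"
  "ns_diff (bounded_op_space E F) S T = (\<lambda>x\<in>ns_carrier E. ns_diff F (S x) (T x))"
  by (auto simp: bounded_op_space_def ns_diff_def)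

lemma op_norm_le:
  assumes "0 \<le> C" "\<And>x. x \<in> ns_carrier E \<Longrightarrow> ns_norm F (T x) \<le> C * ns_norm E x"
  shows "op_norm E F T \<le> C"
  unfolding op_norm_def by (rule cInf_lower) (use assms in \<open>auto intro!: bdd_belowI[of _ 0]\<close>)

context
  fixes E :: "('k::real_normed_field, 'e, 'z) normed_space_scheme"
    and F :: "('k, 'f, 'y) normed_space_scheme"
  assumes E: "normed_space_on E" and F: "normed_space_on F"
begin

interpretation E: normed_space_on E by (rule E)
interpretation F: normed_space_on F by (rule F)

lemma op_norm_bound_ex:
  assumes "T \<in> bounded_ops E F"
  shows "\<exists>C\<ge>0. \<forall>x\<in>ns_carrier E. ns_norm F (T x) \<le> C * ns_norm E x"
proof -
  obtain C where C: "\<And>x. x\<in>ns_carrier E \<Longrightarrow> ns_norm F (T x) \<le> C * ns_norm E x"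
    using assms by (auto simp: bounded_ops_iff)
  have "ns_norm F (T x) \<le> max C 0 * ns_norm E x" if "x\<in>ns_carrier E" for x
    using C[OF that] E.norm_nonneg[OF that] by (meson max.cobounded1 mult_right_mono order_trans)
  then show ?thesis by (intro exI[of _ "max C 0"]) simp
qed

lemma op_norm_nonneg: "T \<in> bounded_ops E F \<Longrightarrow> 0 \<le> op_norm E F T"
  unfolding op_norm_def by (rule cInf_greatest) (use op_norm_bound_ex in auto)

lemma op_norm_bound:
  assumes T: "T \<in> bounded_ops E F" and x: "x \<in> ns_carrier E"
  shows "ns_norm F (T x) \<le> op_norm E F T * ns_norm E x"
proof (cases "ns_norm E x = 0")
  case True
  then show ?thesis using op_norm_bound_ex[OF T] x by force
next
  case False
  then have pos: "ns_norm E x > 0" using E.norm_nonneg[OF x] by simp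
  have "ns_norm F (T x) / ns_norm E x \<le> op_norm E F T"
    unfolding op_norm_def
    by (rule cInf_greatest) (use op_norm_bound_ex[OF T] x pos in \<open>auto simp: divide_simps\<close>)
  then show ?thesis using pos by (simp add: divide_simps)
qed

lemma normed_space_bounded_op_space: "normed_space_on (bounded_op_space E F)"
proof
  let ?V = "ns_carrier E"
  let ?L = "bounded_op_space E F"
  note [simp] = bounded_op_space_simps E.closed F.closed
  have bnd: "T \<in> bounded_ops E F" if "T \<in> extensional (?V)"
    "ns_linear E F T" "\<And>x. x \<in> ?V \<Longrightarrow> ns_norm F (T x) \<le> C * ns_norm E x" for T C
    using that by (auto simp: bounded_ops_iff)
  show "ns_zero ?L \<in> bounded_ops E F"
    by (rule bnd[of _ 0]) (auto simp: ns_linear_def F.add_zero F.scale_zero_right F.norm_zero)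
  fix S T U c d
  {
    assume S: "S \<in> bounded_ops E F"
    note [simp] = bounded_ops_closed[OF S]
    have l: "S (ns_add E x y) = ns_add F (S x) (S y)" "S (ns_scale E c x) = ns_scale F c (S x)"
      if "x \<in> ?V" "y \<in> ?V" for x y c
      using S that by (auto simp: bounded_ops_iff ns_linear_def)
    have ext: "S \<in> extensional (?V)" using S by (simp add: bounded_ops_iff)
    have le_x: "ns_norm F (ns_scale ?L c S x) \<le> norm c * op_norm E F S * ns_norm E x" if "x \<in> ?V" for x c
      using op_norm_bound[OF S that] that by (simp add: F.norm_scale mult_left_mono mult.assoc)
    show sc: "ns_scale ?L c S \<in> bounded_ops E F"
    proof (rule bnd[OF _ _ le_x])
      show "ns_linear E F (ns_scale ?L c S)"
        by (auto simp: ns_linear_def l F.scale_add F.scale_scale mult.commute)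
    qed (auto simp: extensional_def)
    show "ns_add ?L S (ns_zero ?L) = S" "ns_scale ?L 1 S = S" "ns_scale ?L 0 S = ns_zero ?L"
      "ns_scale ?L (c + d) S = ns_add ?L (ns_scale ?L c S) (ns_scale ?L d S)"
      "ns_scale ?L c (ns_scale ?L d S) = ns_scale ?L (c * d) S"
      using ext by (auto intro!: extensionalityI[of _ "?V"]
        simp: F.add_zero F.scale_one F.scale_zero F.add_scale F.scale_scale)
    have le: "ns_norm ?L (ns_scale ?L c S) \<le> norm c * ns_norm ?L S" for c
      using le_x op_norm_nonneg[OF S] by (auto intro: op_norm_le)
    show "ns_norm ?L (ns_scale ?L c S) = norm c * ns_norm ?L S"
    proof (cases "c = 0")
      case True
      then show ?thesis using le[of 0] op_norm_nonneg[OF sc] by simp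
    next
      case False
      have "op_norm E F S \<le> norm (inverse c) * op_norm E F (ns_scale ?L c S)"
      proof (rule op_norm_le)
        fix x assume x: "x \<in> ?V"
        have "ns_norm F (S x) = norm (inverse c) * ns_norm F (ns_scale ?L c S x)"
          using x False by (simp add: F.norm_scale norm_inverse)
        also have "\<dots> \<le> norm (inverse c) * (op_norm E F (ns_scale ?L c S) * ns_norm E x)"
          by (intro mult_left_mono op_norm_bound sc x) simp
        finally show "ns_norm F (S x) \<le> norm (inverse c) * op_norm E F (ns_scale ?L c S) * ns_norm E x"
          by (simp add: mult.assoc)
      qed (use op_norm_nonneg[OF sc] in simp)
      then have "norm c * op_norm E F S \<le> op_norm E F (ns_scale ?L c S)"
        using False by (simp only: norm_inverse) (simp add: field_simps del: bounded_op_space_simps)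
      with le[of c] show ?thesis by simp
    qed
    show "S = ns_zero ?L" if "ns_norm ?L S = 0"
    proof (rule extensionalityI[of _ "?V"])
      fix x assume x: "x \<in> ?V"
      have "ns_norm F (S x) = 0" using op_norm_bound[OF S x] that F.norm_nonneg[of "S x"] x by simp
      then show "S x = ns_zero ?L x" using x F.norm_eq_zeroD[of "S x"] by simp
    qed (use ext in simp_all)
    assume T: "T \<in> bounded_ops E F"
    note [simp] = bounded_ops_closed[OF T]
    have l': "T (ns_add E x y) = ns_add F (T x) (T y)" "T (ns_scale E c x) = ns_scale F c (T x)"
      if "x \<in> ?V" "y \<in> ?V" for x y c
      using T that by (auto simp: bounded_ops_iff ns_linear_def)
    have tri: "ns_norm F (ns_add ?L S T x) \<le> (op_norm E F S + op_norm E F T) * ns_norm E x"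
      if "x \<in> ?V" for x
      using op_norm_bound[OF S that] op_norm_bound[OF T that] F.norm_triangle[of "S x" "T x"] that
      by (simp add: algebra_simps)
    show "ns_add ?L S T \<in> bounded_ops E F"
    proof (rule bnd[OF _ _ tri])
      show "ns_linear E F (ns_add ?L S T)"
        by (simp add: ns_linear_def l l' F.scale_add Pi_iff) (simp add: F.add4)
    qed (simp_all add: extensional_def)
    show "ns_add ?L S T = ns_add ?L T S"
      "ns_scale ?L c (ns_add ?L S T) = ns_add ?L (ns_scale ?L c S) (ns_scale ?L c T)"
      by (auto intro!: extensionalityI[of _ "?V"] simp: F.add_commute F.scale_add)
    show "ns_norm ?L (ns_add ?L S T) \<le> ns_norm ?L S + ns_norm ?L T"
      using tri op_norm_nonneg[OF S] op_norm_nonneg[OF T] by (auto intro!: op_norm_le)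
    assume U: "U \<in> bounded_ops E F"
    note [simp] = bounded_ops_closed[OF U]
    show "ns_add ?L (ns_add ?L S T) U = ns_add ?L S (ns_add ?L T U)"
      by (auto intro!: extensionalityI[of _ "?V"] simp: F.add_assoc)
  }
qed

end

section \<open>Finite-dimensional subspaces\<close>

text \<open>Every norm on a finite-dimensional space dominates the coefficients, in the form that survives
linear dependence of the \<open>b i\<close>: some choice of coefficients is bounded by the norm of the vector.
By induction on \<open>n\<close>: a dependent new vector can be eliminated; an independent one has positive
distance from the span of the others, as the distance is attained on a compact set of coefficients.\<close>

lemma (in normed_space_on) bounded_coefficients:
  fixes b :: "nat \<Rightarrow> 'e"
  assumes compact_box: "\<And>r. compact {c :: nat \<Rightarrow> 'k. \<forall>i. norm (c i) \<le> r}" and b: "\<And>i. b i \<in> V"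
  shows "\<exists>C\<ge>0. \<forall>c. \<exists>c'. ns_sum E (\<lambda>i. c i \<odot> b i) n = ns_sum E (\<lambda>i. c' i \<odot> b i) n \<and>
    (\<forall>i. norm (c' i) \<le> C * nrm (ns_sum E (\<lambda>i. c i \<odot> b i) n))"
proof (induction n)
  case 0
  show ?case by (intro exI[of _ 0] conjI allI exI[of _ "\<lambda>i. 0"]) (simp_all add: norm_zero)
next
  case (Suc n)
  define S where "S c = ns_sum E (\<lambda>i. c i \<odot> b i) n" for c
  obtain C where C: "0 \<le> C" "\<And>c. \<exists>c'. S c = S c' \<and> (\<forall>i. norm (c' i) \<le> C * nrm (S c))"
    using Suc unfolding S_def by blast
  have S: "S c \<in> V" for c unfolding S_def using b by (intro sum_closed closed)
  have S_add: "S c \<oplus> S d = S (\<lambda>i. c i + d i)" for c d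
    unfolding S_def using b by (simp add: sum_add[symmetric] add_scale scale_closed)
  have S_scale: "e \<odot> S c = S (\<lambda>i. e * c i)" for c e
    unfolding S_def using b by (simp add: sum_scale[symmetric] scale_scale scale_closed)
  have S_upd: "S (c(n := e)) = S c" for c e
    unfolding S_def by (rule ns_sum_cong) simp
  show ?case
  proof (cases "\<exists>d. b n = S d")
    case True
    then obtain d where d: "b n = S d" by blast
    show ?thesis
    proof (intro exI[of _ C] conjI allI C(1))
      fix c
      obtain c' where c': "S (\<lambda>i. c i + c n * d i) = S c'"
          "\<And>i. norm (c' i) \<le> C * nrm (S (\<lambda>i. c i + c n * d i))"
        using C(2)[of "\<lambda>i. c i + c n * d i"] by blast
      have eq: "ns_sum E (\<lambda>i. c i \<odot> b i) (Suc n) = S (\<lambda>i. c i + c n * d i)"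
        by (simp add: d S_scale S_add flip: S_def)
      have eq': "ns_sum E (\<lambda>i. (c'(n := 0)) i \<odot> b i) (Suc n) = S c'"
        using b S_upd[of c' 0] S[of c'] by (simp add: scale_zero add_zero S_def del: fun_upd_apply) (simp add: scale_zero add_zero)
      have "norm ((c'(n := 0)) i) \<le> C * nrm (S (\<lambda>i. c i + c n * d i))" for i
        using c'(2) C(1) norm_nonneg[OF S] by simp
      then show "\<exists>c'. ns_sum E (\<lambda>i. c i \<odot> b i) (Suc n) = ns_sum E (\<lambda>i. c' i \<odot> b i) (Suc n) \<and>
          (\<forall>i. norm (c' i) \<le> C * nrm (ns_sum E (\<lambda>i. c i \<odot> b i) (Suc n)))"
        unfolding eq by (intro exI[of _ "c'(n := 0)"] conjI allI) (simp_all only: eq' c'(1))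
    qed
  next
    case False
    \<comment> \<open>The combinations farther from \<open>- b n\<close> than \<open>1\<close> are irrelevant for the distance of \<open>b n\<close> to
    the span; by the induction hypothesis, the others have coefficients in the compact set \<open>K\<close>.\<close>
    define q where "q c = nrm (S c \<oplus> b n)" for c
    define K where "K = {c :: nat \<Rightarrow> 'k. \<forall>i. norm (c i) \<le> C * (1 + nrm (b n))}"
    have q_pos: "0 < q c" for c
    proof -
      have "q c \<noteq> 0"
      proof
        assume "q c = 0"
        then have "S c \<oplus> b n = ns_zero E" unfolding q_def using S b by (intro norm_eq_zeroD closed)
        then have "b n = (-1) \<odot> S c"
          using diff_add_cancel[of "b n" "S c"] add_commute[of "b n" "S c"] zero_add[of "(-1) \<odot> S c"] S b
          by (simp add: ns_diff_def scale_closed)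
        then show False using False by (simp only: S_scale) blast
      qed
      then show ?thesis unfolding q_def using norm_nonneg[of "S c \<oplus> b n"] S b by (simp add: closed)
    qed
    have q_lip: "q c \<le> q d + (\<Sum>i<n. norm (c i - d i) * nrm (b i))" for c d
    proof -
      have "q c = nrm ((S d \<oplus> b n) \<oplus> S (\<lambda>i. c i - d i))"
      proof -
        have "S c = S d \<oplus> S (\<lambda>i. c i - d i)" by (simp add: S_add)
        then show ?thesis unfolding q_def using S b
          by (metis add_assoc add_commute)
      qed
      also have "\<dots> \<le> q d + nrm (S (\<lambda>i. c i - d i))" unfolding q_def
        by (intro norm_triangle closed S b)
      also have "nrm (S (\<lambda>i. c i - d i)) \<le> (\<Sum>i<n. nrm ((c i - d i) \<odot> b i))"
        unfolding S_def by (intro norm_sum closed b)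
      finally show ?thesis using b by (simp add: norm_scale)
    qed
    have "continuous_on UNIV q"
      unfolding continuous_on_def
    proof
      fix d :: "nat \<Rightarrow> 'k"
      have lim: "((\<lambda>c. \<Sum>i<n. norm (c i - d i) * nrm (b i)) \<longlongrightarrow> 0) (at d)"
      proof -
        have "continuous_on UNIV (\<lambda>c :: nat \<Rightarrow> 'k. \<Sum>i<n. norm (c i - d i) * nrm (b i))"
          by (intro continuous_intros continuous_on_product_coordinates)
        then have "((\<lambda>c. \<Sum>i<n. norm (c i - d i) * nrm (b i)) \<longlongrightarrow> (\<Sum>i<n. norm (d i - d i) * nrm (b i))) (at d)"
          unfolding continuous_on_def by blast
        then show ?thesis by simp
      qed
      have "((\<lambda>c. q c - q d) \<longlongrightarrow> 0) (at d)"
      proof (rule Lim_null_comparison[OF _ lim], rule always_eventually, rule allI)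
        fix c
        show "norm (q c - q d) \<le> (\<Sum>i<n. norm (c i - d i) * nrm (b i))"
          using q_lip[of c d] q_lip[of d c] by (simp add: norm_minus_commute abs_le_iff)
      qed
      then show "(q \<longlongrightarrow> q d) (at d within UNIV)" by (simp add: LIM_zero_iff)
    qed
    then have cont: "continuous_on K q" by (rule continuous_on_subset) simp
    have K: "compact K" unfolding K_def by (rule compact_box)
    have "(\<lambda>i. 0) \<in> K" unfolding K_def using C(1) norm_nonneg[OF b[of n]] by simp
    then obtain m where m: "m \<in> K" "\<And>c. c \<in> K \<Longrightarrow> q m \<le> q c"
      using continuous_attains_inf[OF K _ cont] by blast
    define \<delta> where "\<delta> = min 1 (q m)"
    have \<delta>: "0 < \<delta>" unfolding \<delta>_def using q_pos by simp
    have dist: "\<delta> \<le> q c" for c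
    proof (cases "q c \<le> 1")
      case True
      obtain c' where c': "S c = S c'" "\<And>i. norm (c' i) \<le> C * nrm (S c)" using C(2) by blast
      have "nrm (S c) \<le> q c + nrm (b n)"
        using norm_triangle_diff[of "S c \<oplus> b n" "b n"] S b by (simp add: diff_add_cancel closed q_def)
      then have "C * nrm (S c) \<le> C * (1 + nrm (b n))" using True C(1) by (intro mult_left_mono) auto
      then have "c' \<in> K" unfolding K_def using c'(2) order_trans by blast
      then have "q m \<le> q c'" by (rule m)
      then show ?thesis using c'(1) by (simp add: q_def \<delta>_def)
    qed (simp add: \<delta>_def)
    define C' where "C' = max (C * (1 + nrm (b n) / \<delta>)) (1 / \<delta>)"
    show ?thesis
    proof (intro exI[of _ C'] conjI allI)
      show "0 \<le> C'" unfolding C'_def using \<delta> by (simp add: le_max_iff_disj)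
      fix c
      let ?w = "ns_sum E (\<lambda>i. c i \<odot> b i) (Suc n)"
      have w: "?w = S c \<oplus> c n \<odot> b n" by (simp add: S_def)
      have wV: "?w \<in> V" unfolding w by (intro closed S b)
      obtain c' where c': "S c = S c'" "\<And>i. norm (c' i) \<le> C * nrm (S c)" using C(2) by blast
      have cn: "norm (c n) * \<delta> \<le> nrm ?w"
      proof (cases "c n = 0")
        case False
        have "?w = c n \<odot> (S (\<lambda>i. inverse (c n) * c i) \<oplus> b n)"
          unfolding w using False S b by (simp add: scale_add S_scale[symmetric] scale_scale scale_closed scale_one)
        then have "nrm ?w = norm (c n) * q (\<lambda>i. inverse (c n) * c i)"
          unfolding q_def using S b by (simp add: norm_scale closed)
        then show ?thesis using dist by (simp add: mult_left_mono)
      qed (use norm_nonneg[OF wV] in simp)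
      have "nrm (S c) \<le> nrm ?w + norm (c n) * nrm (b n)"
        using norm_triangle_diff[of ?w "c n \<odot> b n"] S b unfolding w
        by (simp add: diff_add_cancel closed norm_scale)
      also have "\<dots> \<le> nrm ?w + (nrm ?w / \<delta>) * nrm (b n)"
        using cn \<delta> norm_nonneg[OF b[of n]] by (intro add_left_mono mult_right_mono) (auto simp: field_simps)
      finally have Sc: "nrm (S c) \<le> (1 + nrm (b n) / \<delta>) * nrm ?w" by (simp add: algebra_simps)
      have "norm ((c'(n := c n)) i) \<le> C' * nrm ?w" for i
      proof (cases "i = n")
        case True
        have "norm (c n) \<le> (1 / \<delta>) * nrm ?w" using cn \<delta> by (simp add: field_simps)
        also have "\<dots> \<le> C' * nrm ?w" unfolding C'_def by (intro mult_right_mono norm_nonneg wV) simp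
        finally show ?thesis using True by simp
      next
        case False
        have "norm (c' i) \<le> C * ((1 + nrm (b n) / \<delta>) * nrm ?w)"
          using c'(2) Sc C(1) by (meson mult_left_mono order_trans)
        also have "\<dots> \<le> C' * nrm ?w" unfolding C'_def mult.assoc[symmetric]
          by (intro mult_right_mono norm_nonneg wV) simp
        finally show ?thesis using False by simp
      qed
      moreover have "ns_sum E (\<lambda>i. (c'(n := c n)) i \<odot> b i) (Suc n) = ?w"
        using S_upd[of c' "c n"] c'(1) by (simp add: S_def)
      ultimately show "\<exists>c'. ?w = ns_sum E (\<lambda>i. c' i \<odot> b i) (Suc n) \<and> (\<forall>i. norm (c' i) \<le> C' * nrm ?w)"
        by metis
    qed
  qed
qed

section \<open>Derivations into the dual of a normed algebra\<close>

text \<open>The mean of \<open>B (X + e x) (Y + e y)\<close> over \<open>e = \<plusminus>1\<close> is \<open>B X Y + B x y\<close>, so one of the two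
signs does not decrease the norm. Choosing the signs one after the other turns a diagonal sum into a
single value of \<open>B\<close>. The summand \<open>z\<close> carries the terms that are still to be absorbed.\<close>

lemma (in normed_space_on) sum_bilinear_le_signed_sums:
  fixes B :: "'e \<Rightarrow> 'e \<Rightarrow> 'k"
  assumes add: "\<And>u v w. u \<in> V \<Longrightarrow> v \<in> V \<Longrightarrow> w \<in> V \<Longrightarrow> B (u \<oplus> v) w = B u w + B v w"
      "\<And>u v w. u \<in> V \<Longrightarrow> v \<in> V \<Longrightarrow> w \<in> V \<Longrightarrow> B w (u \<oplus> v) = B w u + B w v"
    and scale: "\<And>u w c. u \<in> V \<Longrightarrow> w \<in> V \<Longrightarrow> B (c \<odot> u) w = c * B u w"
      "\<And>u w c. u \<in> V \<Longrightarrow> w \<in> V \<Longrightarrow> B w (c \<odot> u) = c * B w u"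
    and xy: "\<And>k. k < n \<Longrightarrow> x k \<in> V" "\<And>k. k < n \<Longrightarrow> y k \<in> V"
  shows "\<exists>\<sigma>. (\<forall>k. \<sigma> k \<in> {1, - 1}) \<and>
    norm (z + (\<Sum>k<n. B (x k) (y k))) \<le>
      norm (z + B (ns_sum E (\<lambda>k. \<sigma> k \<odot> x k) n) (ns_sum E (\<lambda>k. \<sigma> k \<odot> y k) n))"
  using xy
proof (induction n arbitrary: z)
  case 0
  have "B (ns_zero E) (ns_zero E) = 0"
    using scale(1)[of "ns_zero E" "ns_zero E" 0] by (simp add: scale_zero_right zero_closed)
  then show ?case by (intro exI[of _ "\<lambda>k. 1"]) simp
next
  case (Suc n)
  let ?b = "B (x n) (y n)"
  have x: "x n \<in> V" "y n \<in> V" using Suc.prems by auto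
  obtain \<sigma> where \<sigma>: "\<And>k. \<sigma> k \<in> {1, - 1}"
    and le: "norm ((z + ?b) + (\<Sum>k<n. B (x k) (y k))) \<le>
      norm ((z + ?b) + B (ns_sum E (\<lambda>k. \<sigma> k \<odot> x k) n) (ns_sum E (\<lambda>k. \<sigma> k \<odot> y k) n))"
    using Suc.IH[of "z + ?b"] Suc.prems by auto
  define X where "X = ns_sum E (\<lambda>k. \<sigma> k \<odot> x k) n"
  define Y where "Y = ns_sum E (\<lambda>k. \<sigma> k \<odot> y k) n"
  have XY: "X \<in> V" "Y \<in> V" unfolding X_def Y_def using Suc.prems by (auto intro!: sum_closed scale_closed)
  let ?p = "\<lambda>e. z + B (X \<oplus> e \<odot> x n) (Y \<oplus> e \<odot> y n)"
  have p: "?p e = z + B X Y + e * B X (y n) + e * B (x n) Y + e * e * ?b" for e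
    using XY x by (simp add: add scale closed algebra_simps)
  have "2 * (z + ?b + B X Y) = ?p 1 + ?p (-1)" unfolding p by (simp add: algebra_simps)
  then have "2 * norm (z + ?b + B X Y) = norm (?p 1 + ?p (-1))"
    by (metis norm_mult norm_numeral)
  also have "\<dots> \<le> norm (?p 1) + norm (?p (-1))" by (rule norm_triangle_ineq)
  finally obtain e where e: "e \<in> {1, - 1}" and le': "norm (z + ?b + B X Y) \<le> norm (?p e)"
    by (cases "norm (z + ?b + B X Y) \<le> norm (?p 1)") force+
  have upd: "ns_sum E (\<lambda>k. (\<sigma>(n := e)) k \<odot> f k) (Suc n) = ns_sum E (\<lambda>k. \<sigma> k \<odot> f k) n \<oplus> e \<odot> f n" for f
    using ns_sum_cong[of n "\<lambda>k. (\<sigma>(n := e)) k \<odot> f k" "\<lambda>k. \<sigma> k \<odot> f k" E] by simp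
  have "norm (z + (\<Sum>k<Suc n. B (x k) (y k))) \<le> norm (?p e)"
    using le le' by (simp add: X_def Y_def add_ac)
  then show ?case
    using \<sigma> e unfolding X_def Y_def upd[symmetric] by (intro exI[of _ "\<sigma>(n := e)"]) auto
qed

locale normed_algebra_on = normed_space_on A
  for A :: "('k::real_normed_field, 'a, 'z) normed_algebra_scheme" +
  assumes mult_closed: "a \<in> ns_carrier A \<Longrightarrow> b \<in> ns_carrier A \<Longrightarrow> na_mult A a b \<in> ns_carrier A"
    and mult_assoc: "a \<in> ns_carrier A \<Longrightarrow> b \<in> ns_carrier A \<Longrightarrow> c \<in> ns_carrier A \<Longrightarrow>
      na_mult A (na_mult A a b) c = na_mult A a (na_mult A b c)"
    and mult_add: "a \<in> ns_carrier A \<Longrightarrow> b \<in> ns_carrier A \<Longrightarrow> c \<in> ns_carrier A \<Longrightarrow>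
      na_mult A a (ns_add A b c) = ns_add A (na_mult A a b) (na_mult A a c)"
    and add_mult: "a \<in> ns_carrier A \<Longrightarrow> b \<in> ns_carrier A \<Longrightarrow> c \<in> ns_carrier A \<Longrightarrow>
      na_mult A (ns_add A a b) c = ns_add A (na_mult A a c) (na_mult A b c)"
    and mult_scale: "a \<in> ns_carrier A \<Longrightarrow> b \<in> ns_carrier A \<Longrightarrow>
      na_mult A a (ns_scale A r b) = ns_scale A r (na_mult A a b)"
    and scale_mult: "a \<in> ns_carrier A \<Longrightarrow> b \<in> ns_carrier A \<Longrightarrow>
      na_mult A (ns_scale A r a) b = ns_scale A r (na_mult A a b)"
    and norm_mult_le: "a \<in> ns_carrier A \<Longrightarrow> b \<in> ns_carrier A \<Longrightarrow>
      ns_norm A (na_mult A a b) \<le> ns_norm A a * ns_norm A b"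
begin

notation plus (infixl "\<oplus>" 65) and minus (infixl "\<ominus>" 65) and scale (infixr "\<odot>" 75) and carr ("V")
abbreviation times (infixl "\<otimes>" 70) where "a \<otimes> b \<equiv> na_mult A a b"

lemma mult_diff: "a \<in> V \<Longrightarrow> b \<in> V \<Longrightarrow> c \<in> V \<Longrightarrow> a \<otimes> (b \<ominus> c) = a \<otimes> b \<ominus> a \<otimes> c"
  by (simp add: ns_diff_def mult_add mult_scale scale_closed)

lemma diff_mult: "a \<in> V \<Longrightarrow> b \<in> V \<Longrightarrow> c \<in> V \<Longrightarrow> (a \<ominus> b) \<otimes> c = a \<otimes> c \<ominus> b \<otimes> c"
  by (simp add: ns_diff_def add_mult scale_mult scale_closed)

end

lemma normed_space_scalars: "normed_space_on (type_space ((*) :: 'k::real_normed_field \<Rightarrow> _))"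
  by standard (auto simp: type_space_def algebra_simps norm_triangle_ineq norm_mult)

lemma dual_space_simps:
  "ns_add (dual_space A) f g = (\<lambda>b\<in>ns_carrier A. f b + g b)"
  "ns_scale (dual_space A) c f = (\<lambda>b\<in>ns_carrier A. c * f b)"
  "ns_diff (dual_space A) f g = (\<lambda>b\<in>ns_carrier A. f b - g b)"
  by (auto simp: dual_space_def bounded_op_space_simps type_space_def ns_diff_def)

lemma ns_linear_scalars: "ns_linear A (type_space (*)) f \<longleftrightarrow>
    (\<forall>x\<in>ns_carrier A. \<forall>y\<in>ns_carrier A. f (ns_add A x y) = f x + f y) \<and>
    (\<forall>c. \<forall>x\<in>ns_carrier A. f (ns_scale A c x) = c * f x)"
  by (auto simp: ns_linear_def type_space_def)

context normed_algebra_on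
begin

text \<open>Strips the records and restricted functions off a derivation, which becomes a bounded bilinear
form; the last conclusion is the derivation rule with both sides evaluated at \<open>c\<close>.\<close>

lemma derivation_form:
  assumes D: "bounded_dual_derivation A D"
  obtains C where "0 \<le> C"
    "\<And>a b. a \<in> V \<Longrightarrow> b \<in> V \<Longrightarrow> norm (D a b) \<le> C * nrm a * nrm b"
    "\<And>a b c. a \<in> V \<Longrightarrow> b \<in> V \<Longrightarrow> c \<in> V \<Longrightarrow> D (a \<oplus> b) c = D a c + D b c"
    "\<And>a b c. a \<in> V \<Longrightarrow> b \<in> V \<Longrightarrow> c \<in> V \<Longrightarrow> D c (a \<oplus> b) = D c a + D c b"
    "\<And>a c r. a \<in> V \<Longrightarrow> c \<in> V \<Longrightarrow> D (r \<odot> a) c = r * D a c"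
    "\<And>a c r. a \<in> V \<Longrightarrow> c \<in> V \<Longrightarrow> D c (r \<odot> a) = r * D c a"
    "\<And>a b c. a \<in> V \<Longrightarrow> b \<in> V \<Longrightarrow> c \<in> V \<Longrightarrow> D (a \<otimes> b) c = D b (c \<otimes> a) + D a (b \<otimes> c)"
proof -
  let ?K = "type_space ((*) :: 'k \<Rightarrow> _)"
  have Dop: "D \<in> bounded_ops A (dual_space A)"
    and der: "\<And>a b. a \<in> V \<Longrightarrow> b \<in> V \<Longrightarrow>
      D (a \<otimes> b) = ns_add (dual_space A) (dual_left_act A a (D b)) (dual_right_act A (D a) b)"
    using D unfolding bounded_dual_derivation_def by blast+
  have A: "normed_space_on A" by unfold_locales
  have dual: "normed_space_on (dual_space A)"
    unfolding dual_space_def by (rule normed_space_bounded_op_space[OF A normed_space_scalars])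
  have Da: "D a \<in> bounded_ops A ?K" if "a \<in> V" for a
    using bounded_ops_closed[OF Dop that] by (simp add: dual_space_def)
  have lin: "ns_linear A (dual_space A) D" "\<And>a. a \<in> V \<Longrightarrow> ns_linear A ?K (D a)"
    using Dop Da by (simp_all add: bounded_ops_linear)
  show ?thesis
  proof (rule that[of "op_norm A (dual_space A) D"])
    show "0 \<le> op_norm A (dual_space A) D" by (rule op_norm_nonneg[OF A dual Dop])
    fix a b c r assume a: "a \<in> V"
    {
      assume b: "b \<in> V"
      have "norm (D a b) \<le> op_norm A ?K (D a) * nrm b"
        using op_norm_bound[OF A normed_space_scalars Da[OF a] b] by (simp add: type_space_def)
      also have "op_norm A ?K (D a) \<le> op_norm A (dual_space A) D * nrm a"
        using op_norm_bound[OF A dual Dop a] by (simp add: dual_space_def bounded_op_space_simps)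
      finally show "norm (D a b) \<le> op_norm A (dual_space A) D * nrm a * nrm b"
        using norm_nonneg[OF b] by (simp add: mult_right_mono)
    }
    assume c: "c \<in> V"
    show "D (r \<odot> a) c = r * D a c" "D c (r \<odot> a) = r * D c a"
      using lin(1) lin(2)[OF c] a c by (simp_all add: ns_linear_scalars ns_linear_def[of A "dual_space A"] dual_space_simps)
    assume b: "b \<in> V"
    show "D (a \<oplus> b) c = D a c + D b c" "D c (a \<oplus> b) = D c a + D c b"
      using lin(1) lin(2)[OF c] a b c by (simp_all add: ns_linear_scalars ns_linear_def[of A "dual_space A"] dual_space_simps)
    show "D (a \<otimes> b) c = D b (c \<otimes> a) + D a (b \<otimes> c)"
      using der[OF a b] a b c by (simp add: dual_space_simps dual_left_act_def dual_right_act_def mult_closed)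
  qed
qed

end

context normed_algebra_on
begin

text \<open>The heart of the argument: with \<open>e\<close> small and \<open>n\<close> large, the mean of the functionals
\<open>c \<mapsto> D (v k \<otimes> c) (u k)\<close> implements \<open>D\<close> at \<open>a\<close> and \<open>b\<close> up to a small error.\<close>

lemma averaged_functional_nearly_implements:
  fixes D :: "'a \<Rightarrow> 'a \<Rightarrow> 'k"
  assumes C: "0 \<le> C"
    and bound: "\<And>a b. a \<in> V \<Longrightarrow> b \<in> V \<Longrightarrow> norm (D a b) \<le> C * nrm a * nrm b"
    and add: "\<And>a b c. a \<in> V \<Longrightarrow> b \<in> V \<Longrightarrow> c \<in> V \<Longrightarrow> D (a \<oplus> b) c = D a c + D b c"
      "\<And>a b c. a \<in> V \<Longrightarrow> b \<in> V \<Longrightarrow> c \<in> V \<Longrightarrow> D c (a \<oplus> b) = D c a + D c b"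
    and scale: "\<And>a c r. a \<in> V \<Longrightarrow> c \<in> V \<Longrightarrow> D (r \<odot> a) c = r * D a c"
      "\<And>a c r. a \<in> V \<Longrightarrow> c \<in> V \<Longrightarrow> D c (r \<odot> a) = r * D c a"
    and deriv: "\<And>a b c. a \<in> V \<Longrightarrow> b \<in> V \<Longrightarrow> c \<in> V \<Longrightarrow> D (a \<otimes> b) c = D b (c \<otimes> a) + D a (b \<otimes> c)"
    and uv: "\<And>k. k < n \<Longrightarrow> u k \<in> V" "\<And>k. k < n \<Longrightarrow> v k \<in> V" "\<And>k. k < n \<Longrightarrow> nrm (u k) * nrm (v k) \<le> K"
    and signs: "\<And>\<sigma> c. \<forall>k. \<sigma> k \<in> {1, - 1} \<Longrightarrow> c \<in> V \<Longrightarrow>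
      nrm (ns_sum A (\<lambda>k. \<sigma> k \<odot> (v k \<otimes> c \<otimes> u k)) n) \<le> K * nrm c"
    and ab: "a \<in> V" "b \<in> V"
    and near: "\<And>k. k < n \<Longrightarrow> nrm (u k \<otimes> v k \<otimes> a \<ominus> a) \<le> e" "\<And>k. k < n \<Longrightarrow> nrm (u k \<otimes> v k \<otimes> b \<ominus> b) \<le> e"
    and n: "0 < n" and K: "0 \<le> K"
  defines "\<Phi> \<equiv> \<lambda>c. (\<Sum>k<n. D (v k \<otimes> c) (u k)) / of_nat n"
  shows "norm (\<Phi> (b \<otimes> a) - \<Phi> (a \<otimes> b) - D a b) \<le>
    C * e * (nrm a + K * nrm b + K * nrm a) + C * (K * nrm a) * (K * nrm b) / real n"
proof -
  have diff: "D (x \<ominus> y) z = D x z - D y z" "D z (x \<ominus> y) = D z x - D z y"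
    if "x \<in> V" "y \<in> V" "z \<in> V" for x y z
    using that by (simp_all add: ns_diff_def add scale scale_closed)
  define err where "err k = D a (u k \<otimes> v k \<otimes> b \<ominus> b) - D (v k \<otimes> b) ((u k \<otimes> v k \<otimes> a \<ominus> a) \<otimes> u k)
    + D (v k \<otimes> a \<otimes> (u k \<otimes> v k \<otimes> b \<ominus> b)) (u k)" for k
  note cl = closed mult_closed
  \<comment> \<open>For exact left units \<open>u k \<otimes> v k\<close> the three terms of \<open>err\<close> vanish. The identity comes from
  splitting \<open>(v b) a\<close> and \<open>(v a u) (v b)\<close> by the derivation rule, where \<open>(v a u) (v b) = v a (u v b)\<close>
  is nearly \<open>v a b\<close>.\<close>
  have key: "D (v k \<otimes> (b \<otimes> a)) (u k) - D (v k \<otimes> (a \<otimes> b)) (u k)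
      = D a b + err k - D (v k \<otimes> a \<otimes> u k) (v k \<otimes> b \<otimes> u k)" if "k < n" for k
  proof -
    let ?u = "u k" and ?v = "v k"
    note [simp] = ab uv(1,2)[OF that] cl
    have "D (?v \<otimes> (b \<otimes> a)) ?u = D a (?u \<otimes> ?v \<otimes> b) + D (?v \<otimes> b) (a \<otimes> ?u)"
      using deriv[of "?v \<otimes> b" a ?u] by (simp add: mult_assoc)
    moreover have "D (?v \<otimes> a \<otimes> (?u \<otimes> ?v \<otimes> b)) ?u
      = D (?v \<otimes> b) (?u \<otimes> ?v \<otimes> a \<otimes> ?u) + D (?v \<otimes> a \<otimes> ?u) (?v \<otimes> b \<otimes> ?u)"
      using deriv[of "?v \<otimes> a \<otimes> ?u" "?v \<otimes> b" ?u] by (simp add: mult_assoc)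
    moreover have "?v \<otimes> (a \<otimes> b) = ?v \<otimes> a \<otimes> b" by (simp add: mult_assoc)
    ultimately show ?thesis
      unfolding err_def by (simp add: mult_diff diff_mult diff)
  qed
  have err: "norm (err k) \<le> C * e * (nrm a + K * nrm b + K * nrm a)" if k: "k < n" for k
  proof -
    let ?u = "u k" and ?v = "v k"
    note [simp] = ab uv(1,2)[OF k] cl norm_nonneg
    have e: "0 \<le> e" by (rule order_trans[OF norm_nonneg near(1)[OF k]]) simp
    have le: "norm (D x y) \<le> C * X * Y" if "x \<in> V" "y \<in> V" "nrm x \<le> X" "nrm y \<le> Y" for x y X Y
    proof -
      have "norm (D x y) \<le> C * nrm x * nrm y" by (rule bound[OF that(1,2)])
      also have "\<dots> \<le> C * X * Y"
        using that C order_trans[OF norm_nonneg that(3)] by (intro mult_mono mult_left_mono) simp_all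
      finally show ?thesis .
    qed
    have ml: "nrm (x \<otimes> y) \<le> X * Y" if "x \<in> V" "y \<in> V" "nrm x \<le> X" "nrm y \<le> Y" for x y X Y
      using that order_trans[OF norm_nonneg that(3)] by (intro order_trans[OF norm_mult_le] mult_mono) simp_all
    have uvK: "C * c * e * (nrm ?u * nrm ?v) \<le> C * c * e * K" if "0 \<le> c" for c
      using C e that uv(3)[OF k] by (intro mult_left_mono) simp_all
    have 1: "norm (D a (?u \<otimes> ?v \<otimes> b \<ominus> b)) \<le> C * nrm a * e"
      by (rule le) (simp_all add: near(2)[OF k])
    have "norm (D (?v \<otimes> b) ((?u \<otimes> ?v \<otimes> a \<ominus> a) \<otimes> ?u)) \<le> C * (nrm ?v * nrm b) * (e * nrm ?u)"
      by (intro le ml near(1)[OF k]) simp_all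
    with uvK[of "nrm b"] have 2: "norm (D (?v \<otimes> b) ((?u \<otimes> ?v \<otimes> a \<ominus> a) \<otimes> ?u)) \<le> C * K * nrm b * e"
      by (simp add: mult_ac)
    have "norm (D (?v \<otimes> a \<otimes> (?u \<otimes> ?v \<otimes> b \<ominus> b)) ?u) \<le> C * (nrm ?v * nrm a * e) * nrm ?u"
      by (intro le ml near(2)[OF k]) simp_all
    with uvK[of "nrm a"] have 3: "norm (D (?v \<otimes> a \<otimes> (?u \<otimes> ?v \<otimes> b \<ominus> b)) ?u) \<le> C * K * nrm a * e"
      by (simp add: mult_ac)
    have "norm (err k) \<le> norm (D a (?u \<otimes> ?v \<otimes> b \<ominus> b))
      + norm (D (?v \<otimes> b) ((?u \<otimes> ?v \<otimes> a \<ominus> a) \<otimes> ?u)) + norm (D (?v \<otimes> a \<otimes> (?u \<otimes> ?v \<otimes> b \<ominus> b)) ?u)"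
      unfolding err_def by (meson add_right_mono norm_triangle_ineq norm_triangle_ineq4 order_trans)
    with 1 2 3 show ?thesis by (simp add: algebra_simps)
  qed
  define Q where "Q = (\<Sum>k<n. D (v k \<otimes> a \<otimes> u k) (v k \<otimes> b \<otimes> u k))"
  have Q: "norm Q \<le> C * (K * nrm a) * (K * nrm b)"
  proof -
    let ?S = "\<lambda>\<sigma> c. ns_sum A (\<lambda>k. \<sigma> k \<odot> (v k \<otimes> c \<otimes> u k)) n"
    have "\<exists>\<sigma>. (\<forall>k. \<sigma> k \<in> {1, - 1}) \<and> norm (0 + Q) \<le> norm (0 + D (?S \<sigma> a) (?S \<sigma> b))"
      unfolding Q_def using add scale
      by (rule sum_bilinear_le_signed_sums) (use ab uv in \<open>auto intro!: cl\<close>)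
    then obtain \<sigma> where \<sigma>: "\<forall>k. \<sigma> k \<in> {1, - 1}" and Qle: "norm Q \<le> norm (D (?S \<sigma> a) (?S \<sigma> b))" by auto
    have S: "?S \<sigma> c \<in> V" if "c \<in> V" for c using that uv by (intro sum_closed cl) auto
    note Qle
    also have "norm (D (?S \<sigma> a) (?S \<sigma> b)) \<le> C * nrm (?S \<sigma> a) * nrm (?S \<sigma> b)"
      by (intro bound S ab)
    also have "\<dots> \<le> C * (K * nrm a) * (K * nrm b)"
      using C K by (intro mult_mono mult_left_mono signs \<sigma> ab mult_nonneg_nonneg norm_nonneg S) auto
    finally show ?thesis .
  qed
  have n0: "(of_nat n :: 'k) \<noteq> 0" using n by simp
  have "\<Phi> (b \<otimes> a) - \<Phi> (a \<otimes> b) = (\<Sum>k<n. D a b + err k - D (v k \<otimes> a \<otimes> u k) (v k \<otimes> b \<otimes> u k)) / of_nat n"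
    unfolding \<Phi>_def using key by (simp add: diff_divide_distrib[symmetric] sum_subtractf[symmetric])
  also have "\<dots> = D a b + ((\<Sum>k<n. err k) - Q) / of_nat n"
    using n0 by (simp add: Q_def sum_subtractf sum.distrib field_simps)
  finally have "norm (\<Phi> (b \<otimes> a) - \<Phi> (a \<otimes> b) - D a b) = norm ((\<Sum>k<n. err k) - Q) / real n"
    by (simp add: norm_divide)
  also have "\<dots> \<le> ((\<Sum>k<n. norm (err k)) + norm Q) / real n"
    by (intro divide_right_mono order_trans[OF norm_triangle_ineq4] add_mono norm_sum order_refl) (auto simp: Real_Vector_Spaces.norm_sum)
  also have "\<dots> \<le> (real n * (C * e * (nrm a + K * nrm b + K * nrm a)) + C * (K * nrm a) * (K * nrm b)) / real n"
    using sum_bounded_above[of "{..<n}" "\<lambda>k. norm (err k)"] err Q by (intro divide_right_mono add_mono) auto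
  also have "\<dots> = C * e * (nrm a + K * nrm b + K * nrm a) + C * (K * nrm a) * (K * nrm b) / real n"
    using n by (simp add: add_divide_distrib)
  finally show ?thesis .
qed

text \<open>The approximately implementing means satisfy the same norm bound, so they lie in one compact set
of functionals. The sets of functionals that implement \<open>D\<close> at a given pair up to a given error are
closed and have the finite intersection property in it; a common point implements \<open>D\<close>.\<close>

theorem weakly_amenable_if_amplified_factorizations:
  assumes compact_box: "\<And>r. compact {f :: 'a \<Rightarrow> 'k. \<forall>a. norm (f a) \<le> r a}" and K: "0 \<le> K"
    and factors: "\<And>S e n. finite S \<Longrightarrow> S \<subseteq> V \<Longrightarrow> 0 < e \<Longrightarrow> \<exists>u v.
      (\<forall>k<n. u k \<in> V \<and> v k \<in> V \<and> nrm (u k) * nrm (v k) \<le> K \<and> (\<forall>a\<in>S. nrm (u k \<otimes> v k \<otimes> a \<ominus> a) \<le> e)) \<and>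
      (\<forall>\<sigma>. (\<forall>k. \<sigma> k \<in> {1, - 1}) \<longrightarrow>
        (\<forall>a\<in>V. nrm (ns_sum A (\<lambda>k. \<sigma> k \<odot> (v k \<otimes> a \<otimes> u k)) n) \<le> K * nrm a))"
  shows "weakly_amenable A"
  unfolding weakly_amenable_def
proof (intro allI impI)
  fix D assume D: "bounded_dual_derivation A D"
  obtain C where C: "0 \<le> C"
    and bound: "\<And>a b. a \<in> V \<Longrightarrow> b \<in> V \<Longrightarrow> norm (D a b) \<le> C * nrm a * nrm b"
    and add: "\<And>a b c. a \<in> V \<Longrightarrow> b \<in> V \<Longrightarrow> c \<in> V \<Longrightarrow> D (a \<oplus> b) c = D a c + D b c"
      "\<And>a b c. a \<in> V \<Longrightarrow> b \<in> V \<Longrightarrow> c \<in> V \<Longrightarrow> D c (a \<oplus> b) = D c a + D c b"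
    and scale: "\<And>a c r. a \<in> V \<Longrightarrow> c \<in> V \<Longrightarrow> D (r \<odot> a) c = r * D a c"
      "\<And>a c r. a \<in> V \<Longrightarrow> c \<in> V \<Longrightarrow> D c (r \<odot> a) = r * D c a"
    and deriv: "\<And>a b c. a \<in> V \<Longrightarrow> b \<in> V \<Longrightarrow> c \<in> V \<Longrightarrow> D (a \<otimes> b) c = D b (c \<otimes> a) + D a (b \<otimes> c)"
    using derivation_form[OF D] by blast
  define Cube where "Cube = {f :: 'a \<Rightarrow> 'k. \<forall>a. norm (f a) \<le> (if a \<in> V then C * K * nrm a else 0)}"
  define Lin where "Lin = (\<Inter>a\<in>V. \<Inter>b\<in>V. {f :: 'a \<Rightarrow> 'k. f (a \<oplus> b) = f a + f b}) \<inter>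
    (\<Inter>r. \<Inter>a\<in>V. {f :: 'a \<Rightarrow> 'k. f (r \<odot> a) = r * f a})"
  define near where "near = (\<lambda>(a, b, \<eta>). {f :: 'a \<Rightarrow> 'k. norm (f (b \<otimes> a) - f (a \<otimes> b) - D a b) \<le> (\<eta> :: real)})"
  define I where "I = V \<times> V \<times> {0 :: real<..}"
  have "compact (Cube \<inter> Lin)"
  proof (rule compact_Int_closed)
    show "compact Cube" unfolding Cube_def by (rule compact_box)
    show "closed Lin" unfolding Lin_def
      by (intro closed_Int closed_INT ballI closed_Collect_eq continuous_intros continuous_on_product_coordinates)
  qed
  moreover have "closed (near i)" for i
    unfolding near_def case_prod_beta
    by (intro closed_Collect_le continuous_intros continuous_on_product_coordinates)
  moreover have "Cube \<inter> Lin \<inter> (\<Inter>i\<in>J. near i) \<noteq> {}" if J: "finite J" "J \<subseteq> I" for J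
  proof -
    define S where "S = fst ` J \<union> (fst \<circ> snd) ` J"
    have S: "finite S" "S \<subseteq> V" using J unfolding S_def I_def by auto
    \<comment> \<open>The element \<open>1\<close> only keeps the set nonempty.\<close>
    define \<eta> where "\<eta> = Min (insert 1 ((snd \<circ> snd) ` J))"
    have \<eta>_pos: "0 < \<eta>"
      using J unfolding \<eta>_def I_def by (subst Min_gr_iff) auto
    have J_D: "\<eta> \<le> h" "a \<in> S" "b \<in> S" if "(a, b, h) \<in> J" for a b h
    proof -
      show "\<eta> \<le> h" unfolding \<eta>_def using J(1) image_eqI[OF _ that, of h "snd \<circ> snd"] by (intro Min_le) auto
      show "a \<in> S" "b \<in> S" unfolding S_def
        using image_eqI[OF _ that, of a fst] image_eqI[OF _ that, of b "fst \<circ> snd"] by auto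
    qed
    define R where "R = (\<Sum>a\<in>S. nrm a)"
    have nS: "0 \<le> nrm a" if "a \<in> S" for a using S that by (intro norm_nonneg) auto
    have R: "0 \<le> R" "\<And>a. a \<in> S \<Longrightarrow> nrm a \<le> R"
      unfolding R_def using S nS by (auto intro: sum_nonneg member_le_sum)
    define X where "X = C * (R + K * R + K * R)"
    define e where "e = \<eta> / 2 / (X + 1)"
    have X: "0 \<le> X" unfolding X_def using C K R by simp
    have e: "0 < e" "e * X \<le> \<eta> / 2" unfolding e_def using X \<eta>_pos by (simp_all add: field_simps)
    obtain m :: nat where m: "2 * (C * (K * R) * (K * R)) / \<eta> \<le> real m" using real_arch_simple by blast
    define n where "n = Suc m"
    have n: "0 < n" "C * (K * R) * (K * R) / real n \<le> \<eta> / 2"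
    proof -
      have "2 * (C * (K * R) * (K * R)) / \<eta> \<le> real n" using m by (simp add: n_def)
      then show "C * (K * R) * (K * R) / real n \<le> \<eta> / 2"
        using \<eta>_pos by (simp add: n_def field_simps del: of_nat_Suc)
    qed (simp add: n_def)
    obtain u v where uv: "\<And>k. k < n \<Longrightarrow> u k \<in> V" "\<And>k. k < n \<Longrightarrow> v k \<in> V" "\<And>k. k < n \<Longrightarrow> nrm (u k) * nrm (v k) \<le> K"
      and near: "\<And>k a. k < n \<Longrightarrow> a \<in> S \<Longrightarrow> nrm (u k \<otimes> v k \<otimes> a \<ominus> a) \<le> e"
      and signs: "\<And>\<sigma> a. \<forall>k. \<sigma> k \<in> {1, - 1} \<Longrightarrow> a \<in> V \<Longrightarrow>
        nrm (ns_sum A (\<lambda>k. \<sigma> k \<odot> (v k \<otimes> a \<otimes> u k)) n) \<le> K * nrm a"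
    proof -
      from factors[OF S e(1), of n] obtain u v where
        *: "\<forall>k<n. u k \<in> V \<and> v k \<in> V \<and> nrm (u k) * nrm (v k) \<le> K \<and> (\<forall>a\<in>S. nrm (u k \<otimes> v k \<otimes> a \<ominus> a) \<le> e)"
        and "\<forall>\<sigma>. (\<forall>k. \<sigma> k \<in> {1, - 1}) \<longrightarrow>
          (\<forall>a\<in>V. nrm (ns_sum A (\<lambda>k. \<sigma> k \<odot> (v k \<otimes> a \<otimes> u k)) n) \<le> K * nrm a)"
        by (elim exE conjE)
      then show thesis by (intro that[of u v]) simp_all
    qed
    define \<Phi> where "\<Phi> c = (\<Sum>k<n. D (v k \<otimes> c) (u k)) / of_nat n" for c
    define f where "f c = (if c \<in> V then \<Phi> c else 0)" for c
    have \<Phi>: "norm (\<Phi> c) \<le> C * K * nrm c" if c: "c \<in> V" for c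
    proof -
      have "norm (D (v k \<otimes> c) (u k)) \<le> C * K * nrm c" if k: "k < n" for k
      proof -
        have "norm (D (v k \<otimes> c) (u k)) \<le> C * nrm (v k \<otimes> c) * nrm (u k)"
          by (intro bound mult_closed uv k c)
        also have "\<dots> \<le> C * (nrm (v k) * nrm c) * nrm (u k)"
          using C by (intro mult_right_mono mult_left_mono norm_mult_le norm_nonneg uv k c)
        also have "\<dots> = C * (nrm (u k) * nrm (v k)) * nrm c" by simp
        also have "\<dots> \<le> C * K * nrm c"
          using C by (intro mult_right_mono mult_left_mono norm_nonneg uv k c)
        finally show ?thesis .
      qed
      then have "norm (\<Sum>k<n. D (v k \<otimes> c) (u k)) \<le> real n * (C * K * nrm c)"
        using sum_norm_bound[of "{..<n}" "\<lambda>k. D (v k \<otimes> c) (u k)"] by simp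
      then show ?thesis unfolding \<Phi>_def using n(1) by (simp add: norm_divide field_simps)
    qed
    have "f \<in> Cube" unfolding Cube_def f_def using \<Phi> by simp
    moreover have "f \<in> Lin"
    proof -
      have "\<Phi> (a \<oplus> b) = \<Phi> a + \<Phi> b" if "a \<in> V" "b \<in> V" for a b
        unfolding \<Phi>_def using that uv by (simp add: mult_add add mult_closed sum.distrib add_divide_distrib)
      moreover have "\<Phi> (r \<odot> a) = r * \<Phi> a" if "a \<in> V" for a r
        unfolding \<Phi>_def using that uv by (simp add: mult_scale scale mult_closed sum_distrib_left)
      ultimately show ?thesis unfolding Lin_def f_def by (simp add: closed)
    qed
    moreover have "f \<in> near (a, b, h)" if abh: "(a, b, h) \<in> J" for a b h
    proof -
      have ab: "a \<in> S" "b \<in> S" "a \<in> V" "b \<in> V" "\<eta> \<le> h" using J_D[OF abh] S by auto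
      have "norm (\<Phi> (b \<otimes> a) - \<Phi> (a \<otimes> b) - D a b) \<le>
          C * e * (nrm a + K * nrm b + K * nrm a) + C * (K * nrm a) * (K * nrm b) / real n"
        unfolding \<Phi>_def
        by (rule averaged_functional_nearly_implements[OF C bound add scale deriv uv signs])
          (use ab near n(1) K in auto)
      also have "\<dots> \<le> C * e * (R + K * R + K * R) + C * (K * R) * (K * R) / real n"
        using C K e(1) R ab nS by (intro add_mono mult_left_mono divide_right_mono mult_mono) auto
      also have "C * e * (R + K * R + K * R) = e * X" unfolding X_def by (simp add: mult_ac)
      also have "e * X + C * (K * R) * (K * R) / real n \<le> h" using e(2) n(2) ab(5) by linarith
      finally show ?thesis unfolding near_def f_def using ab by (simp add: mult_closed)
    qed
    ultimately show ?thesis by fast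
  qed
  ultimately have "Cube \<inter> Lin \<inter> (\<Inter>i\<in>I. near i) \<noteq> {}"
    by (rule compact_imp_fip_image)
  then obtain f where f: "f \<in> Cube" "f \<in> Lin" "\<And>i. i \<in> I \<Longrightarrow> f \<in> near i" by blast
  have lin: "f (a \<oplus> b) = f a + f b" "f (r \<odot> a) = r * f a" if "a \<in> V" "b \<in> V" for a b r
    using f(2) that unfolding Lin_def by auto
  have impl: "D a b = f (b \<otimes> a) - f (a \<otimes> b)" if "a \<in> V" "b \<in> V" for a b
  proof -
    have *: "norm (f (b \<otimes> a) - f (a \<otimes> b) - D a b) \<le> \<eta>" if "0 < \<eta>" for \<eta>
      using f(3)[of "(a, b, \<eta>)"] \<open>a \<in> V\<close> \<open>b \<in> V\<close> that unfolding I_def near_def by simp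
    have "norm (f (b \<otimes> a) - f (a \<otimes> b) - D a b) \<le> 0"
      by (rule field_le_epsilon) (simp only: add_0 *)
    then show ?thesis by simp
  qed
  let ?\<phi> = "restrict f V"
  have "?\<phi> \<in> bounded_ops A (type_space (*))"
    unfolding bounded_ops_iff ns_linear_scalars
  proof (intro conjI exI[of _ "C * K"] ballI allI)
    show "ns_norm (type_space (*)) (?\<phi> a) \<le> C * K * nrm a" if "a \<in> V" for a
      using f(1)[unfolded Cube_def, THEN CollectD, THEN spec, of a] that by (simp add: type_space_def)
  qed (auto simp: lin closed)
  then have "?\<phi> \<in> ns_carrier (dual_space A)" by (simp add: dual_space_def)
  moreover have "D a = ns_diff (dual_space A) (dual_left_act A a ?\<phi>) (dual_right_act A ?\<phi> a)" if a: "a \<in> V" for a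
  proof (rule extensionalityI[of _ V])
    have "D a \<in> ns_carrier (dual_space A)"
      using D a unfolding bounded_dual_derivation_def by (blast intro: bounded_ops_closed)
    then show "D a \<in> extensional V" by (simp add: dual_space_def bounded_ops_iff)
    show "D a b = ns_diff (dual_space A) (dual_left_act A a ?\<phi>) (dual_right_act A ?\<phi> a) b" if "b \<in> V" for b
      using a that by (simp add: dual_space_simps dual_left_act_def dual_right_act_def mult_closed impl)
  qed (simp add: dual_space_simps)
  ultimately show "inner_dual_derivation A D" unfolding inner_dual_derivation_def by blast
qed

end

section \<open>The algebra of approximable operators\<close>

lemma approximable_algebra_simps:
  "ns_carrier (approximable_algebra E) = approximable_ops E"
  "ns_zero (approximable_algebra E) = ns_zero (bounded_op_space E E)"
  "ns_add (approximable_algebra E) = ns_add (bounded_op_space E E)"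
  "ns_scale (approximable_algebra E) = ns_scale (bounded_op_space E E)"
  "ns_diff (approximable_algebra E) = ns_diff (bounded_op_space E E)"
  "ns_norm (approximable_algebra E) = op_norm E E"
  "na_mult (approximable_algebra E) = compose (ns_carrier E)"
  by (simp_all add: approximable_algebra_def fun_eq_iff ns_diff_def)

context normed_space_on
begin

lemma is_normed_space: "normed_space_on E"
  by unfold_locales

abbreviation Ops where "Ops \<equiv> bounded_op_space E E"

lemma Ops_normed_space: "normed_space_on Ops"
  by (rule normed_space_bounded_op_space[OF is_normed_space is_normed_space])

abbreviation Bounded where "Bounded \<equiv> bounded_ops E E"
abbreviation Fin_rank where "Fin_rank \<equiv> finite_rank_ops E E"
abbreviation opn where "opn \<equiv> op_norm E E"

lemmas Op_bound = op_norm_bound[OF is_normed_space is_normed_space]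
lemmas Op_nonneg = op_norm_nonneg[OF is_normed_space is_normed_space]

lemma Op_linear:
  assumes "T \<in> Bounded" "x \<in> V"
  shows "y \<in> V \<Longrightarrow> T (x \<oplus> y) = T x \<oplus> T y" "T (c \<odot> x) = c \<odot> T x" "y \<in> V \<Longrightarrow> T (x \<ominus> y) = T x \<ominus> T y"
  using assms by (auto simp: bounded_ops_iff ns_linear_def ns_diff_def scale_closed)

lemma Op_zero: "T \<in> Bounded \<Longrightarrow> T (ns_zero E) = ns_zero E"
  by (metis Op_linear(2) bounded_ops_closed scale_zero zero_closed)

lemma compose_bounded:
  assumes S: "S \<in> Bounded" and T: "T \<in> Bounded"
  shows "compose V S T \<in> Bounded" "opn (compose V S T) \<le> opn S * opn T"
proof -
  note [simp] = bounded_ops_closed[OF S] bounded_ops_closed[OF T] Op_linear[OF S] Op_linear[OF T]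
  have le: "nrm (compose V S T x) \<le> (opn S * opn T) * nrm x" if x: "x \<in> V" for x
  proof -
    have "nrm (S (T x)) \<le> opn S * (opn T * nrm x)"
      using Op_bound[OF S, of "T x"] Op_bound[OF T x] x Op_nonneg[OF S]
      by (meson bounded_ops_closed[OF T] mult_left_mono order_trans)
    then show ?thesis using x by (simp add: compose_eq mult.assoc)
  qed
  have "ns_linear E E (compose V S T)"
    unfolding ns_linear_def by (auto simp: compose_eq closed)
  then show "compose V S T \<in> Bounded"
    unfolding bounded_ops_iff using le by auto
  show "opn (compose V S T) \<le> opn S * opn T"
    using le Op_nonneg[OF S] Op_nonneg[OF T] by (intro op_norm_le) auto
qed

lemma finite_rank_bounded: "T \<in> Fin_rank \<Longrightarrow> T \<in> Bounded"
  by (simp add: finite_rank_ops_def)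

lemma finite_rank_subspace: "ns_subspace Ops (Fin_rank)"
  unfolding ns_subspace_def
proof (intro conjI ballI allI)
  interpret L: normed_space_on Ops by (rule Ops_normed_space)
  show "Fin_rank \<subseteq> Bounded" by (auto simp: finite_rank_bounded)
  show "ns_zero Ops \<in> Fin_rank"
  proof -
    have "ns_zero Ops ` V \<subseteq> ns_subspace E hull {}"
      using subspace_hull[of "{}"] by (auto simp: bounded_op_space_simps ns_subspace_def)
    then show ?thesis unfolding finite_rank_ops_def using L.zero_closed by blast
  qed
  fix S T c assume S: "S \<in> Fin_rank"
  then obtain B where B: "finite B" "B \<subseteq> V" "S ` V \<subseteq> ns_subspace E hull B" by (auto simp: finite_rank_ops_def)
  have "ns_scale Ops c S ` V \<subseteq> ns_subspace E hull B"
    using B(3) subspace_hull[OF B(2)] by (auto simp: bounded_op_space_simps ns_subspace_def)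
  then show "ns_scale Ops c S \<in> Fin_rank"
    using B L.scale_closed[OF finite_rank_bounded[OF S]] by (auto simp: finite_rank_ops_def)
  assume T: "T \<in> Fin_rank"
  then obtain B' where B': "finite B'" "B' \<subseteq> V" "T ` V \<subseteq> ns_subspace E hull B'" by (auto simp: finite_rank_ops_def)
  have BB: "finite (B \<union> B')" "B \<union> B' \<subseteq> V" using B B' by auto
  have "ns_add Ops S T ` V \<subseteq> ns_subspace E hull (B \<union> B')"
  proof (intro image_subsetI)
    fix x assume x: "x \<in> V"
    then have "S x \<in> ns_subspace E hull (B \<union> B')" "T x \<in> ns_subspace E hull (B \<union> B')"
      using B(3) B'(3) hull_mono[of B "B \<union> B'" "ns_subspace E"] hull_mono[of B' "B \<union> B'" "ns_subspace E"] by blast+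
    then show "ns_add Ops S T x \<in> ns_subspace E hull (B \<union> B')"
      using subspace_hull[OF BB(2)] x by (simp add: bounded_op_space_simps ns_subspace_def)
  qed
  then show "ns_add Ops S T \<in> Fin_rank"
    using BB L.add_closed[OF finite_rank_bounded[OF S] finite_rank_bounded[OF T]]
    unfolding finite_rank_ops_def by blast
qed

lemma compose_finite_rank:
  assumes S: "S \<in> Bounded" and T: "T \<in> Fin_rank"
  shows "compose V S T \<in> Fin_rank"
proof -
  obtain B where B: "finite B" "B \<subseteq> V" "T ` V \<subseteq> ns_subspace E hull B" using T by (auto simp: finite_rank_ops_def)
  have SB: "S ` B \<subseteq> V" using B(2) bounded_ops_closed[OF S] by auto
  note sub = subspace_hull[OF SB, unfolded ns_subspace_def]
  let ?W = "{x \<in> V. S x \<in> ns_subspace E hull (S ` B)}"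
  have "ns_subspace E ?W"
    unfolding ns_subspace_def using sub by (auto simp: closed Op_linear[OF S] Op_zero[OF S])
  moreover have "B \<subseteq> ?W" using B(2) by (auto intro: hull_inc)
  ultimately have "ns_subspace E hull B \<subseteq> ?W" by (intro hull_minimal)
  then have "compose V S T ` V \<subseteq> ns_subspace E hull (S ` B)"
    using B(3) by (auto simp: compose_eq)
  then show ?thesis
    unfolding finite_rank_ops_def using compose_bounded(1)[OF S finite_rank_bounded[OF T]] B(1) SB by blast
qed

abbreviation Approx where "Approx \<equiv> approximable_ops E"

lemma approximable_iff: "T \<in> Approx \<longleftrightarrow> T \<in> Bounded \<and>
    (\<forall>\<epsilon>>0. \<exists>F\<in>Fin_rank. opn (ns_diff Ops T F) < \<epsilon>)"
  by (simp add: approximable_ops_def)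

lemma finite_rank_approximable: "T \<in> Fin_rank \<Longrightarrow> T \<in> Approx"
  using normed_space_on.diff_self[OF Ops_normed_space, of T] normed_space_on.norm_zero[OF Ops_normed_space]
  by (auto simp: approximable_iff finite_rank_bounded bounded_op_space_simps(4) intro!: bexI[of _ T])

lemma approximable_subspace: "ns_subspace Ops (Approx)"
  unfolding ns_subspace_def
proof (intro conjI ballI allI)
  interpret L: normed_space_on Ops by (rule Ops_normed_space)
  note fin = finite_rank_subspace[unfolded ns_subspace_def]
  show "Approx \<subseteq> Bounded" by (auto simp: approximable_iff)
  show "ns_zero Ops \<in> Approx" using fin by (auto intro: finite_rank_approximable)
  fix S T c assume S: "S \<in> Approx"
  then have S': "S \<in> Bounded" by (simp add: approximable_iff)
  show "ns_scale Ops c S \<in> Approx"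
    unfolding approximable_iff
  proof (intro conjI allI impI L.scale_closed S')
    fix \<epsilon> :: real assume "0 < \<epsilon>"
    then have "0 < \<epsilon> / (norm c + 1)" by (simp add: add_nonneg_pos)
    then obtain F where F: "F \<in> Fin_rank" "opn (ns_diff Ops S F) < \<epsilon> / (norm c + 1)"
      using S unfolding approximable_iff by blast
    have F': "F \<in> Bounded" by (rule finite_rank_bounded) fact
    have "opn (ns_diff Ops (ns_scale Ops c S) (ns_scale Ops c F)) = norm c * opn (ns_diff Ops S F)"
      using L.norm_scale[OF L.diff_closed[OF S' F'], of c] L.scale_diff[OF S' F', of c] by (simp add: bounded_op_space_simps(4))
    also have "\<dots> \<le> (norm c + 1) * opn (ns_diff Ops S F)"
      by (intro mult_right_mono Op_nonneg L.diff_closed S' F') simp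
    also have "\<dots> < \<epsilon>" using F(2) by (simp add: pos_less_divide_eq add_nonneg_pos mult.commute)
    finally show "\<exists>G\<in>Fin_rank. opn (ns_diff Ops (ns_scale Ops c S) G) < \<epsilon>"
      using F(1) fin by blast
  qed
  assume T: "T \<in> Approx"
  then have T': "T \<in> Bounded" by (simp add: approximable_iff)
  show "ns_add Ops S T \<in> Approx"
    unfolding approximable_iff
  proof (intro conjI allI impI L.add_closed S' T')
    fix \<epsilon> :: real assume "0 < \<epsilon>"
    then have e: "0 < \<epsilon> / 2" by simp
    obtain F where F: "F \<in> Fin_rank" "opn (ns_diff Ops S F) < \<epsilon> / 2"
      using S[unfolded approximable_iff] e by blast
    obtain G where G: "G \<in> Fin_rank" "opn (ns_diff Ops T G) < \<epsilon> / 2"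
      using T[unfolded approximable_iff] e by blast
    have FG: "F \<in> Bounded" "G \<in> Bounded" using F G by (auto simp: finite_rank_bounded)
    have "opn (ns_diff Ops (ns_add Ops S T) (ns_add Ops F G)) < \<epsilon>"
      using L.norm_triangle[OF L.diff_closed[OF S' FG(1)] L.diff_closed[OF T' FG(2)]] F(2) G(2)
        L.add_diff_add[OF S' T' FG] by (simp add: bounded_op_space_simps(4))
    then show "\<exists>H\<in>Fin_rank. opn (ns_diff Ops (ns_add Ops S T) H) < \<epsilon>"
      using F(1) G(1) fin by blast
  qed
qed

lemma compose_approximable:
  assumes S: "S \<in> Bounded" and T: "T \<in> Approx"
  shows "compose V S T \<in> Approx"
  unfolding approximable_iff
proof (intro conjI allI impI)
  interpret L: normed_space_on Ops by (rule Ops_normed_space)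
  have T': "T \<in> Bounded" using T by (simp add: approximable_iff)
  show "compose V S T \<in> Bounded" by (rule compose_bounded(1)[OF S T'])
  fix \<epsilon> :: real assume "0 < \<epsilon>"
  then have "0 < \<epsilon> / (opn S + 1)" using Op_nonneg[OF S] by simp
  then obtain F where F: "F \<in> Fin_rank" "opn (ns_diff Ops T F) < \<epsilon> / (opn S + 1)"
    using T unfolding approximable_iff by blast
  have F': "F \<in> Bounded" by (rule finite_rank_bounded) fact
  have TF: "ns_diff Ops T F \<in> Bounded" by (intro L.diff_closed T' F')
  have "ns_diff Ops (compose V S T) (compose V S F) = compose V S (ns_diff Ops T F)"
    by (auto simp: bounded_op_space_simps compose_def fun_eq_iff Op_linear[OF S] bounded_ops_closed[OF T'] bounded_ops_closed[OF F'])
  then have "opn (ns_diff Ops (compose V S T) (compose V S F)) \<le> opn S * opn (ns_diff Ops T F)"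
    using compose_bounded(2)[OF S TF] by simp
  also have "\<dots> \<le> (opn S + 1) * opn (ns_diff Ops T F)"
    by (intro mult_right_mono Op_nonneg TF) simp
  also have "\<dots> < \<epsilon>" using F(2) Op_nonneg[OF S] by (simp add: pos_less_divide_eq mult.commute)
  finally show "\<exists>H\<in>Fin_rank. opn (ns_diff Ops (compose V S T) H) < \<epsilon>"
    using compose_finite_rank[OF S F(1)] by blast
qed

lemma normed_algebra_approximable: "normed_algebra_on (approximable_algebra E)"
proof -
  interpret L: normed_space_on Ops by (rule Ops_normed_space)
  have bd: "T \<in> Bounded" if "T \<in> Approx" for T
    using that by (simp add: approximable_iff)
  note sub = approximable_subspace[unfolded ns_subspace_def]
  note nrm = bounded_op_space_simps(4)[of E E, symmetric]
  show ?thesis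
  proof (unfold_locales, unfold approximable_algebra_simps)
    fix S T U c d
    show "ns_zero Ops \<in> Approx" using sub by simp
    assume S: "S \<in> Approx"
    note S' = bd[OF S]
    show "ns_scale Ops c S \<in> Approx" using sub S by simp
    show "ns_add Ops S (ns_zero Ops) = S"
      "ns_scale Ops (c + d) S = ns_add Ops (ns_scale Ops c S) (ns_scale Ops d S)"
      "ns_scale Ops c (ns_scale Ops d S) = ns_scale Ops (c * d) S"
      "ns_scale Ops 1 S = S" "ns_scale Ops 0 S = ns_zero Ops"
      by (simp_all only: L.add_zero[OF S'] L.add_scale[OF S'] L.scale_scale[OF S'] L.scale_one[OF S'] L.scale_zero[OF S'])
    show "opn (ns_scale Ops c S) = norm c * opn S"
      by (simp only: nrm L.norm_scale[OF S'])
    show "S = ns_zero Ops" if "opn S = 0"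
      using L.norm_eq_zeroD[OF S'] that by (simp only: nrm)
    assume T: "T \<in> Approx"
    note T' = bd[OF T]
    note [simp] = bounded_ops_closed[OF S'] bounded_ops_closed[OF T'] Op_linear[OF S'] Op_linear[OF T']
    show "ns_add Ops S T \<in> Approx" "compose V S T \<in> Approx"
      using sub S T compose_approximable[OF S' T] by simp_all
    show "ns_add Ops S T = ns_add Ops T S" by (rule L.add_commute[OF S' T'])
    show "ns_scale Ops c (ns_add Ops S T) = ns_add Ops (ns_scale Ops c S) (ns_scale Ops c T)"
      by (rule L.scale_add[OF S' T'])
    show "opn (ns_add Ops S T) \<le> opn S + opn T"
      by (simp only: nrm L.norm_triangle[OF S' T'])
    show "opn (compose V S T) \<le> opn S * opn T" by (rule compose_bounded(2)[OF S' T'])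
    show "compose V S (ns_scale Ops c T) = ns_scale Ops c (compose V S T)"
      "compose V (ns_scale Ops c S) T = ns_scale Ops c (compose V S T)"
      by (auto simp: bounded_op_space_simps compose_def fun_eq_iff)
    assume U: "U \<in> Approx"
    note U' = bd[OF U]
    note [simp] = bounded_ops_closed[OF U']
    show "ns_add Ops (ns_add Ops S T) U = ns_add Ops S (ns_add Ops T U)"
      by (rule L.add_assoc[OF S' T' U'])
    show "compose V (compose V S T) U = compose V S (compose V T U)"
      "compose V S (ns_add Ops T U) = ns_add Ops (compose V S T) (compose V S U)"
      "compose V (ns_add Ops S T) U = ns_add Ops (compose V S U) (compose V T U)"
      by (auto simp: bounded_op_space_simps compose_def fun_eq_iff)
  qed
qed

lemma finite_rank_coefficients:
  assumes compact_box: "\<And>r. compact {c :: nat \<Rightarrow> 'k. \<forall>i. norm (c i) \<le> r}" and F: "F \<in> Fin_rank"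
  shows "\<exists>(b :: nat \<Rightarrow> 'e) n C. 0 \<le> C \<and> (\<forall>i. b i \<in> V) \<and> (\<forall>x\<in>V. \<exists>c. F x = ns_sum E (\<lambda>i. c i \<odot> b i) n \<and>
    (\<forall>i. norm (c i) \<le> C * nrm x))"
proof -
  obtain B where B: "finite B" "B \<subseteq> V" "F ` V \<subseteq> ns_subspace E hull B" using F by (auto simp: finite_rank_ops_def)
  have F': "F \<in> Bounded" by (rule finite_rank_bounded) fact
  obtain b0 :: "nat \<Rightarrow> 'e" and n where b0: "B = b0 ` {i. i < n}"
    using finite_imp_nat_seg_image_inj_on[OF B(1)] by blast
  define b where "b i = (if i < n then b0 i else ns_zero E)" for i
  have b: "b i \<in> V" for i unfolding b_def using b0 B(2) zero_closed by auto
  have bB: "b ` {..<n} = B" unfolding b0 b_def by auto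
  obtain C where C: "0 \<le> C" "\<And>c. \<exists>c'. ns_sum E (\<lambda>i. c i \<odot> b i) n = ns_sum E (\<lambda>i. c' i \<odot> b i) n \<and>
    (\<forall>i. norm (c' i) \<le> C * nrm (ns_sum E (\<lambda>i. c i \<odot> b i) n))"
    using bounded_coefficients[OF compact_box, where b = b and n = n, OF b] by blast
  have "\<exists>c. F x = ns_sum E (\<lambda>i. c i \<odot> b i) n \<and> (\<forall>i. norm (c i) \<le> (C * opn F) * nrm x)" if x: "x \<in> V" for x
  proof -
    have "F x \<in> ns_subspace E hull (b ` {..<n})" using B(3) x bB by auto
    then obtain c where c: "F x = ns_sum E (\<lambda>i. c i \<odot> b i) n" using hull_linear_combination[where b = b and n = n, OF b] by blast
    obtain c' where c': "F x = ns_sum E (\<lambda>i. c' i \<odot> b i) n" "\<And>i. norm (c' i) \<le> C * nrm (F x)"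
      using C(2)[of c] unfolding c by metis
    have "C * nrm (F x) \<le> C * (opn F * nrm x)" by (intro mult_left_mono Op_bound F' x C)
    then show ?thesis using c' by (intro exI[of _ c']) (auto intro: order_trans simp: mult.assoc)
  qed
  then show ?thesis using b C(1) Op_nonneg[OF F'] by (intro exI[of _ b] exI[of _ n] exI[of _ "C * opn F"]) simp
qed

text \<open>On a finite rank operator, being nearly the identity at finitely many points amounts to being
nearly the identity in operator norm; the bound \<open>M\<close> carries this over to norm limits.\<close>

lemma nearly_identity_on_approximable:
  assumes compact_box: "\<And>r. compact {c :: nat \<Rightarrow> 'k. \<forall>i. norm (c i) \<le> r}"
    and a: "a \<in> Approx" and \<epsilon>: "0 < \<epsilon>" and M: "0 \<le> M"
  shows "\<exists>B \<eta>. finite B \<and> B \<subseteq> V \<and> 0 < \<eta> \<and> (\<forall>R\<in>Bounded. opn R \<le> M \<longrightarrow>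
    (\<forall>b\<in>B. nrm (R b \<ominus> b) \<le> \<eta>) \<longrightarrow> opn (ns_diff Ops (compose V R a) a) \<le> \<epsilon>)"
proof -
  interpret L: normed_space_on Ops by (rule Ops_normed_space)
  have a': "a \<in> Bounded" using a by (simp add: approximable_iff)
  \<comment> \<open>The error of replacing \<open>a\<close> by \<open>F\<close> occurs once with the factor \<open>M\<close> and once with the factor \<open>1\<close>.\<close>
  define \<delta> where "\<delta> = \<epsilon> / (2 * (M + 1))"
  have \<delta>: "0 < \<delta>" unfolding \<delta>_def using \<epsilon> M by simp
  obtain F where F: "F \<in> Fin_rank" "opn (ns_diff Ops a F) < \<delta>"
    using a \<delta> unfolding approximable_iff by blast
  have F': "F \<in> Bounded" by (rule finite_rank_bounded) fact
  obtain b :: "nat \<Rightarrow> 'e" and n C where C: "0 \<le> C" and b: "\<And>i. b i \<in> V"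
    and coeff: "\<And>x. x \<in> V \<Longrightarrow> \<exists>c. F x = ns_sum E (\<lambda>i. c i \<odot> b i) n \<and> (\<forall>i. norm (c i) \<le> C * nrm x)"
    using finite_rank_coefficients[OF compact_box F(1)] by blast
  define \<eta> where "\<eta> = \<epsilon> / 2 / (real n * C + 1)"
  have "0 < X \<Longrightarrow> 0 < \<epsilon> / 2 / X" "0 \<le> X \<Longrightarrow> X * (\<epsilon> / 2 / (X + 1)) \<le> \<epsilon> / 2" for X
    using \<epsilon> by (simp_all add: field_simps)
  from this(1)[of "real n * C + 1"] this(2)[of "real n * C"]
  have \<eta>: "0 < \<eta>" "real n * C * \<eta> \<le> \<epsilon> / 2" unfolding \<eta>_def using C by (simp_all add: add_nonneg_pos)
  show ?thesis
  proof (intro exI[of _ "b ` {..<n}"] exI[of _ \<eta>] conjI ballI impI)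
    fix R assume R: "R \<in> Bounded" "opn R \<le> M" and near: "\<forall>x\<in>b ` {..<n}. nrm (R x \<ominus> x) \<le> \<eta>"
    show "opn (ns_diff Ops (compose V R a) a) \<le> \<epsilon>"
    proof (rule op_norm_le)
      fix x assume x: "x \<in> V"
      note [simp] = bounded_ops_closed[OF a' x] bounded_ops_closed[OF F' x] bounded_ops_closed[OF R(1)] closed b
      have aF: "nrm (a x \<ominus> F x) \<le> \<delta> * nrm x"
      proof -
        have "nrm (a x \<ominus> F x) \<le> opn (ns_diff Ops a F) * nrm x"
          using Op_bound[OF L.diff_closed[OF a' F'] x] x by (simp add: bounded_op_space_simps)
        also have "\<dots> \<le> \<delta> * nrm x" using F(2) by (intro mult_right_mono norm_nonneg x) simp
        finally show ?thesis .
      qed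
      obtain c where c: "F x = ns_sum E (\<lambda>i. c i \<odot> b i) n" "\<And>i. norm (c i) \<le> C * nrm x" using coeff[OF x] by blast
      have RF: "R (F x) \<ominus> F x = ns_sum E (\<lambda>i. c i \<odot> (R (b i) \<ominus> b i)) n"
      proof -
        have "R (F x) = ns_sum E (\<lambda>i. R (c i \<odot> b i)) n"
          unfolding c(1) by (rule ns_linear_sum[OF is_normed_space is_normed_space bounded_ops_linear[OF R(1)]]) simp
        also have "\<dots> = ns_sum E (\<lambda>i. c i \<odot> R (b i)) n" by (simp add: Op_linear[OF R(1)])
        finally have "R (F x) \<ominus> F x = ns_sum E (\<lambda>i. c i \<odot> R (b i)) n \<oplus> ns_sum E (\<lambda>i. (-1) \<odot> (c i \<odot> b i)) n"
          unfolding ns_diff_def c(1) by (subst sum_scale) simp_all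
        also have "\<dots> = ns_sum E (\<lambda>i. c i \<odot> (R (b i) \<ominus> b i)) n"
          by (subst sum_add[symmetric]) (simp_all add: scale_diff, simp add: ns_diff_def)
        finally show ?thesis .
      qed
      have "nrm (R (F x) \<ominus> F x) \<le> (\<Sum>i<n. nrm (c i \<odot> (R (b i) \<ominus> b i)))"
        unfolding RF by (rule norm_sum) simp
      also have "\<dots> \<le> (\<Sum>i<n. C * nrm x * \<eta>)"
        using near c(2) C norm_nonneg[OF x] by (intro sum_mono) (auto simp: norm_scale intro!: mult_mono norm_nonneg)
      also have "\<dots> = real n * C * \<eta> * nrm x" by simp
      also have "\<dots> \<le> \<epsilon> / 2 * nrm x" by (intro mult_right_mono \<eta> norm_nonneg x)
      finally have RF_le: "nrm (R (F x) \<ominus> F x) \<le> \<epsilon> / 2 * nrm x" .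
      have "R (a x) \<ominus> a x = (R (a x) \<ominus> R (F x)) \<oplus> ((R (F x) \<ominus> F x) \<oplus> (F x \<ominus> a x))"
        by (simp add: diff_add_diff)
      then have "nrm (R (a x) \<ominus> a x) \<le> nrm (R (a x \<ominus> F x)) + (nrm (R (F x) \<ominus> F x) + nrm (F x \<ominus> a x))"
        using norm_triangle[of "R (a x) \<ominus> R (F x)" "(R (F x) \<ominus> F x) \<oplus> (F x \<ominus> a x)"]
          norm_triangle[of "R (F x) \<ominus> F x" "F x \<ominus> a x"] by (simp add: Op_linear[OF R(1)])
      also have "nrm (R (a x \<ominus> F x)) \<le> M * (\<delta> * nrm x)"
      proof -
        have "nrm (R (a x \<ominus> F x)) \<le> opn R * nrm (a x \<ominus> F x)" by (intro Op_bound R) simp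
        also have "\<dots> \<le> M * (\<delta> * nrm x)" using R(2) aF M by (intro mult_mono norm_nonneg) simp_all
        finally show ?thesis .
      qed
      also have "nrm (F x \<ominus> a x) \<le> \<delta> * nrm x" using aF by (simp add: norm_diff_commute)
      also note RF_le
      finally have "nrm (R (a x) \<ominus> a x) \<le> ((M + 1) * \<delta> + \<epsilon> / 2) * nrm x" by (simp add: algebra_simps)
      also have "(M + 1) * \<delta> = \<epsilon> / 2" unfolding \<delta>_def using M by (simp add: field_simps)
      finally show "nrm (ns_diff Ops (compose V R a) a x) \<le> \<epsilon> * nrm x"
        using x by (simp add: bounded_op_space_simps compose_eq)
    qed (use \<epsilon> in simp)
  qed (use b \<eta> in auto)
qed

lemma sum_Ops: "x \<in> V \<Longrightarrow> ns_sum Ops f n x = ns_sum E (\<lambda>k. f k x) n"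
  by (induction n) (simp_all add: bounded_op_space_simps)

end

text \<open>The factorization criterion for approximable operators, with operators in place of algebra
elements and finitely many points of \<open>E\<close> in place of finitely many operators.\<close>

theorem weakly_amenable_approximable_algebra:
  fixes E :: "('k::real_or_complex, 'e, 'z) normed_space_scheme"
  assumes E: "normed_space_on E" and M: "0 \<le> M"
    and factors: "\<And>B \<eta> n. finite B \<Longrightarrow> B \<subseteq> ns_carrier E \<Longrightarrow> 0 < \<eta> \<Longrightarrow> \<exists>u v.
      (\<forall>k<n. u k \<in> finite_rank_ops E E \<and> v k \<in> finite_rank_ops E E \<and> op_norm E E (u k) \<le> M \<and> op_norm E E (v k) \<le> M \<and>
        (\<forall>b\<in>B. ns_norm E (ns_diff E (u k (v k b)) b) \<le> \<eta>)) \<and>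
      (\<forall>\<sigma>. (\<forall>k. \<sigma> k \<in> {1, - 1}) \<longrightarrow> (\<forall>a\<in>bounded_ops E E. \<forall>x\<in>ns_carrier E.
        ns_norm E (ns_sum E (\<lambda>k. ns_scale E (\<sigma> k) (v k (a (u k x)))) n) \<le> M * M * op_norm E E a * ns_norm E x))"
  shows "weakly_amenable (approximable_algebra E)"
proof -
  interpret normed_space_on E by (rule E)
  interpret L: normed_space_on Ops by (rule Ops_normed_space)
  interpret A: normed_algebra_on "approximable_algebra E" by (rule normed_algebra_approximable)
  have boxN: "compact {c :: nat \<Rightarrow> 'k. \<forall>i. norm (c i) \<le> r}" for r by (rule compact_bounded_functions)
  have bd: "T \<in> Bounded" if "T \<in> Approx" for T
    using that by (simp add: approximable_iff)
  show ?thesis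
  proof (rule A.weakly_amenable_if_amplified_factorizations, unfold approximable_algebra_simps)
    show "compact {f :: ('e \<Rightarrow> 'e) \<Rightarrow> 'k. \<forall>a. norm (f a) \<le> r a}" for r by (rule compact_bounded_functions)
    show "0 \<le> M * M" using M by simp
    fix S :: "('e \<Rightarrow> 'e) set" and e :: real and n :: nat
    assume S: "finite S" "S \<subseteq> Approx" and e: "0 < e"
    have "\<exists>B \<eta>. finite B \<and> B \<subseteq> V \<and> 0 < \<eta> \<and> (\<forall>R\<in>Bounded. opn R \<le> M * M \<longrightarrow>
      (\<forall>b\<in>B. nrm (R b \<ominus> b) \<le> \<eta>) \<longrightarrow> opn (ns_diff Ops (compose V R a) a) \<le> e)" if "a \<in> S" for a
      using that S(2) M by (intro nearly_identity_on_approximable boxN e) auto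
    then obtain B \<eta> where B: "\<And>a. a \<in> S \<Longrightarrow> finite (B a)" "\<And>a. a \<in> S \<Longrightarrow> B a \<subseteq> V" "\<And>a. a \<in> S \<Longrightarrow> 0 < (\<eta> a :: real)"
      and near: "\<And>a R. a \<in> S \<Longrightarrow> R \<in> Bounded \<Longrightarrow> opn R \<le> M * M \<Longrightarrow>
      (\<forall>b\<in>B a. nrm (R b \<ominus> b) \<le> \<eta> a) \<Longrightarrow> opn (ns_diff Ops (compose V R a) a) \<le> e"
      by metis
    define \<eta>' where "\<eta>' = Min (insert 1 (\<eta> ` S))"
    have \<eta>': "0 < \<eta>'" "\<And>a. a \<in> S \<Longrightarrow> \<eta>' \<le> \<eta> a" unfolding \<eta>'_def using S(1) B(3) by (auto simp: Min_gr_iff)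
    have "finite (\<Union>a\<in>S. B a)" "(\<Union>a\<in>S. B a) \<subseteq> V" using S(1) B by auto
    from factors[OF this \<eta>'(1), of n] obtain u v where
      uv: "\<forall>k<n. u k \<in> Fin_rank \<and> v k \<in> Fin_rank \<and> opn (u k) \<le> M \<and> opn (v k) \<le> M \<and>
        (\<forall>b\<in>(\<Union>a\<in>S. B a). nrm (u k (v k b) \<ominus> b) \<le> \<eta>')"
      and signs: "\<forall>\<sigma>. (\<forall>k. \<sigma> k \<in> {1, - 1}) \<longrightarrow> (\<forall>a\<in>Bounded. \<forall>x\<in>V.
        nrm (ns_sum E (\<lambda>k. \<sigma> k \<odot> v k (a (u k x))) n) \<le> M * M * opn a * nrm x)"
      by (elim exE conjE)
    have uv_bd: "u k \<in> Bounded" "v k \<in> Bounded" if "k < n" for k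
      using uv that by (auto intro: finite_rank_bounded)
    show "\<exists>u v. (\<forall>k<n. u k \<in> Approx \<and> v k \<in> Approx \<and> opn (u k) * opn (v k) \<le> M * M \<and>
          (\<forall>a\<in>S. opn (ns_diff Ops (compose V (compose V (u k) (v k)) a) a) \<le> e)) \<and>
        (\<forall>\<sigma>. (\<forall>k. \<sigma> k \<in> {1, - 1}) \<longrightarrow> (\<forall>a\<in>Approx.
          opn (ns_sum (approximable_algebra E) (\<lambda>k. ns_scale Ops (\<sigma> k) (compose V (compose V (v k) a) (u k))) n) \<le> M * M * opn a))"
    proof (rule exI[of _ u], rule exI[of _ v], intro conjI allI impI ballI)
      fix k assume k: "k < n"
      show "u k \<in> Approx" "v k \<in> Approx"
        using uv k by (auto intro: finite_rank_approximable)
      show uvM: "opn (u k) * opn (v k) \<le> M * M"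
        using uv k M uv_bd[OF k] by (intro mult_mono Op_nonneg) auto
      fix a assume a: "a \<in> S"
      show "opn (ns_diff Ops (compose V (compose V (u k) (v k)) a) a) \<le> e"
      proof (rule near[OF a])
        show "compose V (u k) (v k) \<in> Bounded" by (intro compose_bounded uv_bd k)
        show "opn (compose V (u k) (v k)) \<le> M * M"
          using compose_bounded(2)[OF uv_bd[OF k]] uvM by linarith
        show "\<forall>b\<in>B a. nrm (compose V (u k) (v k) b \<ominus> b) \<le> \<eta> a"
        proof
          fix b assume b: "b \<in> B a"
          have "nrm (u k (v k b) \<ominus> b) \<le> \<eta>'" using uv k a b by blast
          moreover have "b \<in> V" using B(2)[OF a] b by auto
          ultimately show "nrm (compose V (u k) (v k) b \<ominus> b) \<le> \<eta> a" using \<eta>'(2)[OF a] by (simp add: compose_eq)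
        qed
      qed
    next
      fix \<sigma> :: "nat \<Rightarrow> 'k" and a assume \<sigma>: "\<forall>k. \<sigma> k \<in> {1, - 1}" and "a \<in> Approx"
      then have a: "a \<in> Bounded" by (intro bd)
      have "ns_sum (approximable_algebra E) f n = ns_sum Ops f n" for f and n :: nat by (induction n) (simp_all add: approximable_algebra_simps)
      moreover have "ns_sum Ops (\<lambda>k. ns_scale Ops (\<sigma> k) (compose V (compose V (v k) a) (u k))) n x
        = ns_sum E (\<lambda>k. \<sigma> k \<odot> v k (a (u k x))) n" if x: "x \<in> V" for x
        unfolding sum_Ops[OF x]
      proof (rule ns_sum_cong)
        fix k assume "k < n"
        then have "u k x \<in> V" using uv_bd(1) x by (blast intro: bounded_ops_closed)
        then show "ns_scale Ops (\<sigma> k) (compose V (compose V (v k) a) (u k)) x = \<sigma> k \<odot> v k (a (u k x))"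
          using x by (simp add: bounded_op_space_simps compose_eq)
      qed
      ultimately show "opn (ns_sum (approximable_algebra E)
          (\<lambda>k. ns_scale Ops (\<sigma> k) (compose V (compose V (v k) a) (u k))) n) \<le> M * M * opn a"
        using signs \<sigma> a M Op_nonneg[OF a] by (intro op_norm_le) auto
    qed
  qed
qed

section \<open>Strongly measurable functions\<close>

lemma strongly_measurable_simple: "simple_function M f \<Longrightarrow> strongly_measurable M f"
  unfolding strongly_measurable_def by (intro exI[of _ "\<lambda>n. f"]) simp

lemma strongly_measurable_compose_linear:
  assumes "bounded_linear h" "strongly_measurable M f"
  shows "strongly_measurable M (\<lambda>x. h (f x))"
proof -
  obtain s where s: "\<And>n. simple_function M (s n)" "\<And>x. x \<in> space M \<Longrightarrow> (\<lambda>n::nat. s n x) \<longlonglongrightarrow> f x"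
    using assms(2) unfolding strongly_measurable_def by blast
  then show ?thesis unfolding strongly_measurable_def
    by (intro exI[of _ "\<lambda>n x. h (s n x)"])
      (auto intro: simple_function_compose1 bounded_linear.tendsto[OF assms(1)])
qed

lemma strongly_measurable_diff:
  assumes "strongly_measurable M f" "strongly_measurable M g"
  shows "strongly_measurable M (\<lambda>x. f x - g x)"
  using strongly_measurable_add[OF assms(1) strongly_measurable_compose_linear[OF bounded_linear_minus[OF bounded_linear_ident] assms(2)]]
  by simp

lemma strongly_measurable_indicator:
  assumes "strongly_measurable M f" "A \<in> sets M"
  shows "strongly_measurable M (\<lambda>x. indicator A x *\<^sub>R f x)"
proof -
  obtain s where s: "\<And>n. simple_function M (s n)" "\<And>x. x \<in> space M \<Longrightarrow> (\<lambda>n::nat. s n x) \<longlonglongrightarrow> f x"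
    using assms(1) unfolding strongly_measurable_def by blast
  have "simple_function M (\<lambda>x. (indicator A x :: real) *\<^sub>R s n x)" for n
    by (rule simple_function_compose2[OF _ s(1)]) (use assms(2) in \<open>rule simple_function_indicator\<close>)
  then show ?thesis unfolding strongly_measurable_def using s(2)
    by (intro exI[of _ "\<lambda>n x. indicator A x *\<^sub>R s n x"]) (auto intro: tendsto_intros)
qed

lemma strongly_measurable_norm: "strongly_measurable M f \<Longrightarrow> (\<lambda>x. norm (f x)) \<in> borel_measurable M"
  by (rule measurable_compose[OF strongly_measurable_imp_borel borel_measurable_norm])

text \<open>Cutting off the approximants where they exceed twice the limit costs nothing in the limit and
makes dominated convergence applicable.\<close>

lemma strongly_measurable_dominated_approximation:
  assumes f: "strongly_measurable M f"
  obtains s :: "nat \<Rightarrow> _" where "\<And>n. simple_function M (s n)" "\<And>x. x \<in> space M \<Longrightarrow> (\<lambda>n. s n x) \<longlonglongrightarrow> f x"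
    "\<And>n x. norm (s n x) \<le> 2 * norm (f x)"
proof -
  obtain s where s: "\<And>n. simple_function M (s n)" "\<And>x. x \<in> space M \<Longrightarrow> (\<lambda>n::nat. s n x) \<longlonglongrightarrow> f x"
    using f unfolding strongly_measurable_def by blast
  define t where "t n x = (if norm (s n x) \<le> 2 * norm (f x) then s n x else 0)" for n x
  have [measurable]: "(\<lambda>x. norm (f x)) \<in> borel_measurable M" "(\<lambda>x. norm (s n x)) \<in> borel_measurable M" for n
    by (auto intro: strongly_measurable_norm f strongly_measurable_simple s)
  have "simple_function M (t n)" for n
    unfolding t_def by (rule simple_function_If) (auto simp: s(1))
  moreover have "(\<lambda>n. t n x) \<longlonglongrightarrow> f x" if x: "x \<in> space M" for x
  proof (cases "f x = 0")
    case True
    then have "t n x = 0" for n unfolding t_def by auto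
    then show ?thesis using True by simp
  next
    case False
    then have "norm (f x) < 2 * norm (f x)" by simp
    then have "eventually (\<lambda>n. norm (s n x) < 2 * norm (f x)) sequentially"
      by (rule order_tendstoD(2)[OF tendsto_norm[OF s(2)[OF x]]])
    then have "eventually (\<lambda>n. s n x = t n x) sequentially"
      by eventually_elim (simp add: t_def)
    then show ?thesis using s(2)[OF x] by (rule Lim_transform_eventually[rotated])
  qed
  moreover have "norm (t n x) \<le> 2 * norm (f x)" for n x unfolding t_def by auto
  ultimately show ?thesis by (rule that)
qed

abbreviation "simple_bochner_integrable \<equiv> Bochner_Integration.simple_bochner_integrable"
abbreviation "simple_bochner_integral \<equiv> Bochner_Integration.simple_bochner_integral"

section \<open>The p-norm\<close>

definition p_mass :: "real \<Rightarrow> 'w measure \<Rightarrow> ('w \<Rightarrow> 'x::real_normed_vector) \<Rightarrow> real" where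
  "p_mass p M f = (\<integral>x. norm (f x) powr p \<partial>M)"

lemma p_mass_nonneg: "0 \<le> p_mass p M f"
  by (simp add: p_mass_def)

lemma Lp_norm_eq: "Lp_norm p M f = p_mass p M f powr (1 / p)"
  by (simp add: Lp_norm_def p_mass_def)

lemma Lp_norm_nonneg: "0 \<le> Lp_norm p M f"
  by (simp add: Lp_norm_eq)

lemma Lp_norm_powr: "1 \<le> p \<Longrightarrow> Lp_norm p M f powr p = p_mass p M f"
  by (simp add: Lp_norm_eq powr_powr p_mass_nonneg)

lemma Lp_norm_le_iff:
  assumes "1 \<le> p" "0 \<le> c"
  shows "Lp_norm p M f \<le> c \<longleftrightarrow> p_mass p M f \<le> c powr p"
proof
  assume "Lp_norm p M f \<le> c"
  then have "Lp_norm p M f powr p \<le> c powr p" using assms by (intro powr_mono2 Lp_norm_nonneg) auto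
  then show "p_mass p M f \<le> c powr p" using assms by (simp add: Lp_norm_powr)
next
  assume "p_mass p M f \<le> c powr p"
  then have "p_mass p M f powr (1 / p) \<le> (c powr p) powr (1 / p)"
    using assms by (intro powr_mono2 p_mass_nonneg) auto
  then show "Lp_norm p M f \<le> c" using assms by (simp add: Lp_norm_eq powr_powr)
qed

text \<open>The tangent inequality is behind both the triangle inequality of the p-norm and the Jensen
inequality for averages. The boundary point \<open>t = 0\<close> is outside the open half-line on which the
power function has tangents, and is treated separately.\<close>

lemma powr_tangent:
  fixes p :: real
  assumes "1 \<le> p" "0 \<le> t" "0 < m"
  shows "m powr p + p * m powr (p - 1) * (t - m) \<le> t powr p"
proof (cases "t = 0")
  case True
  have "m powr (p - 1) * m = m powr p" using assms by (simp add: powr_diff)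
  then have "m powr p + p * m powr (p - 1) * (0 - m) = (1 - p) * m powr p"
    by (simp add: algebra_simps)
  also have "\<dots> \<le> 0" using assms by (simp add: mult_nonpos_nonneg)
  finally show ?thesis using True by simp
next
  case False
  have "p * m powr (p - 1) * (t - m) \<le> t powr p - m powr p"
  proof (rule convex_on_imp_above_tangent[OF powr_convex[OF assms(1)]])
    show "((\<lambda>x. x powr p) has_real_derivative p * m powr (p - 1)) (at m within {0<..})"
      using assms by (auto intro!: derivative_eq_intros)
  qed (use assms False in \<open>auto simp: interior_open\<close>)
  then show ?thesis by simp
qed

text \<open>Convexity of the p-th power at the convex combination of \<open>s / a\<close> and \<open>t / b\<close> with weights
\<open>a / (a + b)\<close> and \<open>b / (a + b)\<close>. With \<open>a\<close> and \<open>b\<close> (just above) the norms of two functions this becomes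
Minkowski's inequality.\<close>

lemma powr_convex_combination:
  fixes p :: real
  assumes p: "1 \<le> p" and s: "0 \<le> s" and t: "0 \<le> t" and a: "0 < a" and b: "0 < b"
  shows "(s + t) powr p \<le> (a + b) powr p * (a / (a + b) * (s / a) powr p + b / (a + b) * (t / b) powr p)"
proof -
  let ?m = "(s + t) / (a + b)"
  have "?m powr p \<le> a / (a + b) * (s / a) powr p + b / (a + b) * (t / b) powr p"
  proof (cases "?m = 0")
    case True
    then show ?thesis using a b by simp
  next
    case False
    then have m: "0 < ?m" using s t a b by (simp add: zero_less_divide_iff) 
    let ?d = "p * ?m powr (p - 1)"
    have "a / (a + b) * (?m powr p + ?d * (s / a - ?m)) + b / (a + b) * (?m powr p + ?d * (t / b - ?m))
      \<le> a / (a + b) * (s / a) powr p + b / (a + b) * (t / b) powr p"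
      using a b s t by (intro add_mono mult_left_mono powr_tangent p m) auto
    also have "a / (a + b) * (?m powr p + ?d * (s / a - ?m)) + b / (a + b) * (?m powr p + ?d * (t / b - ?m)) = ?m powr p"
    proof -
      have comb: "\<alpha> * (P + d * (x - m)) + \<beta> * (P + d * (y - m)) = (\<alpha> + \<beta>) * P + d * ((\<alpha> * x + \<beta> * y) - (\<alpha> + \<beta>) * m)"
        for \<alpha> \<beta> P d x y m :: real by (simp add: algebra_simps)
      have "a / (a + b) + b / (a + b) = 1" "a / (a + b) * (s / a) + b / (a + b) * (t / b) = ?m"
        using a b by (simp_all add: add_divide_distrib[symmetric])
      then show ?thesis unfolding comb by simp
    qed
    finally show ?thesis by simp
  qed
  then have "(a + b) powr p * ?m powr p \<le> (a + b) powr p * (a / (a + b) * (s / a) powr p + b / (a + b) * (t / b) powr p)"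
    by (intro mult_left_mono) auto
  moreover have "(a + b) powr p * ?m powr p = (s + t) powr p"
    using a b s t by (simp add: powr_divide)
  ultimately show ?thesis by simp
qed

lemma Lp_norm_triangle:
  fixes f g :: "'w \<Rightarrow> 'x::real_normed_vector"
  assumes p: "1 \<le> p" and f: "f \<in> Lp_functions p M" and g: "g \<in> Lp_functions p M"
  shows "Lp_norm p M (\<lambda>x. f x + g x) \<le> Lp_norm p M f + Lp_norm p M g"
proof (rule field_le_epsilon)
  fix e :: real assume e: "0 < e"
  define a where "a = Lp_norm p M f + e / 2"
  define b where "b = Lp_norm p M g + e / 2"
  have a: "0 < a" "p_mass p M f \<le> a powr p"
    using e Lp_norm_nonneg[of p M f] Lp_norm_le_iff[OF p, of a M f] by (auto simp: a_def)
  have b: "0 < b" "p_mass p M g \<le> b powr p"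
    using e Lp_norm_nonneg[of p M g] Lp_norm_le_iff[OF p, of b M g] by (auto simp: b_def)
  let ?c = "(a + b) powr p"
  let ?h = "\<lambda>x. ?c * (a / (a + b) * (norm (f x) powr p / a powr p) + b / (a + b) * (norm (g x) powr p / b powr p))"
  have int: "integrable M (\<lambda>x. norm (f x) powr p)" "integrable M (\<lambda>x. norm (g x) powr p)"
    using f g by (auto simp: Lp_functions_def)
  have "p_mass p M (\<lambda>x. f x + g x) \<le> (\<integral>x. ?h x \<partial>M)"
    unfolding p_mass_def
  proof (rule integral_mono)
    show "integrable M (\<lambda>x. norm (f x + g x) powr p)"
      using Lp_functions_add[OF f g p] by (simp add: Lp_functions_def)
    show "integrable M ?h" using int by simp
    fix x
    have "norm (f x + g x) powr p \<le> (norm (f x) + norm (g x)) powr p"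
      using p by (intro powr_mono2 norm_triangle_ineq) auto
    also have "\<dots> \<le> ?h x"
      using powr_convex_combination[OF p _ _ a(1) b(1), of "norm (f x)" "norm (g x)"] a(1) b(1) by (simp add: powr_divide)
    finally show "norm (f x + g x) powr p \<le> ?h x" .
  qed
  also have "\<dots> = ?c * (a / (a + b) * (p_mass p M f / a powr p) + b / (a + b) * (p_mass p M g / b powr p))"
    using int by (simp add: p_mass_def)
  also have "\<dots> \<le> ?c * (a / (a + b) * 1 + b / (a + b) * 1)"
    using a b by (intro mult_left_mono add_mono) (auto simp: divide_le_eq_1)
  also have "\<dots> = ?c" using a b by (simp add: add_divide_distrib[symmetric])
  finally have "Lp_norm p M (\<lambda>x. f x + g x) \<le> a + b"
    using a b by (subst Lp_norm_le_iff[OF p]) auto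
  then show "Lp_norm p M (\<lambda>x. f x + g x) \<le> Lp_norm p M f + Lp_norm p M g + e" by (simp add: a_def b_def)
qed

lemma Lp_functions_diff:
  assumes "f \<in> Lp_functions p M" "g \<in> Lp_functions p M" "1 \<le> p"
  shows "(\<lambda>x. f x - g x) \<in> Lp_functions p M"
proof -
  have "(\<lambda>x. - g x) \<in> Lp_functions p M"
    using assms(2) strongly_measurable_compose_linear[OF bounded_linear_minus[OF bounded_linear_ident], of M g]
    by (simp add: Lp_functions_def)
  from Lp_functions_add[OF assms(1) this assms(3)] show ?thesis by simp
qed

lemma Lp_functions_simple:
  assumes "simple_bochner_integrable M f" "1 \<le> p"
  shows "f \<in> Lp_functions p M"
proof -
  have sf: "simple_function M f" using assms(1) by (simp add: simple_bochner_integrable.simps)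
  have "simple_bochner_integrable M (\<lambda>x. norm (f x) powr p)"
    using simple_bochner_integrable_compose2[of "\<lambda>x y. norm x powr p", OF _ assms(1) assms(1)] by simp
  then have "integrable M (\<lambda>x. norm (f x) powr p)"
    using has_bochner_integral_simple_bochner_integrable integrable.simps by blast
  then show ?thesis using sf by (simp add: Lp_functions_def strongly_measurable_simple)
qed

lemma Lp_simple_dense:
  fixes f :: "'w \<Rightarrow> 'x::real_normed_vector"
  assumes p: "1 \<le> p" and f: "f \<in> Lp_functions p M" and e: "0 < e"
  shows "\<exists>s. simple_bochner_integrable M s \<and> Lp_norm p M (\<lambda>x. f x - s x) \<le> e"
proof -
  have sm: "strongly_measurable M f" and int: "integrable M (\<lambda>x. norm (f x) powr p)"
    using f by (auto simp: Lp_functions_def)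
  obtain s :: "nat \<Rightarrow> 'w \<Rightarrow> 'x" where s: "\<And>n. simple_function M (s n)" "\<And>x. x \<in> space M \<Longrightarrow> (\<lambda>n. s n x) \<longlonglongrightarrow> f x"
    "\<And>n x. norm (s n x) \<le> 2 * norm (f x)" using strongly_measurable_dominated_approximation[OF sm] by blast
  have smd: "strongly_measurable M (\<lambda>x. f x - s n x)" for n
    by (intro strongly_measurable_diff sm strongly_measurable_simple s)
  have sb: "simple_bochner_integrable M (s n)" for n
  proof -
    have [measurable]: "(\<lambda>x. norm (s n x)) \<in> borel_measurable M"
      by (intro strongly_measurable_norm strongly_measurable_simple s)
    have "integrable M (\<lambda>x. norm (s n x) powr p)"
    proof (rule Bochner_Integration.integrable_bound)
      show "integrable M (\<lambda>x. 2 powr p * norm (f x) powr p)" using int by simp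
      show "AE x in M. norm (norm (s n x) powr p) \<le> norm (2 powr p * norm (f x) powr p)"
        using p s(3) by (intro AE_I2) (simp add: powr_mult[symmetric] powr_mono2)
    qed measurable
    moreover have "simple_function M (\<lambda>x. norm (s n x) powr p)"
      by (rule simple_function_compose1[OF s(1)])
    ultimately have "simple_bochner_integrable M (\<lambda>x. norm (s n x) powr p)"
      by (intro simple_bochner_integrableI_bounded) (auto simp: integrable_iff_bounded)
    then have "emeasure M {x \<in> space M. s n x \<noteq> 0} \<noteq> \<infinity>"
      using p by (simp add: simple_bochner_integrable.simps)
    then show ?thesis using s(1) by (simp add: simple_bochner_integrable.simps)
  qed
  have "(\<lambda>n. \<integral>x. norm (f x - s n x) powr p \<partial>M) \<longlonglongrightarrow> (\<integral>x. 0 \<partial>M)"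
  proof (rule integral_dominated_convergence[where w = "\<lambda>x. 3 powr p * norm (f x) powr p"])
    show "AE x in M. (\<lambda>n. norm (f x - s n x) powr p) \<longlonglongrightarrow> 0"
    proof (rule AE_I2)
      fix x assume "x \<in> space M"
      from tendsto_norm[OF tendsto_diff[OF tendsto_const s(2)[OF this], of "f x"]]
      have "(\<lambda>n. norm (f x - s n x)) \<longlonglongrightarrow> 0" by simp
      from tendsto_powr'[OF this tendsto_const[of p]] p
      show "(\<lambda>n. norm (f x - s n x) powr p) \<longlonglongrightarrow> 0" by simp
    qed
    show "AE x in M. norm (norm (f x - s n x) powr p) \<le> 3 powr p * norm (f x) powr p" for n
    proof (rule AE_I2)
      fix x
      have "norm (f x - s n x) \<le> 3 * norm (f x)"
        using norm_triangle_ineq4[of "f x" "s n x"] s(3)[of n x] by simp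
      then show "norm (norm (f x - s n x) powr p) \<le> 3 powr p * norm (f x) powr p"
        using p by (simp add: powr_mult[symmetric] powr_mono2)
    qed
    show "(\<lambda>x. norm (f x - s n x) powr p) \<in> borel_measurable M" for n
      using strongly_measurable_norm[OF smd, of n] by measurable
  qed (use int in auto)
  then have "(\<lambda>n. p_mass p M (\<lambda>x. f x - s n x)) \<longlonglongrightarrow> 0" by (simp add: p_mass_def)
  then have "eventually (\<lambda>n. p_mass p M (\<lambda>x. f x - s n x) < e powr p) sequentially"
    using e by (intro order_tendstoD(2)) auto
  then obtain n where "p_mass p M (\<lambda>x. f x - s n x) < e powr p"
    unfolding eventually_sequentially by blast
  then have "Lp_norm p M (\<lambda>x. f x - s n x) \<le> e" using e p by (simp add: Lp_norm_le_iff)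
  then show ?thesis using sb by blast
qed

section \<open>Bochner integrals in arbitrary Banach spaces\<close>

text \<open>The values lie in a Banach space that need not be separable. The integral of simple functions
makes sense in every normed space; by density of the simple functions in \<open>L\<^sub>1\<close> it extends by
continuity.\<close>

abbreviation bochner_integrable :: "'w measure \<Rightarrow> ('w \<Rightarrow> 'x::real_normed_vector) \<Rightarrow> bool" where
  "bochner_integrable M f \<equiv> f \<in> Lp_functions 1 M"

lemma bochner_integrable_iff:
  "bochner_integrable M f \<longleftrightarrow> strongly_measurable M f \<and> integrable M (\<lambda>x. norm (f x))"
  by (simp add: Lp_functions_def)

lemma bochner_integrable_norm: "bochner_integrable M f \<Longrightarrow> integrable M (\<lambda>x. norm (f x))"
  by (simp add: bochner_integrable_iff)

lemmas bochner_integrable_simple = Lp_functions_simple[OF _ order_refl]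
lemmas bochner_integrable_add = Lp_functions_add[OF _ _ order_refl]
lemmas bochner_integrable_diff = Lp_functions_diff[OF _ _ order_refl]

definition simple_approx :: "'w measure \<Rightarrow> ('w \<Rightarrow> 'x::real_normed_vector) \<Rightarrow> (nat \<Rightarrow> 'w \<Rightarrow> 'x) \<Rightarrow> bool" where
  "simple_approx M f s \<longleftrightarrow> (\<forall>n. simple_bochner_integrable M (s n)) \<and>
    (\<lambda>n. \<integral>x. norm (f x - s n x) \<partial>M) \<longlonglongrightarrow> 0"

definition bochner_int :: "'w measure \<Rightarrow> ('w \<Rightarrow> 'x::real_normed_vector) \<Rightarrow> 'x" where
  "bochner_int M f = lim (\<lambda>n. simple_bochner_integral M ((SOME s. simple_approx M f s) n))"

lemma simple_bochner_integrable_real: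
  assumes "simple_bochner_integrable M s"
  shows "simple_bochner_integrable M (\<lambda>x. norm (s x))"
  using simple_bochner_integrable_compose2[of "\<lambda>x y. norm x", OF _ assms assms] by simp

lemma norm_simple_bochner_integral_le:
  assumes "simple_bochner_integrable M s"
  shows "norm (simple_bochner_integral M s) \<le> (\<integral>x. norm (s x) \<partial>M)"
  using simple_bochner_integral_norm_bound[OF assms]
    has_bochner_integral_simple_bochner_integrable[OF simple_bochner_integrable_real[OF assms]]
  by (simp add: has_bochner_integral_integral_eq)

lemma norm_diff_simple_bochner_integral_le:
  assumes f: "bochner_integrable M f" and s: "simple_bochner_integrable M s" "simple_bochner_integrable M t"
  shows "norm (simple_bochner_integral M s - simple_bochner_integral M t)
    \<le> (\<integral>x. norm (f x - s x) \<partial>M) + (\<integral>x. norm (f x - t x) \<partial>M)"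
proof -
  have st: "simple_bochner_integrable M (\<lambda>x. s x - t x)"
    by (rule simple_bochner_integrable_compose2[OF _ s]) simp
  note i = bochner_integrable_norm[OF bochner_integrable_diff[OF f bochner_integrable_simple[OF s(1)]]]
    bochner_integrable_norm[OF bochner_integrable_diff[OF f bochner_integrable_simple[OF s(2)]]]
  have "norm (simple_bochner_integral M s - simple_bochner_integral M t) \<le> (\<integral>x. norm (s x - t x) \<partial>M)"
    using norm_simple_bochner_integral_le[OF st] by (simp add: simple_bochner_integral_diff s)
  also have "\<dots> \<le> (\<integral>x. norm (f x - s x) + norm (f x - t x) \<partial>M)"
  proof (rule integral_mono)
    show "integrable M (\<lambda>x. norm (s x - t x))" by (rule bochner_integrable_norm[OF bochner_integrable_simple[OF st]])
    show "norm (s x - t x) \<le> norm (f x - s x) + norm (f x - t x)" for x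
      using norm_triangle_ineq4[of "f x - t x" "f x - s x"] by simp
  qed (intro Bochner_Integration.integrable_add i)
  also have "\<dots> = (\<integral>x. norm (f x - s x) \<partial>M) + (\<integral>x. norm (f x - t x) \<partial>M)"
    by (rule Bochner_Integration.integral_add[OF i])
  finally show ?thesis .
qed

lemma simple_approx_exists:
  assumes f: "bochner_integrable M f"
  shows "\<exists>s. simple_approx M f s"
proof -
  have "\<exists>t. simple_bochner_integrable M t \<and> Lp_norm 1 M (\<lambda>x. f x - t x) \<le> inverse (real (Suc n))" for n
    by (rule Lp_simple_dense[OF order_refl f]) simp
  then obtain s where s: "\<And>n. simple_bochner_integrable M (s n)"
    "\<And>n. Lp_norm 1 M (\<lambda>x. f x - s n x) \<le> inverse (real (Suc n))" by metis
  have "(\<lambda>n. \<integral>x. norm (f x - s n x) \<partial>M) \<longlonglongrightarrow> 0"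
  proof (rule Lim_null_comparison[OF always_eventually LIMSEQ_inverse_real_of_nat], rule allI)
    show "norm (\<integral>x. norm (f x - s n x) \<partial>M) \<le> inverse (real (Suc n))" for n
      using s(2)[of n] by (simp add: Lp_norm_def)
  qed
  with s(1) show ?thesis unfolding simple_approx_def by blast
qed

text \<open>Independence of the approximating sequence: the integrals of any two such sequences differ by a
null sequence, which also shows that they are Cauchy.\<close>

lemma bochner_int_limit:
  fixes f :: "'w \<Rightarrow> 'x::banach"
  assumes f: "bochner_integrable M f" and s: "simple_approx M f s"
  shows "(\<lambda>n. simple_bochner_integral M (s n)) \<longlonglongrightarrow> bochner_int M f"
proof -
  define t where "t = (SOME s. simple_approx M f s)"
  have t: "simple_approx M f t" unfolding t_def by (rule someI_ex[OF simple_approx_exists[OF f]])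
  have lim: "(\<lambda>n. \<integral>x. norm (f x - t n x) \<partial>M) \<longlonglongrightarrow> 0" using t unfolding simple_approx_def by simp
  have "Cauchy (\<lambda>n. simple_bochner_integral M (t n))"
  proof (rule metric_CauchyI)
    fix e :: real assume "0 < e"
    then have "eventually (\<lambda>n. (\<integral>x. norm (f x - t n x) \<partial>M) < e / 2) sequentially"
      by (intro order_tendstoD(2)[OF lim]) simp
    then obtain N where N: "\<And>n. n \<ge> N \<Longrightarrow> (\<integral>x. norm (f x - t n x) \<partial>M) < e / 2"
      unfolding eventually_sequentially by blast
    have "dist (simple_bochner_integral M (t m)) (simple_bochner_integral M (t n)) < e" if "m \<ge> N" "n \<ge> N" for m n
      using norm_diff_simple_bochner_integral_le[OF f, of "t m" "t n"] t N[OF that(1)] N[OF that(2)]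
      unfolding simple_approx_def dist_norm by auto
    then show "\<exists>N. \<forall>m\<ge>N. \<forall>n\<ge>N. dist (simple_bochner_integral M (t m)) (simple_bochner_integral M (t n)) < e"
      by blast
  qed
  then have tlim: "(\<lambda>n. simple_bochner_integral M (t n)) \<longlonglongrightarrow> bochner_int M f"
    unfolding bochner_int_def t_def[symmetric] using Cauchy_convergent convergent_LIMSEQ_iff by blast
  have "(\<lambda>n. (\<integral>x. norm (f x - s n x) \<partial>M) + (\<integral>x. norm (f x - t n x) \<partial>M)) \<longlonglongrightarrow> 0"
    using tendsto_add[OF _ lim, of _ 0] s unfolding simple_approx_def by simp
  then have "(\<lambda>n. simple_bochner_integral M (s n) - simple_bochner_integral M (t n)) \<longlonglongrightarrow> 0"
    by (rule Lim_null_comparison[OF always_eventually, rotated])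
      (use norm_diff_simple_bochner_integral_le[OF f] s t in \<open>auto simp: simple_approx_def\<close>)
  from tendsto_add[OF this tlim] show ?thesis by simp
qed

lemma bochner_int_add:
  fixes f :: "'w \<Rightarrow> 'x::banach"
  assumes f: "bochner_integrable M f" and g: "bochner_integrable M g"
  shows "bochner_int M (\<lambda>x. f x + g x) = bochner_int M f + bochner_int M g"
proof -
  obtain s t where s: "simple_approx M f s" and t: "simple_approx M g t"
    using simple_approx_exists[OF f] simple_approx_exists[OF g] by blast
  have st: "simple_bochner_integrable M (s n)" "simple_bochner_integrable M (t n)" for n
    using s t by (auto simp: simple_approx_def)
  have i: "integrable M (\<lambda>x. norm (f x - s n x))" "integrable M (\<lambda>x. norm (g x - t n x))" for n
    by (rule bochner_integrable_norm[OF bochner_integrable_diff[OF f bochner_integrable_simple[OF st(1)]]],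
      rule bochner_integrable_norm[OF bochner_integrable_diff[OF g bochner_integrable_simple[OF st(2)]]])
  have "simple_approx M (\<lambda>x. f x + g x) (\<lambda>n x. s n x + t n x)"
    unfolding simple_approx_def
  proof (intro conjI allI)
    show stn: "simple_bochner_integrable M (\<lambda>x. s n x + t n x)" for n
      by (rule simple_bochner_integrable_compose2[OF _ st]) simp
    have lim: "(\<lambda>n. (\<integral>x. norm (f x - s n x) \<partial>M) + (\<integral>x. norm (g x - t n x) \<partial>M)) \<longlonglongrightarrow> 0"
      using tendsto_add[OF conjunct2[OF s[unfolded simple_approx_def]] conjunct2[OF t[unfolded simple_approx_def]]] by simp
    show "(\<lambda>n. \<integral>x. norm (f x + g x - (s n x + t n x)) \<partial>M) \<longlonglongrightarrow> 0"
    proof (rule Lim_null_comparison[OF always_eventually lim], rule allI)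
      fix n
      have "(\<integral>x. norm (f x + g x - (s n x + t n x)) \<partial>M) \<le> (\<integral>x. norm (f x - s n x) + norm (g x - t n x) \<partial>M)"
      proof (rule integral_mono)
        show "integrable M (\<lambda>x. norm (f x + g x - (s n x + t n x)))"
          by (intro bochner_integrable_norm bochner_integrable_diff bochner_integrable_add f g bochner_integrable_simple st)
        show "norm (f x + g x - (s n x + t n x)) \<le> norm (f x - s n x) + norm (g x - t n x)" for x
          using norm_triangle_ineq[of "f x - s n x" "g x - t n x"] by (simp add: algebra_simps)
      qed (intro Bochner_Integration.integrable_add i)
      then show "norm (\<integral>x. norm (f x + g x - (s n x + t n x)) \<partial>M) \<le>
          (\<integral>x. norm (f x - s n x) \<partial>M) + (\<integral>x. norm (g x - t n x) \<partial>M)"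
        by (simp add: Bochner_Integration.integral_add[OF i])
    qed
  qed
  from bochner_int_limit[OF bochner_integrable_add[OF f g] this]
  have "(\<lambda>n. simple_bochner_integral M (s n) + simple_bochner_integral M (t n)) \<longlonglongrightarrow> bochner_int M (\<lambda>x. f x + g x)"
    by (simp add: simple_bochner_integral_add st)
  then show ?thesis
    using tendsto_add[OF bochner_int_limit[OF f s] bochner_int_limit[OF g t]] by (rule LIMSEQ_unique)
qed

lemma bochner_int_bounded_linear:
  fixes f :: "'w \<Rightarrow> 'x::banach" and h :: "'x \<Rightarrow> 'y::banach"
  assumes h: "bounded_linear h" and f: "bochner_integrable M f"
  shows "bochner_integrable M (\<lambda>x. h (f x))" "bochner_int M (\<lambda>x. h (f x)) = h (bochner_int M f)"
proof -
  interpret bounded_linear h by (rule h)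
  obtain K where K: "\<And>x. norm (h x) \<le> norm x * K" "0 \<le> K" using nonneg_bounded by blast
  have int_h: "bochner_integrable M (\<lambda>x. h (f x))" if f: "bochner_integrable M f" for f
    unfolding bochner_integrable_iff
  proof
    show sm: "strongly_measurable M (\<lambda>x. h (f x))"
      using f by (auto simp: bochner_integrable_iff intro: strongly_measurable_compose_linear[OF h])
    show "integrable M (\<lambda>x. norm (h (f x)))"
      by (rule Bochner_Integration.integrable_bound[where f = "\<lambda>x. norm (f x) * K"])
        (use K bochner_integrable_norm[OF f] in \<open>auto intro: strongly_measurable_norm[OF sm]\<close>)
  qed
  show 1: "bochner_integrable M (\<lambda>x. h (f x))" by (rule int_h[OF f])
  obtain s where s: "simple_approx M f s" using simple_approx_exists[OF f] by blast
  have sb: "simple_bochner_integrable M (s n)" for n using s by (auto simp: simple_approx_def)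
  have shb: "simple_bochner_integrable M (\<lambda>x. h (s n x))" for n
    by (rule simple_bochner_integrable_compose2[of "\<lambda>x y. h x", OF _ sb sb]) (simp add: zero)
  note i = bochner_integrable_diff[OF f bochner_integrable_simple[OF sb]]
  have "simple_approx M (\<lambda>x. h (f x)) (\<lambda>n x. h (s n x))"
    unfolding simple_approx_def
  proof (intro conjI allI shb)
    have "(\<lambda>n. \<integral>x. norm (f x - s n x) \<partial>M) \<longlonglongrightarrow> 0" using s by (simp add: simple_approx_def)
    from tendsto_mult_left[OF this, of K] have lim: "(\<lambda>n. K * (\<integral>x. norm (f x - s n x) \<partial>M)) \<longlonglongrightarrow> 0" by simp
    show "(\<lambda>n. \<integral>x. norm (h (f x) - h (s n x)) \<partial>M) \<longlonglongrightarrow> 0"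
    proof (rule Lim_null_comparison[OF always_eventually lim], rule allI)
      fix n
      have "(\<integral>x. norm (h (f x) - h (s n x)) \<partial>M) \<le> (\<integral>x. K * norm (f x - s n x) \<partial>M)"
      proof (rule integral_mono)
        show "integrable M (\<lambda>x. norm (h (f x) - h (s n x)))"
          by (intro bochner_integrable_norm bochner_integrable_diff 1 bochner_integrable_simple shb)
        show "norm (h (f x) - h (s n x)) \<le> K * norm (f x - s n x)" for x
          using K(1)[of "f x - s n x"] by (simp add: diff mult.commute)
      qed (intro integrable_mult_right bochner_integrable_norm i)
      then show "norm (\<integral>x. norm (h (f x) - h (s n x)) \<partial>M) \<le> K * (\<integral>x. norm (f x - s n x) \<partial>M)"
        by simp
    qed
  qed
  from bochner_int_limit[OF 1 this]
  have "(\<lambda>n. h (simple_bochner_integral M (s n))) \<longlonglongrightarrow> bochner_int M (\<lambda>x. h (f x))"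
    by (simp add: simple_bochner_integral_linear[OF linear_axioms sb])
  then show "bochner_int M (\<lambda>x. h (f x)) = h (bochner_int M f)"
    using tendsto[OF bochner_int_limit[OF f s]] by (rule LIMSEQ_unique)
qed

lemma norm_bochner_int_le:
  fixes f :: "'w \<Rightarrow> 'x::banach"
  assumes f: "bochner_integrable M f"
  shows "norm (bochner_int M f) \<le> (\<integral>x. norm (f x) \<partial>M)"
proof -
  obtain s where s: "simple_approx M f s" using simple_approx_exists[OF f] by blast
  have sb: "simple_bochner_integrable M (s n)" for n using s by (auto simp: simple_approx_def)
  have z: "simple_bochner_integrable M (\<lambda>x. 0 :: 'x)" by (auto simp: simple_bochner_integrable.simps)
  have sz: "simple_bochner_integral M (\<lambda>x. 0 :: 'x) = 0"
    by (auto simp: simple_bochner_integral_def intro!: sum.neutral)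
  have "(\<lambda>n. (\<integral>x. norm (f x - s n x) \<partial>M) + (\<integral>x. norm (f x) \<partial>M)) \<longlonglongrightarrow> 0 + (\<integral>x. norm (f x) \<partial>M)"
    using s unfolding simple_approx_def by (intro tendsto_add tendsto_const) simp
  moreover have "norm (simple_bochner_integral M (s n)) \<le> (\<integral>x. norm (f x - s n x) \<partial>M) + (\<integral>x. norm (f x) \<partial>M)" for n
    using norm_diff_simple_bochner_integral_le[OF f sb z, of n] by (simp add: sz)
  ultimately show ?thesis
    using LIMSEQ_le[OF tendsto_norm[OF bochner_int_limit[OF f s]]] by auto
qed

lemma simple_bochner_integrable_indicator:
  assumes A: "A \<in> sets M" "emeasure M A < \<infinity>"
  shows "simple_bochner_integrable M (\<lambda>x. indicat_real A x *\<^sub>R y)"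
proof (rule simple_bochner_integrable.intros)
  show "simple_function M (\<lambda>x. indicat_real A x *\<^sub>R y)"
    by (rule simple_function_compose1[OF simple_function_indicator[OF A(1)]])
  have "emeasure M {x \<in> space M. indicat_real A x *\<^sub>R y \<noteq> 0} \<le> emeasure M A"
    by (rule emeasure_mono) (use A in \<open>auto simp: indicator_def split: if_splits\<close>)
  then show "emeasure M {x \<in> space M. indicat_real A x *\<^sub>R y \<noteq> 0} \<noteq> \<infinity>"
    using A(2) by (auto simp: top_unique)
qed

lemma bochner_int_indicator:
  fixes y :: "'x::banach"
  assumes A: "A \<in> sets M" "emeasure M A < \<infinity>"
  shows "bochner_int M (\<lambda>x. indicator A x *\<^sub>R y) = measure M A *\<^sub>R y"
proof -
  let ?f = "\<lambda>x. indicat_real A x *\<^sub>R y"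
  note sb = simple_bochner_integrable_indicator[OF A]
  have sb1: "simple_bochner_integrable M (indicator A :: _ \<Rightarrow> real)" using sb[of "1 :: real"] by simp
  have "simple_approx M ?f (\<lambda>n. ?f)" using sb by (simp add: simple_approx_def)
  from bochner_int_limit[OF bochner_integrable_simple[OF sb] this]
  have "bochner_int M ?f = simple_bochner_integral M ?f" by (simp add: LIMSEQ_const_iff)
  also have "\<dots> = simple_bochner_integral M (indicator A :: _ \<Rightarrow> real) *\<^sub>R y"
    by (rule simple_bochner_integral_linear[OF _ sb1, where f = "\<lambda>r. r *\<^sub>R y"]) (simp add: linear_iff scaleR_left_distrib)
  also have "simple_bochner_integral M (indicator A :: _ \<Rightarrow> real) = measure M A"
    using has_bochner_integral_integral_eq[OF has_bochner_integral_simple_bochner_integrable[OF sb1]]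
      sets.sets_into_space[OF A(1)] by (simp add: Int_absorb2)
  finally show ?thesis .
qed

section \<open>Averages over a set of finite measure\<close>

lemma Lp_bochner_integrable_on:
  assumes p: "1 \<le> p" and f: "f \<in> Lp_functions p M" and A: "A \<in> sets M" "emeasure M A < \<infinity>"
  shows "bochner_integrable M (\<lambda>x. indicator A x *\<^sub>R f x)"
  unfolding bochner_integrable_iff
proof
  have sm: "strongly_measurable M f" and int: "integrable M (\<lambda>x. norm (f x) powr p)"
    using f by (auto simp: Lp_functions_def)
  show sm': "strongly_measurable M (\<lambda>x. indicator A x *\<^sub>R f x)"
    by (rule strongly_measurable_indicator[OF sm A(1)])
  show "integrable M (\<lambda>x. norm (indicator A x *\<^sub>R f x))"
  proof (rule Bochner_Integration.integrable_bound)
    show "integrable M (\<lambda>x. indicator A x + norm (f x) powr p)"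
      using int A by (intro Bochner_Integration.integrable_add) (auto simp: less_top)
    show "(\<lambda>x. norm (indicator A x *\<^sub>R f x)) \<in> borel_measurable M" by (rule strongly_measurable_norm[OF sm'])
    have "norm (f x) \<le> 1 + norm (f x) powr p" for x
    proof (cases "norm (f x) \<le> 1")
      case False
      then have "norm (f x) powr 1 \<le> norm (f x) powr p" using p by (intro powr_mono) auto
      then show ?thesis using False by simp
    qed (simp add: add_increasing2)
    then show "AE x in M. norm (norm (indicator A x *\<^sub>R f x)) \<le> norm (indicator A x + norm (f x) powr p)"
      by (intro AE_I2) (simp add: indicator_def)
  qed
qed

definition average :: "'w measure \<Rightarrow> 'w set \<Rightarrow> ('w \<Rightarrow> 'x::banach) \<Rightarrow> 'x" where
  "average M A f = inverse (measure M A) *\<^sub>R bochner_int M (\<lambda>x. indicator A x *\<^sub>R f x)"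

context
  fixes p :: real and M :: "'w measure" and A :: "'w set"
  assumes p: "1 \<le> p" and A: "A \<in> sets M" "0 < emeasure M A" "emeasure M A < \<infinity>"
begin

lemma average_measure_pos: "0 < measure M A"
  using A(2,3) by (simp add: measure_def enn2real_positive_iff)

lemma average_add:
  fixes f :: "'w \<Rightarrow> 'x::banach"
  assumes "f \<in> Lp_functions p M" "g \<in> Lp_functions p M"
  shows "average M A (\<lambda>x. f x + g x) = average M A f + average M A g"
  unfolding average_def
  by (simp add: scaleR_add_right bochner_int_add[OF Lp_bochner_integrable_on[OF p assms(1) A(1,3)]
    Lp_bochner_integrable_on[OF p assms(2) A(1,3)]])

lemma average_bounded_linear:
  fixes f :: "'w \<Rightarrow> 'x::banach" and h :: "'x \<Rightarrow> 'x"
  assumes h: "bounded_linear h" and f: "f \<in> Lp_functions p M"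
  shows "average M A (\<lambda>x. h (f x)) = h (average M A f)"
proof -
  interpret bounded_linear h by (rule h)
  show ?thesis unfolding average_def
    using bochner_int_bounded_linear(2)[OF h Lp_bochner_integrable_on[OF p f A(1,3)]] by (simp add: scaleR)
qed

lemma average_const:
  fixes f :: "'w \<Rightarrow> 'x::banach"
  assumes "\<And>x. x \<in> A \<Longrightarrow> f x = y"
  shows "average M A f = y"
proof -
  have "(\<lambda>x. indicator A x *\<^sub>R f x) = (\<lambda>x. indicator A x *\<^sub>R y)"
    using assms by (auto simp: fun_eq_iff split: split_indicator)
  then show ?thesis using bochner_int_indicator[OF A(1,3), of y] average_measure_pos by (simp add: average_def)
qed

text \<open>The tangent of the p-th power at the mean \<open>m\<close> of the norm of \<open>f\<close> over \<open>A\<close>, integrated over \<open>A\<close>.\<close>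

lemma average_Jensen:
  fixes f :: "'w \<Rightarrow> 'x::banach"
  assumes f: "f \<in> Lp_functions p M"
  shows "measure M A * norm (average M A f) powr p \<le> (\<integral>x. indicator A x * norm (f x) powr p \<partial>M)"
proof -
  define \<mu> where "\<mu> = measure M A"
  have \<mu>: "0 < \<mu>" using average_measure_pos by (simp add: \<mu>_def)
  define g where "g x = indicator A x * norm (f x)" for x
  have bi: "bochner_integrable M (\<lambda>x. indicator A x *\<^sub>R f x)" by (rule Lp_bochner_integrable_on[OF p f A(1,3)])
  have g: "integrable M g" using bochner_integrable_norm[OF bi] by (simp add: g_def[abs_def])
  define m where "m = (\<integral>x. g x \<partial>M) / \<mu>"
  have le_m: "norm (average M A f) \<le> m"
    using norm_bochner_int_le[OF bi] \<mu> by (simp add: average_def m_def g_def \<mu>_def divide_simps)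
  then have m0: "0 \<le> m" using norm_ge_zero order_trans by blast
  have int: "integrable M (\<lambda>x. norm (f x) powr p)" using f by (simp add: Lp_functions_def)
  have intA: "integrable M (\<lambda>x. indicator A x * norm (f x) powr p)"
    using integrable_mult_indicator[OF A(1) int] by simp
  have "\<mu> * m powr p \<le> (\<integral>x. indicator A x * norm (f x) powr p \<partial>M)"
  proof (cases "m = 0")
    case False
    then have m: "0 < m" using m0 by simp
    let ?d = "p * m powr (p - 1)"
    have iA: "integrable M (indicator A :: 'w \<Rightarrow> real)" "(\<integral>x. indicator A x \<partial>M) = \<mu>"
      using A sets.sets_into_space[OF A(1)] by (auto simp: \<mu>_def Int_absorb2 less_top)
    have "\<mu> * m powr p = (m powr p - ?d * m) * \<mu> + ?d * (\<integral>x. g x \<partial>M)"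
      using \<mu> by (simp add: m_def algebra_simps)
    also have "\<dots> = (\<integral>x. (m powr p - ?d * m) * indicator A x + ?d * g x \<partial>M)"
      using iA g by simp
    also have "\<dots> \<le> (\<integral>x. indicator A x * norm (f x) powr p \<partial>M)"
    proof (rule integral_mono)
      show "integrable M (\<lambda>x. (m powr p - ?d * m) * indicator A x + ?d * g x)" using iA(1) g by simp
      show "(m powr p - ?d * m) * indicator A x + ?d * g x \<le> indicator A x * norm (f x) powr p" for x
        using powr_tangent[OF p _ m, of "norm (f x)"] by (simp add: g_def indicator_def algebra_simps)
    qed (rule intA)
    finally show ?thesis .
  qed simp
  moreover have "\<mu> * norm (average M A f) powr p \<le> \<mu> * m powr p"
    using \<mu> le_m p by (intro mult_left_mono powr_mono2) auto
  ultimately show ?thesis by (simp add: \<mu>_def)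
qed

lemma average_cong_AE:
  fixes f :: "'w \<Rightarrow> 'x::banach"
  assumes f: "f \<in> Lp_functions p M" and g: "g \<in> Lp_functions p M" and fg: "AE x in M. f x = g x"
  shows "average M A f = average M A g"
proof -
  have d: "(\<lambda>x. f x - g x) \<in> Lp_functions p M" by (rule Lp_functions_diff[OF f g p])
  have "(\<integral>x. indicator A x * norm (f x - g x) powr p \<partial>M) = (\<integral>x. 0 \<partial>M)"
  proof (rule integral_cong_AE)
    show "AE x in M. indicator A x * norm (f x - g x) powr p = 0"
      using fg by eventually_elim (use p in simp)
    have [measurable]: "(\<lambda>x. norm (f x - g x)) \<in> borel_measurable M"
      using d by (auto simp: Lp_functions_def intro: strongly_measurable_norm)
    show "(\<lambda>x. indicator A x * norm (f x - g x) powr p) \<in> borel_measurable M"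
      using A(1) by measurable
  qed simp
  then have "norm (average M A (\<lambda>x. f x - g x)) powr p \<le> 0"
    using average_Jensen[OF d] average_measure_pos by (simp add: mult_le_0_iff)
  then have "average M A (\<lambda>x. f x - g x) = 0" by simp
  moreover have "average M A f = average M A g + average M A (\<lambda>x. f x - g x)"
    using average_add[OF g d] by simp
  ultimately show ?thesis by simp
qed

end

section \<open>Step functions\<close>

text \<open>Null sets are excluded, since averages over the cells are taken.\<close>

definition cells :: "'w measure \<Rightarrow> nat \<Rightarrow> (nat \<Rightarrow> 'w set) \<Rightarrow> bool" where
  "cells M m A \<longleftrightarrow> disjoint_family_on A {..<m} \<and>
    (\<forall>j<m. A j \<in> sets M \<and> 0 < emeasure M (A j) \<and> emeasure M (A j) < \<infinity>)"

definition step :: "nat \<Rightarrow> (nat \<Rightarrow> 'w set) \<Rightarrow> (nat \<Rightarrow> 'x::real_vector) \<Rightarrow> 'w \<Rightarrow> 'x" where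
  "step m A y w = (\<Sum>j<m. indicator (A j) w *\<^sub>R y j)"

lemma cellsD:
  assumes "cells M m A" "j < m"
  shows "A j \<in> sets M" "0 < emeasure M (A j)" "emeasure M (A j) < \<infinity>" "0 < measure M (A j)"
proof -
  show *: "A j \<in> sets M" "0 < emeasure M (A j)" "emeasure M (A j) < \<infinity>" using assms by (auto simp: cells_def)
  show "0 < measure M (A j)" by (rule average_measure_pos[of 1 A for A, OF _ *]) simp
qed

lemma cells_unique: "cells M m A \<Longrightarrow> i < m \<Longrightarrow> j < m \<Longrightarrow> x \<in> A i \<Longrightarrow> x \<in> A j \<Longrightarrow> i = j"
  unfolding cells_def disjoint_family_on_def by blast

lemma norm_sum_single_powr:
  fixes h :: "nat \<Rightarrow> 'x::real_normed_vector"
  assumes "\<And>i j. i < n \<Longrightarrow> j < n \<Longrightarrow> h i \<noteq> 0 \<Longrightarrow> h j \<noteq> 0 \<Longrightarrow> i = j"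
  shows "norm (\<Sum>j<n. h j) powr p = (\<Sum>j<n. norm (h j) powr p)"
proof (cases "\<exists>i<n. h i \<noteq> 0")
  case True
  then obtain i where i: "i < n" "h i \<noteq> 0" by blast
  have z: "h j = 0" if "j < n" "j \<noteq> i" for j using assms i that by blast
  have "(\<Sum>j<n. h j) = (\<Sum>j\<in>{i}. h j)" by (rule sum.mono_neutral_right) (use i z in auto)
  moreover have "(\<Sum>j<n. norm (h j) powr p) = (\<Sum>j\<in>{i}. norm (h j) powr p)"
    by (rule sum.mono_neutral_right) (use i z in auto)
  ultimately show ?thesis by simp
qed simp

lemma step_eq:
  assumes "cells M m A" "j < m" "x \<in> A j"
  shows "step m A y x = y j"
proof -
  have "step m A y x = (\<Sum>i\<in>{j}. indicator (A i) x *\<^sub>R y i)"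
    unfolding step_def
    by (rule sum.mono_neutral_right) (use assms cells_unique[OF assms(1)] in \<open>auto simp: indicator_def\<close>)
  then show ?thesis using assms(3) by simp
qed

lemma step_add: "step m A (\<lambda>j. y j + z j) x = step m A y x + step m A z x"
  by (simp add: step_def scaleR_add_right sum.distrib)

lemma step_diff: "step m A (\<lambda>j. y j - z j) x = step m A y x - step m A z x"
  by (simp add: step_def scaleR_diff_right sum_subtractf)

lemma step_linear: "linear h \<Longrightarrow> step m A (\<lambda>j. h (y j)) x = h (step m A y x)"
  by (simp add: step_def linear_sum linear_scale)

lemma Lp_functions_zero: "(\<lambda>x. 0) \<in> Lp_functions p M"
  by (simp add: Lp_functions_def strongly_measurable_simple)

lemma Lp_functions_indicator:
  assumes A: "A \<in> sets M" "emeasure M A < \<infinity>" and p: "1 \<le> p"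
  shows "(\<lambda>x. indicator A x *\<^sub>R y) \<in> Lp_functions p M"
  by (rule Lp_functions_simple[OF simple_bochner_integrable_indicator[OF A] p])

lemma Lp_functions_sum:
  fixes f :: "nat \<Rightarrow> 'w \<Rightarrow> 'x::real_normed_vector"
  assumes "\<And>j. j < n \<Longrightarrow> f j \<in> Lp_functions p M" "1 \<le> p"
  shows "(\<lambda>x. \<Sum>j<n. f j x) \<in> Lp_functions p M"
  using assms(1) by (induction n) (simp_all add: Lp_functions_zero Lp_functions_add assms(2))

lemma step_Lp:
  assumes "cells M m A" "1 \<le> p"
  shows "step m A y \<in> Lp_functions p M"
  unfolding step_def[abs_def]
  by (intro Lp_functions_sum Lp_functions_indicator assms(2) cellsD[OF assms(1)])

lemma p_mass_step:
  assumes A: "cells M m A"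
  shows "p_mass p M (step m A y) = (\<Sum>j<m. measure M (A j) * norm (y j) powr p)"
proof -
  have "norm (step m A y x) powr p = (\<Sum>j<m. norm (y j) powr p * indicator (A j) x)" for x
  proof -
    have "norm (step m A y x) powr p = (\<Sum>j<m. norm (indicat_real (A j) x *\<^sub>R y j) powr p)"
      unfolding step_def
      by (rule norm_sum_single_powr) (use cells_unique[OF A] in \<open>auto simp: indicator_def split: if_splits\<close>)
    also have "\<dots> = (\<Sum>j<m. norm (y j) powr p * indicator (A j) x)"
      by (rule sum.cong) (auto simp: indicator_def)
    finally show ?thesis .
  qed
  then have "p_mass p M (step m A y) = (\<integral>x. (\<Sum>j<m. norm (y j) powr p * indicator (A j) x) \<partial>M)"
    by (simp add: p_mass_def)
  also have "\<dots> = (\<Sum>j<m. \<integral>x. norm (y j) powr p * indicator (A j) x \<partial>M)"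
    by (rule Bochner_Integration.integral_sum) (use cellsD[OF A] in \<open>auto simp: less_top\<close>)
  also have "\<dots> = (\<Sum>j<m. measure M (A j) * norm (y j) powr p)"
    using sets.sets_into_space[OF cellsD(1)[OF A]] by (intro sum.cong) (auto simp: Int_absorb2)
  finally show ?thesis .
qed

text \<open>Finitely many simple functions form one simple function with values in lists. Its level sets of
positive finite measure are the cells: level sets of infinite measure only carry the value zero, and
the finitely many null level sets are negligible.\<close>

lemma common_cells:
  fixes S :: "('w \<Rightarrow> 'x::real_normed_vector) set"
  assumes S: "finite S" "\<And>s. s \<in> S \<Longrightarrow> simple_bochner_integrable M s"
  shows "\<exists>m A. cells M m A \<and> (\<forall>s\<in>S. \<exists>y. AE x in M. s x = step m A y x)"
proof -
  obtain xs where xs: "set xs = S" using finite_list[OF S(1)] by blast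
  define G where "G x = map (\<lambda>s. s x) xs" for x
  have sf: "simple_function M s" if "s \<in> S" for s using S(2)[OF that] by (simp add: simple_bochner_integrable.simps)
  have "simple_function M (\<lambda>x. map (\<lambda>s. s x) ys)" if "set ys \<subseteq> S" for ys
    using that
  proof (induction ys)
    case (Cons s ys)
    then have "simple_function M (\<lambda>x. s x # map (\<lambda>s. s x) ys)"
      by (intro simple_function_compose2[where h = "(#)"] sf) auto
    then show ?case by simp
  qed simp
  then have G: "simple_function M G" using xs by (simp add: G_def[abs_def])
  define lev where "lev c = G -` {c} \<inter> space M" for c
  have lev: "lev c \<in> sets M" for c unfolding lev_def by (rule simple_functionD[OF G])
  have finG: "finite (G ` space M)" by (rule simple_functionD[OF G])
  define C where "C = {c \<in> G ` space M. 0 < emeasure M (lev c) \<and> emeasure M (lev c) < \<infinity>}"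
  have "finite C" using finG by (simp add: C_def)
  then obtain h where h: "bij_betw h {0..<card C} C" using ex_bij_betw_nat_finite by blast
  define m where "m = card C"
  define A where "A j = lev (h j)" for j
  have hC: "h j \<in> C" if "j < m" for j using bij_betwE[OF h] that by (auto simp: m_def)
  have cells: "cells M m A"
    unfolding cells_def
  proof (intro conjI allI impI)
    have "inj_on h {..<m}" using bij_betw_imp_inj_on[OF h] by (simp add: m_def atLeast0LessThan)
    then show "disjoint_family_on A {..<m}"
      by (auto simp: disjoint_family_on_def A_def lev_def inj_on_def)
    fix j assume "j < m"
    from hC[OF this] show "A j \<in> sets M" "0 < emeasure M (A j)" "emeasure M (A j) < \<infinity>"
      by (auto simp: A_def lev C_def)
  qed
  define N where "N = (\<Union>c\<in>{c \<in> G ` space M. emeasure M (lev c) = 0}. lev c)"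
  have "N \<in> null_sets M"
    unfolding N_def using finG lev by (intro null_sets_UN' countable_finite) (auto simp: null_sets_def)
  then have AE: "AE x in M. x \<notin> N" by (rule AE_not_in)
  have "\<exists>y. AE x in M. s x = step m A y x" if s: "s \<in> S" for s
  proof -
    obtain i where i: "i < length xs" "s = xs ! i" using s xs by (metis in_set_conv_nth)
    have Gi: "G x ! i = s x" for x using i by (simp add: G_def)
    have eq: "s x = step m A (\<lambda>j. h j ! i) x" if x: "x \<in> space M" "x \<notin> N" for x
    proof (cases "emeasure M (lev (G x)) < \<infinity>")
      case True
      have "emeasure M (lev (G x)) \<noteq> 0" using x by (auto simp: N_def lev_def)
      then have "G x \<in> C" using True x by (auto simp: C_def zero_less_iff_neq_zero)
      then obtain j where j: "j < m" "h j = G x"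
        using h unfolding bij_betw_def m_def by (metis atLeastLessThan_iff imageE)
      then have "x \<in> A j" using x by (simp add: A_def lev_def)
      from step_eq[OF cells j(1) this, of "\<lambda>j. h j ! i"] show ?thesis using j(2) Gi by simp
    next
      case False
      have "s x = 0"
      proof (rule ccontr)
        assume "s x \<noteq> 0"
        have "lev (G x) \<subseteq> {z \<in> space M. s z \<noteq> 0}"
        proof
          fix z assume "z \<in> lev (G x)"
          then have "G z = G x" "z \<in> space M" by (simp_all add: lev_def)
          then show "z \<in> {z \<in> space M. s z \<noteq> 0}" using Gi[of z] Gi[of x] \<open>s x \<noteq> 0\<close> by simp
        qed
        moreover have "{z \<in> space M. s z \<noteq> 0} \<in> sets M"
          using simple_functionD(2)[OF sf[OF s], of "- {0}"] by (simp add: vimage_def Int_def conj_commute)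
        ultimately have "emeasure M (lev (G x)) \<le> emeasure M {z \<in> space M. s z \<noteq> 0}" by (rule emeasure_mono)
        then show False using S(2)[OF s] False by (auto simp: simple_bochner_integrable.simps top_unique less_top)
      qed
      moreover have "x \<notin> A j" if "j < m" for j
        using hC[OF that] False by (auto simp: A_def lev_def C_def)
      then have "step m A (\<lambda>j. h j ! i) x = 0" by (simp add: step_def)
      ultimately show ?thesis by simp
    qed
    have "AE x in M. s x = step m A (\<lambda>j. h j ! i) x" using AE AE_space by eventually_elim (rule eq)
    then show ?thesis by blast
  qed
  then show ?thesis using cells by blast
qed

section \<open>Moving averages from one family of cells to another\<close>

text \<open>The normalising factor makes this an operator of norm at most the norm of \<open>T\<close>: a constant on a
cell \<open>A j\<close> and its image on \<open>B j\<close> have the same p-norm, up to the action of \<open>T\<close>.\<close>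

definition transport :: "real \<Rightarrow> 'w measure \<Rightarrow> ('x \<Rightarrow> 'x) \<Rightarrow> nat \<Rightarrow> (nat \<Rightarrow> 'w set) \<Rightarrow> (nat \<Rightarrow> 'w set) \<Rightarrow>
    ('w \<Rightarrow> 'x::banach) \<Rightarrow> 'w \<Rightarrow> 'x" where
  "transport p M T m A B f =
    step m B (\<lambda>j. (measure M (A j) / measure M (B j)) powr (1 / p) *\<^sub>R T (average M (A j) f))"

context
  fixes p L :: real and M :: "'w measure" and T :: "'x::banach \<Rightarrow> 'x" and m :: nat and A B :: "nat \<Rightarrow> 'w set"
  assumes p: "1 \<le> p" and A: "cells M m A" and B: "cells M m B"
    and T: "linear T" "\<And>x. norm (T x) \<le> L * norm x" and L: "0 \<le> L"
begin

lemma transport_Lp: "transport p M T m A B f \<in> Lp_functions p M"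
  unfolding transport_def by (rule step_Lp[OF B p])

lemma transport_cong_AE:
  assumes "f \<in> Lp_functions p M" "g \<in> Lp_functions p M" "AE x in M. f x = g x"
  shows "transport p M T m A B f = transport p M T m A B g"
  unfolding transport_def step_def
  using average_cong_AE[OF p cellsD(1,2,3)[OF A] assms] by (simp add: fun_eq_iff)

lemma transport_add:
  assumes "f \<in> Lp_functions p M" "g \<in> Lp_functions p M"
  shows "transport p M T m A B (\<lambda>x. f x + g x) x = transport p M T m A B f x + transport p M T m A B g x"
proof -
  have "average M (A j) (\<lambda>x. f x + g x) = average M (A j) f + average M (A j) g" if "j < m" for j
    by (rule average_add[OF p cellsD(1,2,3)[OF A that] assms])
  then show ?thesis
    unfolding transport_def step_add[symmetric] unfolding step_def
    by (intro sum.cong) (simp_all add: linear_add[OF T(1)] scaleR_add_right)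
qed

lemma transport_commute:
  assumes h: "bounded_linear h" "\<And>x. T (h x) = h (T x)" and f: "f \<in> Lp_functions p M"
  shows "transport p M T m A B (\<lambda>x. h (f x)) x = h (transport p M T m A B f x)"
proof -
  interpret bounded_linear h by (rule h)
  have "average M (A j) (\<lambda>x. h (f x)) = h (average M (A j) f)" if "j < m" for j
    by (rule average_bounded_linear[OF p cellsD(1,2,3)[OF A that] h(1) f])
  then show ?thesis
    unfolding transport_def step_linear[OF linear_axioms, symmetric] unfolding step_def
    by (intro sum.cong) (simp_all add: h(2) scaleR)
qed

text \<open>The bound uses the values of \<open>f\<close> on the cells only. This is what makes the operators that read
from different blocks of cells add up without loss.\<close>

lemma p_mass_transport_le:
  assumes f: "f \<in> Lp_functions p M"
  shows "p_mass p M (transport p M T m A B f) \<le> L powr p * (\<Sum>j<m. \<integral>x. indicator (A j) x * norm (f x) powr p \<partial>M)"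
proof -
  have "p_mass p M (transport p M T m A B f) =
    (\<Sum>j<m. measure M (B j) * norm ((measure M (A j) / measure M (B j)) powr (1 / p) *\<^sub>R T (average M (A j) f)) powr p)"
    unfolding transport_def by (rule p_mass_step[OF B])
  also have "\<dots> = (\<Sum>j<m. measure M (A j) * norm (T (average M (A j) f)) powr p)"
  proof (rule sum.cong[OF refl])
    fix j assume "j \<in> {..<m}"
    then have "0 < measure M (A j)" "0 < measure M (B j)" using cellsD(4)[OF A] cellsD(4)[OF B] by auto
    then show "measure M (B j) * norm ((measure M (A j) / measure M (B j)) powr (1 / p) *\<^sub>R T (average M (A j) f)) powr p
      = measure M (A j) * norm (T (average M (A j) f)) powr p"
      using p by (simp add: powr_mult powr_powr)
  qed
  also have "\<dots> \<le> (\<Sum>j<m. L powr p * (\<integral>x. indicator (A j) x * norm (f x) powr p \<partial>M))"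
  proof (rule sum_mono)
    fix j assume "j \<in> {..<m}"
    then have j: "j < m" by simp
    have "norm (T (average M (A j) f)) powr p \<le> (L * norm (average M (A j) f)) powr p"
      using p T(2) by (intro powr_mono2) auto
    then have "measure M (A j) * norm (T (average M (A j) f)) powr p \<le>
        L powr p * (measure M (A j) * norm (average M (A j) f) powr p)"
      using mult_left_mono[of "norm (T (average M (A j) f)) powr p" "(L * norm (average M (A j) f)) powr p" "measure M (A j)"]
      by (simp add: powr_mult mult_ac)
    also have "\<dots> \<le> L powr p * (\<integral>x. indicator (A j) x * norm (f x) powr p \<partial>M)"
      by (intro mult_left_mono average_Jensen[OF p cellsD(1,2,3)[OF A j] f]) auto
    finally show "measure M (A j) * norm (T (average M (A j) f)) powr p \<le>
        L powr p * (\<integral>x. indicator (A j) x * norm (f x) powr p \<partial>M)" .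
  qed
  finally show ?thesis by (simp add: sum_distrib_left)
qed

lemma sum_integral_cells_le:
  assumes f: "f \<in> Lp_functions p M" and C: "cells M n C"
  shows "(\<Sum>j<n. \<integral>x. indicator (C j) x * norm (f x) powr p \<partial>M) \<le> p_mass p M (f :: 'w \<Rightarrow> 'x)"
proof -
  have int: "integrable M (\<lambda>x. norm (f x) powr p)" using f by (simp add: Lp_functions_def)
  have intC: "integrable M (\<lambda>x. indicator (C j) x * norm (f x) powr p)" if "j < n" for j
    using integrable_mult_indicator[OF cellsD(1)[OF C that] int] by simp
  have le1: "(\<Sum>j<n. indicat_real (C j) x) \<le> 1" for x
  proof (cases "\<exists>j<n. x \<in> C j")
    case True
    then obtain j where "j < n" "x \<in> C j" by blast
    then show ?thesis using step_eq[OF C, of j x "\<lambda>j. 1 :: real"] by (simp add: step_def)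
  next
    case False
    then have "(\<Sum>j<n. indicat_real (C j) x) = 0" by (intro sum.neutral) auto
    then show ?thesis by simp
  qed
  have "(\<Sum>j<n. \<integral>x. indicator (C j) x * norm (f x) powr p \<partial>M) = (\<integral>x. (\<Sum>j<n. indicator (C j) x * norm (f x) powr p) \<partial>M)"
    by (rule Bochner_Integration.integral_sum[symmetric]) (use intC in auto)
  also have "\<dots> \<le> p_mass p M f"
    unfolding p_mass_def
  proof (rule integral_mono)
    show "(\<Sum>j<n. indicator (C j) x * norm (f x) powr p) \<le> norm (f x) powr p" for x
      using mult_right_mono[OF le1[of x], of "norm (f x) powr p"] by (simp add: sum_distrib_right)
    show "integrable M (\<lambda>x. \<Sum>j<n. indicator (C j) x * norm (f x) powr p)"
      by (rule Bochner_Integration.integrable_sum) (use intC in simp)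
  qed (rule int)
  finally show ?thesis .
qed

lemma Lp_norm_transport_le:
  assumes f: "f \<in> Lp_functions p M"
  shows "Lp_norm p M (transport p M T m A B f) \<le> L * Lp_norm p M f"
proof -
  have "p_mass p M (transport p M T m A B f) \<le> L powr p * p_mass p M f"
    using p_mass_transport_le[OF f] sum_integral_cells_le[OF f A]
    by (meson mult_left_mono order_trans powr_ge_zero)
  then show ?thesis
    using L by (simp add: Lp_norm_le_iff[OF p] Lp_norm_nonneg powr_mult Lp_norm_powr[OF p])
qed

text \<open>The two normalising factors cancel.\<close>

lemma transport_back:
  "transport p M T m B A (transport p M T m A B f) = step m A (\<lambda>j. T (T (average M (A j) f)))"
proof
  fix x
  have "(measure M (B j) / measure M (A j)) powr (1 / p) *\<^sub>R T (average M (B j) (transport p M T m A B f))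
      = T (T (average M (A j) f))" if j: "j < m" for j
  proof -
    let ?c = "(measure M (A j) / measure M (B j)) powr (1 / p)"
    have pos: "0 < measure M (A j)" "0 < measure M (B j)" using cellsD(4)[OF A j] cellsD(4)[OF B j] by auto
    have "average M (B j) (transport p M T m A B f) = ?c *\<^sub>R T (average M (A j) f)"
      by (rule average_const[OF p cellsD(1,2,3)[OF B j]]) (simp add: transport_def step_eq[OF B j])
    moreover have "(measure M (B j) / measure M (A j)) powr (1 / p) * ?c = 1"
      using pos by (simp add: powr_mult[symmetric])
    ultimately show ?thesis by (simp add: linear_scale[OF T(1)])
  qed
  then show "transport p M T m B A (transport p M T m A B f) x = step m A (\<lambda>j. T (T (average M (A j) f))) x"
    unfolding transport_def[of p M T m B A] step_def[of m A] by (intro sum.cong) simp_all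
qed

end

section \<open>The Lebesgue-Bochner space\<close>

context banach_space_over
begin

lemma bounded_linear_smul: "bounded_linear (smul c)"
proof (rule bounded_linear_intro[where K = "norm c"])
  show "smul c (r *\<^sub>R x) = r *\<^sub>R smul c x" for r x
    by (metis mult.commute scale_of_real scale_scale)
qed (simp_all add: scale_right_distrib norm_scale mult.commute)

abbreviation X where "X \<equiv> type_space smul"

lemma normed_space_type_space: "normed_space_on X"
  by standard (auto simp: type_space_def scale_right_distrib scale_left_distrib norm_scale norm_triangle_ineq)

end

locale Lp_setting = banach_space_over smul
  for smul :: "'k::real_or_complex \<Rightarrow> 'x::banach \<Rightarrow> 'x" +
  fixes p :: real and M :: "'w measure"
  assumes p: "1 \<le> p"
begin

abbreviation Lp where "Lp \<equiv> Lp_space p M smul"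
abbreviation cls :: "('w \<Rightarrow> 'x) \<Rightarrow> ('w \<Rightarrow> 'x) set" where "cls f \<equiv> Lp_rel p M `` {f}"
abbreviation fns :: "('w \<Rightarrow> 'x) set" where "fns \<equiv> Lp_functions p M"

lemma cls_closed: "f \<in> fns \<Longrightarrow> cls f \<in> ns_carrier Lp"
  by (simp add: Lp_space_def quotientI)

lemma cls_cases: "U \<in> ns_carrier Lp \<Longrightarrow> (\<And>f. f \<in> fns \<Longrightarrow> U = cls f \<Longrightarrow> P) \<Longrightarrow> P"
  by (auto simp: Lp_space_def elim: quotientE)

lemma cls_eqI: "f \<in> fns \<Longrightarrow> g \<in> fns \<Longrightarrow> AE x in M. f x = g x \<Longrightarrow> cls f = cls g"
  by (intro equiv_class_eq[OF equiv_Lp_rel]) (simp add: Lp_rel_def)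

lemma cls_eqD: "f \<in> fns \<Longrightarrow> g \<in> fns \<Longrightarrow> cls f = cls g \<Longrightarrow> AE x in M. f x = g x"
  using eq_equiv_class[OF _ equiv_Lp_rel, of p M f g] by (simp add: Lp_rel_def)

lemmas cls_add = Lp_space_add_class[OF p, where M = M and smul = smul]
lemmas cls_scale = Lp_space_scale_class[where M = M and p = p]
lemmas cls_norm = Lp_space_norm_class[where M = M and p = p and smul = smul]
lemmas fns_add = Lp_functions_add[OF _ _ p, where M = M]
lemmas fns_scale = Lp_functions_scale[where M = M and p = p]

lemma cls_zero: "ns_zero Lp = cls (\<lambda>x. 0)"
  by (simp add: Lp_space_def)

lemma cls_diff: "f \<in> fns \<Longrightarrow> g \<in> fns \<Longrightarrow> ns_diff Lp (cls f) (cls g) = cls (\<lambda>x. f x - g x)"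
  using fns_scale[of g "- 1"] by (simp add: ns_diff_def cls_scale cls_add)

lemma Lp_norm_scale: "Lp_norm p M (\<lambda>x. smul c (f x)) = norm c * Lp_norm p M f"
  using p by (simp add: Lp_norm_def norm_scale powr_mult powr_powr)

lemma Lp_norm_eq_0: "f \<in> fns \<Longrightarrow> Lp_norm p M f = 0 \<Longrightarrow> AE x in M. f x = 0"
proof -
  assume f: "f \<in> fns" and 0: "Lp_norm p M f = 0"
  have int: "integrable M (\<lambda>x. norm (f x) powr p)" using f by (simp add: Lp_functions_def)
  have "(\<integral>x. norm (f x) powr p \<partial>M) = 0" using 0 by (simp add: Lp_norm_def)
  then have "AE x in M. norm (f x) powr p = 0"
    by (subst (asm) integral_nonneg_eq_0_iff_AE[OF int]) auto
  then show ?thesis by eventually_elim simp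
qed

lemma normed_space_Lp: "normed_space_on Lp"
proof
  note [simp] = cls_add cls_scale cls_norm fns_add fns_scale Lp_functions_zero cls_zero cls_closed
  show "ns_zero Lp \<in> ns_carrier Lp" by simp
  fix U W Z c d
  assume "U \<in> ns_carrier Lp"
  then obtain f where f: "f \<in> fns" "U = cls f" by (rule cls_cases)
  show "ns_scale Lp c U \<in> ns_carrier Lp" using f by simp
  show "ns_add Lp U (ns_zero Lp) = U" using f by simp
  show "ns_scale Lp (c + d) U = ns_add Lp (ns_scale Lp c U) (ns_scale Lp d U)"
    using f by (simp add: scale_left_distrib)
  show "ns_scale Lp c (ns_scale Lp d U) = ns_scale Lp (c * d) U" "ns_scale Lp 1 U = U" "ns_scale Lp 0 U = ns_zero Lp"
    using f by simp_all
  show "ns_norm Lp (ns_scale Lp c U) = norm c * ns_norm Lp U" using f by (simp add: Lp_norm_scale)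
  show "U = ns_zero Lp" if "ns_norm Lp U = 0"
  proof -
    have "Lp_norm p M f = 0" using f that by simp
    then have "cls f = cls (\<lambda>x. 0)" by (intro cls_eqI f(1) Lp_functions_zero Lp_norm_eq_0)
    then show ?thesis using f(2) by simp
  qed
  assume "W \<in> ns_carrier Lp"
  then obtain g where g: "g \<in> fns" "W = cls g" by (rule cls_cases)
  show "ns_add Lp U W \<in> ns_carrier Lp" using f g by simp
  show "ns_add Lp U W = ns_add Lp W U" using f g by (simp add: add.commute)
  show "ns_scale Lp c (ns_add Lp U W) = ns_add Lp (ns_scale Lp c U) (ns_scale Lp c W)"
    using f g by (simp add: scale_right_distrib)
  show "ns_norm Lp (ns_add Lp U W) \<le> ns_norm Lp U + ns_norm Lp W"
    using f g by (simp add: Lp_norm_triangle[OF p])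
  assume "Z \<in> ns_carrier Lp"
  then obtain h where h: "h \<in> fns" "Z = cls h" by (rule cls_cases)
  show "ns_add Lp (ns_add Lp U W) Z = ns_add Lp U (ns_add Lp W Z)" using f g h by (simp add: add.assoc)
qed

sublocale Lp: normed_space_on Lp by (rule normed_space_Lp)

lemma cls_sum: "(\<And>k. k < n \<Longrightarrow> g k \<in> fns) \<Longrightarrow> ns_sum Lp (\<lambda>k. cls (g k)) n = cls (\<lambda>x. \<Sum>k<n. g k x)"
  by (induction n) (simp_all add: cls_zero cls_add Lp_functions_sum[OF _ p])

text \<open>The operator on classes induced by an operator on functions; the choice of the representative is
immaterial for the operators that ignore null sets.\<close>

definition class_op :: "(('w \<Rightarrow> 'x) \<Rightarrow> 'w \<Rightarrow> 'x) \<Rightarrow> ('w \<Rightarrow> 'x) set \<Rightarrow> ('w \<Rightarrow> 'x) set" where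
  "class_op w = (\<lambda>U\<in>Lp.carr. cls (w (SOME f. f \<in> fns \<and> U = cls f)))"

lemma class_op_cls:
  assumes "\<And>f g. f \<in> fns \<Longrightarrow> g \<in> fns \<Longrightarrow> AE x in M. f x = g x \<Longrightarrow> w f = w g" and f: "f \<in> fns"
  shows "class_op w (cls f) = cls (w f)"
proof -
  define g where "g = (SOME g. g \<in> fns \<and> cls f = cls g)"
  have g: "g \<in> fns \<and> cls f = cls g" unfolding g_def by (rule someI[of _ f]) (use f in simp)
  then have "AE x in M. g x = f x" using f by (intro cls_eqD) simp_all
  then have "w g = w f" using assms(1) g f by blast
  then show ?thesis using cls_closed[OF f] by (simp add: class_op_def g_def)
qed

lemma class_op_bounded:
  assumes fns: "\<And>f. f \<in> fns \<Longrightarrow> w f \<in> fns"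
    and cong: "\<And>f g. f \<in> fns \<Longrightarrow> g \<in> fns \<Longrightarrow> AE x in M. f x = g x \<Longrightarrow> w f = w g"
    and add: "\<And>f g x. f \<in> fns \<Longrightarrow> g \<in> fns \<Longrightarrow> w (\<lambda>x. f x + g x) x = w f x + w g x"
    and scale: "\<And>f c x. f \<in> fns \<Longrightarrow> w (\<lambda>x. smul c (f x)) x = smul c (w f x)"
    and L: "0 \<le> L" "\<And>f. f \<in> fns \<Longrightarrow> Lp_norm p M (w f) \<le> L * Lp_norm p M f"
  shows "class_op w \<in> Lp.Bounded" "Lp.opn (class_op w) \<le> L"
proof -
  note w = class_op_cls[OF cong]
  have le: "Lp.nrm (class_op w U) \<le> L * Lp.nrm U" if U: "U \<in> Lp.carr" for U
  proof -
    obtain f where "f \<in> fns" "U = cls f" using U by (rule cls_cases)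
    then show ?thesis using L(2) by (simp add: w cls_norm fns)
  qed
  have "ns_linear Lp Lp (class_op w)"
    unfolding ns_linear_def
  proof (intro conjI ballI allI funcsetI)
    fix U W c assume "U \<in> Lp.carr"
    then obtain f where f: "f \<in> fns" "U = cls f" by (rule cls_cases)
    show "class_op w U \<in> Lp.carr" using f by (simp add: w fns cls_closed)
    have "w (\<lambda>x. smul c (f x)) = (\<lambda>x. smul c (w f x))" using scale f by blast
    then show "class_op w (ns_scale Lp c U) = ns_scale Lp c (class_op w U)"
      using f by (simp add: w fns cls_scale fns_scale)
    assume "W \<in> Lp.carr"
    then obtain g where g: "g \<in> fns" "W = cls g" by (rule cls_cases)
    have "w (\<lambda>x. f x + g x) = (\<lambda>x. w f x + w g x)" using add f g by blast
    then show "class_op w (ns_add Lp U W) = ns_add Lp (class_op w U) (class_op w W)"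
      using f g by (simp add: w fns cls_add fns_add)
  qed
  then show "class_op w \<in> Lp.Bounded"
    unfolding bounded_ops_iff using le by (auto simp: class_op_def)
  show "Lp.opn (class_op w) \<le> L" by (rule op_norm_le[OF L(1) le])
qed

text \<open>Step functions with values in a finite-dimensional space are spanned by the functions that are
constant on one cell and have a generator as value there.\<close>

lemma step_in_hull:
  assumes K: "finite K" and B: "cells M m B"
  shows "\<exists>K'. finite K' \<and> K' \<subseteq> Lp.carr \<and>
    (\<forall>z. (\<forall>j<m. z j \<in> ns_subspace X hull K) \<longrightarrow> cls (step m B z) \<in> ns_subspace Lp hull K')"
proof -
  define e where "e j z = cls (\<lambda>x. indicator (B j) x *\<^sub>R z)" for j z
  have ind: "(\<lambda>x. indicat_real (B j) x *\<^sub>R z) \<in> fns" if "j < m" for j z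
    by (rule Lp_functions_indicator[OF _ _ p]) (use cellsD[OF B that] in auto)
  define K' where "K' = (\<Union>j<m. e j ` K)"
  have K': "finite K'" "K' \<subseteq> Lp.carr"
    unfolding K'_def e_def using K by (auto intro: cls_closed ind)
  define H where "H = ns_subspace Lp hull K'"
  have "ns_subspace Lp H" unfolding H_def by (rule Lp.subspace_hull[OF K'(2)])
  note sub = this[unfolded ns_subspace_def]
  have e: "e j z \<in> H" if j: "j < m" and z: "z \<in> ns_subspace X hull K" for j z
  proof -
    have "ns_subspace X {z. e j z \<in> H}"
      unfolding ns_subspace_def
    proof (intro conjI ballI allI)
      show "ns_zero X \<in> {z. e j z \<in> H}"
        using sub by (simp add: type_space_def e_def cls_zero)
      fix x y c assume x: "x \<in> {z. e j z \<in> H}"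
      have "e j (smul c x) = ns_scale Lp c (e j x)"
        unfolding e_def cls_scale[OF ind[OF j]]
        using bounded_linear.linear[OF bounded_linear_smul, of c] by (simp add: linear_scale)
      then show "ns_scale X c x \<in> {z. e j z \<in> H}"
        using x sub by (simp add: type_space_def)
      assume y: "y \<in> {z. e j z \<in> H}"
      have "e j (x + y) = ns_add Lp (e j x) (e j y)"
        unfolding e_def cls_add[OF ind[OF j] ind[OF j]] by (simp add: scaleR_add_right)
      then show "ns_add X x y \<in> {z. e j z \<in> H}"
        using x y sub by (simp add: type_space_def)
    qed (simp add: type_space_def)
    moreover have "K \<subseteq> {z. e j z \<in> H}"
      using j unfolding H_def by (auto simp: K'_def intro!: hull_inc)
    ultimately have "ns_subspace X hull K \<subseteq> {z. e j z \<in> H}"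
      by (intro hull_minimal)
    then show ?thesis using z by auto
  qed
  have "cls (step m B z) \<in> H" if z: "\<forall>j<m. z j \<in> ns_subspace X hull K" for z
  proof -
    have "cls (step m B z) = ns_sum Lp (\<lambda>j. e j (z j)) m"
      unfolding e_def step_def[abs_def] by (rule cls_sum[symmetric]) (rule ind)
    moreover have "ns_sum Lp (\<lambda>j. e j (z j)) n \<in> H" if "n \<le> m" for n
      using that by (induction n) (use sub e z in \<open>auto simp: Suc_le_eq\<close>)
    ultimately show ?thesis by simp
  qed
  then show ?thesis unfolding H_def using K' by blast
qed

lemma finite_rank_type_space:
  assumes T: "T \<in> finite_rank_ops X X"
    and L: "op_norm X X T \<le> L"
  shows "linear T" "T (smul c x) = smul c (T x)" "norm (T x) \<le> L * norm x"
proof -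
  have T': "T \<in> bounded_ops X X" using T by (simp add: finite_rank_ops_def)
  have lin: "T (x + y) = T x + T y" "T (smul c x) = smul c (T x)" for x y c
    using bounded_ops_linear[OF T'] by (auto simp: ns_linear_def type_space_def)
  then show "T (smul c x) = smul c (T x)" by simp
  show "linear T" using lin lin(2)[of "of_real _"] by (intro linearI) (simp_all add: scale_of_real)
  have "norm (T x) \<le> op_norm X X T * norm x"
    using op_norm_bound[OF normed_space_type_space normed_space_type_space T', of x] by (simp add: type_space_def)
  also have "\<dots> \<le> L * norm x" using L by (intro mult_right_mono) auto
  finally show "norm (T x) \<le> L * norm x" .
qed

context
  fixes T L m A B
  assumes T: "T \<in> finite_rank_ops X X"
    and TL: "op_norm X X T \<le> L" and L: "0 \<le> L"
    and A: "cells M m A" and B: "cells M m B"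
begin

lemmas transport_rules = p A B finite_rank_type_space(1,3)[OF T TL] L

lemma transport_op_cls: "f \<in> fns \<Longrightarrow> class_op (transport p M T m A B) (cls f) = cls (transport p M T m A B f)"
  by (rule class_op_cls) (rule transport_cong_AE[OF transport_rules])

lemma transport_op_bounded:
  "class_op (transport p M T m A B) \<in> Lp.Bounded" "Lp.opn (class_op (transport p M T m A B)) \<le> L"
proof -
  let ?w = "transport p M T m A B"
  have cong: "?w f = ?w g" if "f \<in> fns" "g \<in> fns" "AE x in M. f x = g x" for f g
    using that by (rule transport_cong_AE[OF transport_rules])
  have add: "?w (\<lambda>x. f x + g x) x = ?w f x + ?w g x" if "f \<in> fns" "g \<in> fns" for f g x
    using that by (rule transport_add[OF transport_rules])
  have scale: "?w (\<lambda>x. smul c (f x)) x = smul c (?w f x)" if "f \<in> fns" for f c x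
    by (rule transport_commute[OF transport_rules, where h = "smul c", OF bounded_linear_smul finite_rank_type_space(2)[OF T TL] that])
  show "class_op ?w \<in> Lp.Bounded" "Lp.opn (class_op ?w) \<le> L"
    by (rule class_op_bounded[of ?w L, OF transport_Lp[OF transport_rules] cong add scale L Lp_norm_transport_le[OF transport_rules]];
      assumption)+
qed

lemma transport_op_finite_rank: "class_op (transport p M T m A B) \<in> Lp.Fin_rank"
proof -
  obtain K where K: "finite K" "range T \<subseteq> ns_subspace X hull K"
    using T by (auto simp: finite_rank_ops_def type_space_def)
  interpret Xs: normed_space_on X by (rule normed_space_type_space)
  have sub: "ns_subspace X (ns_subspace X hull K)"
    by (rule Xs.subspace_hull) (simp add: type_space_def)
  obtain K' where K': "finite K'" "K' \<subseteq> Lp.carr"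
    "\<And>z. (\<forall>j<m. z j \<in> ns_subspace X hull K) \<Longrightarrow> cls (step m B z) \<in> ns_subspace Lp hull K'"
    using step_in_hull[OF K(1) B] by blast
  have "class_op (transport p M T m A B) U \<in> ns_subspace Lp hull K'" if "U \<in> Lp.carr" for U
  proof -
    obtain f where f: "f \<in> fns" "U = cls f" using \<open>U \<in> Lp.carr\<close> by (rule cls_cases)
    have scale: "smul c z \<in> H" if "ns_subspace X H" "z \<in> H" for H c z
      using that by (simp add: ns_subspace_def type_space_def)
    have "r *\<^sub>R T x \<in> ns_subspace X hull K" for r x
      using scale[OF sub, of "T x" "of_real r"] K(2) by (auto simp: scale_of_real)
    then show ?thesis unfolding f(2) transport_op_cls[OF f(1)] transport_def by (intro K'(3)) auto
  qed
  then show ?thesis unfolding finite_rank_ops_def using transport_op_bounded(1) K'(1,2) by blast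
qed

end

end

section \<open>Weak amenability\<close>

lemma sum_blocks:
  fixes F :: "nat \<Rightarrow> real"
  shows "(\<Sum>k<n. \<Sum>j<m. F (k * m + j)) = (\<Sum>i<n * m. F i)"
proof (induction n)
  case (Suc n)
  have "(\<Sum>i<n * m + l. F i) = (\<Sum>i<n * m. F i) + (\<Sum>j<l. F (n * m + j))" for l
    by (induction l) simp_all
  from this[of m] Suc show ?case by (simp add: add.commute)
qed simp

lemma block_unique:
  fixes m :: nat
  assumes "r < m" "r' < m" "i * m + r = j * m + r'"
  shows "i = j \<and> r = r'"
proof -
  have "(i * m + r) div m = i" "(i * m + r) mod m = r" "(j * m + r') div m = j" "(j * m + r') mod m = r'"
    using assms(1,2) by simp_all
  then show ?thesis using assms(3) by simp
qed

lemma cells_block: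
  assumes \<Omega>: "disjoint_family \<Omega>" "\<And>n. \<Omega> n \<in> sets M" "\<And>n. 0 < emeasure M (\<Omega> n)" "\<And>n. emeasure M (\<Omega> n) < \<infinity>"
  shows "cells M m (\<lambda>j. \<Omega> (k * m + j))"
  unfolding cells_def
proof (intro conjI allI impI \<Omega>(2-4))
  show "disjoint_family_on (\<lambda>j. \<Omega> (k * m + j)) {..<m}"
    unfolding disjoint_family_on_def
    using disjoint_family_onD[OF \<Omega>(1)] by auto
qed

context Lp_setting
begin

context
  fixes T :: "'x \<Rightarrow> 'x" and L :: real and m :: nat and A :: "nat \<Rightarrow> 'w set" and \<Omega> :: "nat \<Rightarrow> 'w set"
  assumes T: "T \<in> finite_rank_ops X X"
    and TL: "op_norm X X T \<le> L" and L: "0 \<le> L"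
    and A: "cells M m A"
    and \<Omega>: "disjoint_family \<Omega>" "\<And>n. \<Omega> n \<in> sets M" "\<And>n. 0 < emeasure M (\<Omega> n)" "\<And>n. emeasure M (\<Omega> n) < \<infinity>"
begin

abbreviation block where "block k \<equiv> \<lambda>j. \<Omega> (k * m + j)"

lemmas block_cells = cells_block[where \<Omega> = \<Omega> and M = M and m = m, OF \<Omega>]
lemmas T_rules = finite_rank_type_space(1,3)[OF T TL]

abbreviation U where "U k \<equiv> class_op (transport p M T m (block k) A)"
abbreviation W where "W k \<equiv> class_op (transport p M T m A (block k))"

text \<open>The outputs of the \<open>W k\<close> are disjointly supported, so the p-th powers of their norms add up, and
signs do not matter. The \<open>U k\<close> read disjoint parts of \<open>x\<close>, so the p-th powers of the norms of the
\<open>U k x\<close> add up to at most \<open>L\<close> to the power \<open>p\<close> times that of \<open>x\<close>. Hence the bound is independent of \<open>n\<close>.\<close>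

lemma signed_block_sum_le:
  assumes \<sigma>: "\<And>k. \<sigma> k \<in> {1, - 1}" and a: "a \<in> Lp.Bounded" and x: "x \<in> Lp.carr"
  shows "Lp.nrm (ns_sum Lp (\<lambda>k. ns_scale Lp (\<sigma> k) (W k (a (U k x)))) n)
    \<le> L * L * Lp.opn a * Lp.nrm x"
proof -
  obtain f where f: "f \<in> fns" "x = cls f" using x by (rule cls_cases)
  define F where "F i = (\<integral>x. indicator (\<Omega> i) x * norm (f x) powr p \<partial>M)" for i
  define c where "c = Lp.opn a"
  have c: "0 \<le> c" unfolding c_def by (rule Lp.Op_nonneg[OF a])
  note U_rules = p block_cells A T_rules L
  note W_rules = p A block_cells T_rules L
  have Ux: "U k x = cls (transport p M T m (block k) A f)" for k
    unfolding f(2) by (rule transport_op_cls[OF T TL L block_cells A f(1)])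
  have Uf: "transport p M T m (block k) A f \<in> fns" for k by (rule transport_Lp[OF U_rules])
  have "\<exists>g\<in>fns. a (U k x) = cls g" for k
  proof -
    have "a (U k x) \<in> Lp.carr" unfolding Ux by (intro bounded_ops_closed[OF a] cls_closed Uf)
    then show ?thesis by (rule cls_cases) blast
  qed
  then obtain g where g: "\<And>k. g k \<in> fns" "\<And>k. a (U k x) = cls (g k)" by metis
  define t where "t k = transport p M T m A (block k) (g k)" for k
  have t: "t k \<in> fns" for k unfolding t_def by (rule transport_Lp[OF W_rules])
  have "ns_scale Lp (\<sigma> k) (W k (a (U k x))) = cls (\<lambda>x. smul (\<sigma> k) (t k x))" for k
    unfolding g(2) transport_op_cls[OF T TL L A block_cells g(1)] t_def[symmetric] by (rule cls_scale[OF t])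
  then have sum: "ns_sum Lp (\<lambda>k. ns_scale Lp (\<sigma> k) (W k (a (U k x)))) n = cls (\<lambda>x. \<Sum>k<n. smul (\<sigma> k) (t k x))"
    by (simp add: cls_sum fns_scale t)
  have norm_\<sigma>: "norm (\<sigma> k) = 1" for k using \<sigma>[of k] by auto
  have g_le: "p_mass p M (g k) \<le> (c * L) powr p * (\<Sum>j<m. F (k * m + j))" for k
  proof -
    have "Lp_norm p M (g k) = Lp.nrm (a (U k x))" unfolding g(2) by (rule cls_norm[OF g(1), symmetric])
    also have "\<dots> \<le> c * Lp.nrm (U k x)"
      unfolding c_def by (rule Lp.Op_bound[OF a]) (use Ux cls_closed[OF Uf] in simp)
    also have "Lp.nrm (U k x) = Lp_norm p M (transport p M T m (block k) A f)" unfolding Ux by (rule cls_norm[OF Uf])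
    finally have "p_mass p M (g k) \<le> (c * Lp_norm p M (transport p M T m (block k) A f)) powr p"
      using c by (subst Lp_norm_le_iff[OF p, symmetric]) (auto simp: Lp_norm_nonneg)
    also have "\<dots> = c powr p * p_mass p M (transport p M T m (block k) A f)"
      by (simp add: powr_mult Lp_norm_powr[OF p])
    also have "\<dots> \<le> c powr p * (L powr p * (\<Sum>j<m. F (k * m + j)))"
      unfolding F_def by (intro mult_left_mono p_mass_transport_le[OF U_rules f(1)]) simp
    finally show ?thesis by (simp add: powr_mult mult.assoc)
  qed
  have t_le: "p_mass p M (t k) \<le> L powr p * p_mass p M (g k)" for k
  proof -
    have "p_mass p M (t k) \<le> (L * Lp_norm p M (g k)) powr p"
      using Lp_norm_transport_le[OF W_rules g(1), of k] L
      by (subst Lp_norm_le_iff[OF p, symmetric]) (auto simp: Lp_norm_nonneg t_def)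
    then show ?thesis by (simp add: powr_mult Lp_norm_powr[OF p])
  qed
  have supp: "\<exists>r<m. w \<in> \<Omega> (k * m + r)" if "t k w \<noteq> 0" for k w
  proof (rule ccontr)
    assume "\<not> (\<exists>r<m. w \<in> \<Omega> (k * m + r))"
    then have "t k w = 0" unfolding t_def transport_def step_def by (intro sum.neutral) simp
    with that show False by simp
  qed
  have pw: "norm (\<Sum>k<n. smul (\<sigma> k) (t k w)) powr p = (\<Sum>k<n. norm (t k w) powr p)" for w
  proof -
    have "norm (\<Sum>k<n. smul (\<sigma> k) (t k w)) powr p = (\<Sum>k<n. norm (smul (\<sigma> k) (t k w)) powr p)"
    proof (rule norm_sum_single_powr)
      fix i j assume "smul (\<sigma> i) (t i w) \<noteq> 0" "smul (\<sigma> j) (t j w) \<noteq> 0"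
      then have "t i w \<noteq> 0" "t j w \<noteq> 0" by auto
      then obtain r r' where r: "r < m" "r' < m" "w \<in> \<Omega> (i * m + r)" "w \<in> \<Omega> (j * m + r')" using supp by blast
      then have "i * m + r = j * m + r'" using disjoint_family_onD[OF \<Omega>(1)] by blast
      then show "i = j" using block_unique r(1,2) by blast
    qed
    then show ?thesis by (simp add: norm_scale norm_\<sigma>)
  qed
  have "p_mass p M (\<lambda>x. \<Sum>k<n. smul (\<sigma> k) (t k x)) = (\<integral>w. (\<Sum>k<n. norm (t k w) powr p) \<partial>M)"
    by (simp add: p_mass_def pw)
  also have "\<dots> = (\<Sum>k<n. p_mass p M (t k))"
    unfolding p_mass_def by (rule Bochner_Integration.integral_sum) (use t in \<open>simp add: Lp_functions_def\<close>)
  also have "\<dots> \<le> (\<Sum>k<n. L powr p * ((c * L) powr p * (\<Sum>j<m. F (k * m + j))))"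
    using t_le g_le by (intro sum_mono) (meson mult_left_mono order_trans powr_ge_zero)
  also have "\<dots> = L powr p * ((c * L) powr p * (\<Sum>i<n * m. F i))"
    unfolding sum_blocks[symmetric] by (simp only: sum_distrib_left)
  also have "\<dots> \<le> L powr p * ((c * L) powr p * p_mass p M f)"
  proof -
    have "cells M (n * m) \<Omega>" using cells_block[OF \<Omega>, of "n * m" 0] by simp
    from sum_integral_cells_le[OF p A A T_rules L f(1) this]
    show ?thesis unfolding F_def by (intro mult_left_mono) simp_all
  qed
  also have "\<dots> = (L * L * c * Lp_norm p M f) powr p"
    by (simp add: powr_mult Lp_norm_powr[OF p] mult_ac)
  finally have "Lp_norm p M (\<lambda>x. \<Sum>k<n. smul (\<sigma> k) (t k x)) \<le> L * L * c * Lp_norm p M f"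
    using L c by (subst Lp_norm_le_iff[OF p]) (simp_all add: Lp_norm_nonneg)
  then show ?thesis
    unfolding sum using f by (simp add: cls_norm Lp_functions_sum[OF _ p] fns_scale t c_def)
qed

text \<open>On a step function over the cells \<open>A\<close>, going to a block and back applies \<open>T\<close> twice to each value.\<close>

lemma back_and_forth_step:
  assumes y: "\<And>j. j < m \<Longrightarrow> norm (T (T (y j)) - y j) \<le> \<epsilon>" and \<epsilon>: "0 \<le> \<epsilon>"
  shows "Lp.nrm (Lp.minus (U k (W k (cls (step m A y)))) (cls (step m A y)))
    \<le> (\<Sum>j<m. measure M (A j)) powr (1 / p) * \<epsilon>"
proof -
  have st: "step m A z \<in> fns" for z by (rule step_Lp[OF A p])
  have "average M (A j) (step m A y) = y j" if "j < m" for j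
    by (rule average_const[OF p cellsD(1,2,3)[OF A that]]) (rule step_eq[OF A that])
  then have "step m A (\<lambda>j. T (T (average M (A j) (step m A y)))) = step m A (\<lambda>j. T (T (y j)))"
    by (auto simp: step_def fun_eq_iff)
  then have "U k (W k (cls (step m A y))) = cls (step m A (\<lambda>j. T (T (y j))))"
    using transport_back[OF p A block_cells T_rules L, of k "step m A y"]
    by (simp add: transport_op_cls[OF T TL L A block_cells st]
      transport_op_cls[OF T TL L block_cells A transport_Lp[OF p A block_cells T_rules L]])
  then have "Lp.nrm (Lp.minus (U k (W k (cls (step m A y)))) (cls (step m A y)))
    = Lp_norm p M (step m A (\<lambda>j. T (T (y j)) - y j))"
    using st by (simp add: cls_diff cls_norm flip: step_diff)
  also have "\<dots> \<le> (\<Sum>j<m. measure M (A j)) powr (1 / p) * \<epsilon>"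
  proof (subst Lp_norm_le_iff[OF p])
    have "p_mass p M (step m A (\<lambda>j. T (T (y j)) - y j)) \<le> (\<Sum>j<m. measure M (A j) * \<epsilon> powr p)"
      unfolding p_mass_step[OF A] using p y by (intro sum_mono mult_left_mono powr_mono2) auto
    also have "\<dots> = ((\<Sum>j<m. measure M (A j)) powr (1 / p) * \<epsilon>) powr p"
      using p by (simp add: powr_mult powr_powr sum_distrib_right sum_nonneg)
    finally show "p_mass p M (step m A (\<lambda>j. T (T (y j)) - y j)) \<le> ((\<Sum>j<m. measure M (A j)) powr (1 / p) * \<epsilon>) powr p" .
  qed (use \<epsilon> in simp)
  finally show ?thesis .
qed

end

text \<open>A common refinement of simple approximations to the points of \<open>B\<close> yields the cells, and their
values yield the finite set that \<open>T\<close> has to fix approximately.\<close>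

lemma amplified_factorizations:
  fixes \<Omega> :: "nat \<Rightarrow> 'w set"
  assumes L: "0 \<le> L"
    and approx: "\<And>K \<epsilon>. finite K \<Longrightarrow> 0 < \<epsilon> \<Longrightarrow> \<exists>T\<in>finite_rank_ops X X.
      op_norm X X T \<le> L \<and> (\<forall>x\<in>K. norm (T x - x) \<le> \<epsilon>)"
    and \<Omega>: "disjoint_family \<Omega>" "\<And>n. \<Omega> n \<in> sets M" "\<And>n. 0 < emeasure M (\<Omega> n)" "\<And>n. emeasure M (\<Omega> n) < \<infinity>"
    and B: "finite B" "B \<subseteq> Lp.carr" and \<eta>: "0 < \<eta>"
  shows "\<exists>u v. (\<forall>k<n. u k \<in> Lp.Fin_rank \<and> v k \<in> Lp.Fin_rank \<and>
        Lp.opn (u k) \<le> L \<and> Lp.opn (v k) \<le> L \<and>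
        (\<forall>b\<in>B. Lp.nrm (Lp.minus (u k (v k b)) b) \<le> \<eta>)) \<and>
      (\<forall>\<sigma>. (\<forall>k. \<sigma> k \<in> {1, - 1}) \<longrightarrow> (\<forall>a\<in>Lp.Bounded. \<forall>x\<in>Lp.carr.
        Lp.nrm (ns_sum Lp (\<lambda>k. ns_scale Lp (\<sigma> k) (v k (a (u k x)))) n) \<le> L * L * Lp.opn a * Lp.nrm x))"
proof -
  \<comment> \<open>Replacing a point by a step function costs \<open>\<delta>\<close> directly and \<open>L * L * \<delta>\<close> after applying \<open>u k\<close> and \<open>v k\<close>.\<close>
  define \<delta> where "\<delta> = \<eta> / 2 / (L * L + 1)"
  have \<delta>: "0 < \<delta>" "(L * L + 1) * \<delta> = \<eta> / 2"
  proof -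
    have pos: "0 < L * L + 1" using L by (simp add: add_nonneg_pos)
    have half: "X * (\<eta> / 2 / X) = \<eta> / 2" if "0 < X" for X using that by simp
    show "0 < \<delta>" using pos \<eta> by (simp add: \<delta>_def)
    show "(L * L + 1) * \<delta> = \<eta> / 2" unfolding \<delta>_def by (rule half[OF pos])
  qed
  have "\<forall>b\<in>B. \<exists>f. f \<in> fns \<and> b = cls f"
    using B(2) by (meson cls_cases subsetD)
  from bchoice[OF this] obtain f where f: "\<And>b. b \<in> B \<Longrightarrow> f b \<in> fns" "\<And>b. b \<in> B \<Longrightarrow> b = cls (f b)"
    by blast
  have "\<forall>b\<in>B. \<exists>s. simple_bochner_integrable M s \<and> Lp_norm p M (\<lambda>x. f b x - s x) \<le> \<delta>"
    using Lp_simple_dense[OF p f(1) \<delta>(1)] by blast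
  from bchoice[OF this] obtain s where s: "\<And>b. b \<in> B \<Longrightarrow> simple_bochner_integrable M (s b)"
    "\<And>b. b \<in> B \<Longrightarrow> Lp_norm p M (\<lambda>x. f b x - s b x) \<le> \<delta>" by blast
  note fs = f s
  obtain m A where A: "cells M m A" and "\<forall>s\<in>s ` B. \<exists>y. AE x in M. s x = step m A y x"
    using common_cells[of "s ` B" M] B(1) fs(3) by auto
  then obtain y where y: "\<And>b. b \<in> B \<Longrightarrow> AE x in M. s b x = step m A (y b) x" by (metis imageI)
  have cls_s: "cls (s b) = cls (step m A (y b))" if "b \<in> B" for b
    by (intro cls_eqI y that step_Lp[OF A p] Lp_functions_simple[OF fs(3) p])
  define R where "R = (\<Sum>j<m. measure M (A j)) powr (1 / p)"
  \<comment> \<open>Applying \<open>T\<close> twice moves a value by at most \<open>(L + 1) * \<epsilon>\<close>, and \<open>R\<close> is the p-norm of the indicator of the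
  union of the cells.\<close>
  define \<epsilon> where "\<epsilon> = \<eta> / 2 / ((L + 1) * (R + 1))"
  have R: "0 \<le> R" by (simp add: R_def)
  have \<epsilon>: "0 < \<epsilon>" "R * ((L + 1) * \<epsilon>) \<le> \<eta> / 2"
  proof -
    have LR: "0 < L + 1" "0 < R + 1" using L R by auto
    then show pos: "0 < \<epsilon>" using \<eta> by (simp add: \<epsilon>_def)
    have "R * ((L + 1) * \<epsilon>) \<le> (R + 1) * ((L + 1) * \<epsilon>)" using pos LR by (intro mult_right_mono) auto
    also have "\<dots> = \<eta> / 2"
    proof -
      have "b * (a * (\<eta> / 2 / (a * b))) = \<eta> / 2" if "0 < a" "0 < b" for a b using that by simp
      then show ?thesis unfolding \<epsilon>_def using LR by blast
    qed
    finally show "R * ((L + 1) * \<epsilon>) \<le> \<eta> / 2" .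
  qed
  define K where "K = (\<Union>b\<in>B. y b ` {..<m})"
  have "finite K" using B(1) by (simp add: K_def)
  then obtain T where T: "T \<in> finite_rank_ops X X"
    and TL: "op_norm X X T \<le> L" and TK: "\<And>x. x \<in> K \<Longrightarrow> norm (T x - x) \<le> \<epsilon>"
    using approx[OF _ \<epsilon>(1)] by blast
  note T_rules = finite_rank_type_space[OF T TL]
  have TT: "norm (T (T x) - x) \<le> (L + 1) * \<epsilon>" if "x \<in> K" for x
  proof -
    have "T (T x) - x = T (T x - x) + (T x - x)" by (simp add: linear_diff[OF T_rules(1)])
    then have "norm (T (T x) - x) \<le> norm (T (T x - x)) + norm (T x - x)" by (metis norm_triangle_ineq)
    also have "\<dots> \<le> L * norm (T x - x) + norm (T x - x)" using T_rules(3) by (intro add_right_mono)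
    also have "\<dots> = (L + 1) * norm (T x - x)" by (simp add: algebra_simps)
    also have "\<dots> \<le> (L + 1) * \<epsilon>" using TK[OF that] L by (intro mult_left_mono) auto
    finally show ?thesis .
  qed
  let ?block = "\<lambda>k j. \<Omega> (k * m + j)"
  define u where "u k = class_op (transport p M T m (?block k) A)" for k
  define v where "v k = class_op (transport p M T m A (?block k))" for k
  have cells: "cells M m (?block k)" for k by (rule cells_block[OF \<Omega>])
  have u: "u k \<in> Lp.Fin_rank" "u k \<in> Lp.Bounded" "Lp.opn (u k) \<le> L" for k
    unfolding u_def using transport_op_finite_rank[OF T TL L cells A] transport_op_bounded[OF T TL L cells A] by blast+
  have v: "v k \<in> Lp.Fin_rank" "v k \<in> Lp.Bounded" "Lp.opn (v k) \<le> L" for k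
    unfolding v_def using transport_op_finite_rank[OF T TL L A cells] transport_op_bounded[OF T TL L A cells] by blast+
  have near: "Lp.nrm (Lp.minus (u k (v k b)) b) \<le> \<eta>" if b: "b \<in> B" for k b
  proof -
    define b' where "b' = cls (s b)"
    have sf: "s b \<in> fns" by (rule Lp_functions_simple[OF fs(3)[OF b] p])
    have cl: "b \<in> Lp.carr" "b' \<in> Lp.carr" using B(2) b cls_closed[OF sf] by (auto simp: b'_def)
    have cl': "v k z \<in> Lp.carr" "u k z \<in> Lp.carr" if "z \<in> Lp.carr" for z
      using bounded_ops_closed[OF v(2) that] bounded_ops_closed[OF u(2) that] .
    note [simp] = cl cl' Lp.diff_closed
    have bb: "Lp.nrm (Lp.minus b b') \<le> \<delta>"
    proof -
      have "Lp.minus b b' = cls (\<lambda>x. f b x - s b x)"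
        unfolding b'_def using cls_diff[OF fs(1)[OF b] sf] fs(2)[OF b] by simp
      then show ?thesis using fs(4)[OF b] by (simp add: cls_norm[OF Lp_functions_diff[OF fs(1)[OF b] sf p]])
    qed
    have uv: "Lp.nrm (u k (v k z)) \<le> L * L * Lp.nrm z" if z: "z \<in> Lp.carr" for z
    proof -
      have le: "Lp.nrm (w z) \<le> L * Lp.nrm z" if "w \<in> Lp.Bounded" "Lp.opn w \<le> L" "z \<in> Lp.carr" for w z
        using Lp.Op_bound[OF that(1,3)] mult_right_mono[OF that(2) Lp.norm_nonneg[OF that(3)]] by linarith
      have "Lp.nrm (u k (v k z)) \<le> L * Lp.nrm (v k z)" by (rule le[OF u(2,3)]) (use z in simp)
      also have "\<dots> \<le> L * (L * Lp.nrm z)" by (intro mult_left_mono le v z L)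
      finally show ?thesis by (simp add: mult.assoc)
    qed
    have mid: "Lp.nrm (Lp.minus (u k (v k b')) b') \<le> \<eta> / 2"
    proof -
      have "Lp.nrm (Lp.minus (u k (v k b')) b') \<le> R * ((L + 1) * \<epsilon>)"
        unfolding b'_def cls_s[OF b] u_def v_def R_def
        by (rule back_and_forth_step[OF T TL L A \<Omega>]) (use TT L \<epsilon>(1) b in \<open>auto simp: K_def\<close>)
      then show ?thesis using \<epsilon>(2) by linarith
    qed
    have "Lp.minus (u k (v k b)) b = ns_add Lp (u k (v k (Lp.minus b b')))
      (ns_add Lp (Lp.minus (u k (v k b')) b') (Lp.minus b' b))"
      by (simp add: Lp.Op_linear(3)[OF v(2)] Lp.Op_linear(3)[OF u(2)] Lp.diff_add_diff)
    then have "Lp.nrm (Lp.minus (u k (v k b)) b) \<le> Lp.nrm (u k (v k (Lp.minus b b')))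
      + (Lp.nrm (Lp.minus (u k (v k b')) b') + Lp.nrm (Lp.minus b' b))"
      using Lp.norm_triangle[of "u k (v k (Lp.minus b b'))" "ns_add Lp (Lp.minus (u k (v k b')) b') (Lp.minus b' b)"]
        Lp.norm_triangle[of "Lp.minus (u k (v k b')) b'" "Lp.minus b' b"] by (simp add: Lp.add_closed)
    also have "\<dots> \<le> L * L * \<delta> + (\<eta> / 2 + \<delta>)"
    proof (intro add_mono mid)
      have "Lp.nrm (u k (v k (Lp.minus b b'))) \<le> L * L * Lp.nrm (Lp.minus b b')" by (rule uv) simp
      also have "\<dots> \<le> L * L * \<delta>" using bb L by (intro mult_left_mono) auto
      finally show "Lp.nrm (u k (v k (Lp.minus b b'))) \<le> L * L * \<delta>" .
      show "Lp.nrm (Lp.minus b' b) \<le> \<delta>" using bb Lp.norm_diff_commute[OF cl] by simp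
    qed
    also have "\<dots> = \<eta>" using \<delta>(2) by (simp add: algebra_simps)
    finally show ?thesis .
  qed
  have signs: "Lp.nrm (ns_sum Lp (\<lambda>k. ns_scale Lp (\<sigma> k) (v k (a (u k x)))) n) \<le> L * L * Lp.opn a * Lp.nrm x"
    if "\<forall>k. \<sigma> k \<in> {1, - 1}" "a \<in> Lp.Bounded" "x \<in> Lp.carr" for \<sigma> a x
    unfolding u_def v_def by (rule signed_block_sum_le[OF T TL L A \<Omega> _ that(2,3)]) (use that(1) in blast)
  show ?thesis
    by (rule exI[of _ u], rule exI[of _ v]) (use u v near signs in blast)
qed

end

theorem theorem4p4:
  fixes p :: real
    and M :: "'w measure"
    and \<Omega> :: "nat \<Rightarrow> 'w set"
    and smul :: "'k::real_or_complex \<Rightarrow> 'x::banach \<Rightarrow> 'x"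
  assumes "1 \<le> p"
    and "\<And>n. \<Omega> n \<in> sets M"
    and "disjoint_family \<Omega>"
    and "\<And>n. 0 < emeasure M (\<Omega> n)"
    and "\<And>n. emeasure M (\<Omega> n) < \<infinity>"
    and "banach_space_over smul"
    and "bounded_approximation_property smul"
  shows "weakly_amenable (approximable_algebra (Lp_space p M smul))"
proof -
  interpret banach_space_over smul by (rule assms(6))
  interpret Lp_setting smul p M by standard (rule assms(1))
  obtain \<Lambda> where \<Lambda>: "\<And>K \<epsilon>. compact K \<and> 0 < \<epsilon> \<longrightarrow>
      (\<exists>T\<in>finite_rank_ops X X.
         op_norm X X T \<le> \<Lambda> \<and> (\<forall>x\<in>K. norm (T x - x) \<le> \<epsilon>))"
    using assms(7) unfolding bounded_approximation_property_def by blast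
  \<comment> \<open>The constant in the approximation property may be taken nonnegative.\<close>
  have approx: "\<exists>T\<in>finite_rank_ops X X.
      op_norm X X T \<le> max \<Lambda> 0 \<and> (\<forall>x\<in>K. norm (T x - x) \<le> \<epsilon>)"
    if "finite K" "0 < \<epsilon>" for K \<epsilon>
    using \<Lambda>[of K \<epsilon>] finite_imp_compact[OF that(1)] that(2) by (meson max.coboundedI1)
  show ?thesis
    by (rule weakly_amenable_approximable_algebra[OF normed_space_Lp, of "max \<Lambda> 0"])
      (simp, rule amplified_factorizations[OF _ approx assms(3,2,4,5)], simp_all)
qed

end
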